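(* Let $\theta\in\Theta$ (i.e. $\rho(A_0)<1$), and assume that the noise $(\xi_n)_{n\ge1}$ satisfies: $r(n)=O(n^{-\alpha_1})$ as $n\to\infty$ for some $\alpha_1>0$; $\int_{-\pi}^{\pi}|\log f_\xi(\lambda)|\,d\lambda<\infty$; and $\beta_n^2=O(n^{-\alpha_2})$ for some $\alpha_2>1$. Then, when the true parameter is $\theta$, the maximum likelihood estimator is strongly consistent: $\widehat\theta_n\to\theta$ almost surely as $n\to\infty$.
   Context: Fix an integer $p\ge1$. $A^*$ is the transpose of $A$, $Id_p$ the $p\times p$ identity matrix, $\rho(\cdot)$ the spectral radius. Noise: $(\xi_n)_{n\ge1}$ is a real stationary centered Gaussian process with covariance function $r(n)=\mathbb{E}(\xi_1\xi_{1+n})$, $r(0)=1$, and spectral density $f_\xi$. Let $\sigma_1\varepsilon_1=\xi_1$, $\sigma_1=1$, and for $n\ge2$, $\sigma_n\varepsilon_n=\xi_n-\mathbb{E}(\xi_n\mid\xi_1,\dots,\xi_{n-1})$, where $\sigma_n>0$ and the $\varepsilon_n$ are i.i.d. $\mathcal N(0,1)$. Write $\sigma_n\varepsilon_n=\sum_{i=1}^n k(n,i)\xi_i$ with deterministic $k(n,i)$, $k(n,n)=1$. For $n\ge1$, $\beta_n=-k(n+1,1)$ (the partial autocorrelation function, PACF, of $(\xi_n)$); by convention $\beta_0=1$ (it plays no role below since $\zeta_0=0$). One has $\sigma_n^2=\prod_{i=1}^{n-1}(1-\beta_i^2)$. Model: $X_n=\sum_{i=1}^p\theta_iX_{n-i}+\xi_n$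 for $n\ge1$, with $X_n=0$ for $n\le0$ and $\theta=(\theta_1,\dots,\theta_p)^*\in\mathbb{R}^p$. $A_0$ is the $p\times p$ companion matrix with first row $(\theta_1,\dots,\theta_p)$, ones on the subdiagonal and zeros elsewhere. $\Theta=\{\theta\in\mathbb{R}^p:\rho(A_0)<1\}$. Let $Y_n=(X_n,\dots,X_{n-p+1})^*$, $Z_n=\sum_{i=1}^nk(n,i)Y_i$, and $\zeta_n=\begin{pmatrix}Z_n\\ \sum_{k=1}^{n-1}\beta_kZ_k\end{pmatrix}\in\mathbb{R}^{2p}$ for $n\ge1$, $\zeta_0=0$. Then $\zeta_n=\widetilde A_{n-1}\zeta_{n-1}+\ell\sigma_n\varepsilon_n$ with $\widetilde A_n=\begin{pmatrix}A_0&\beta_nA_0\\ \beta_nId_p&Id_p\end{pmatrix}$ and $\ell=(1,0,\dots,0)^*\in\mathbb{R}^{2p}$. MLE: with $a_n=(Id_p,\beta_nId_p)^*$ (a $2p\times p$ matrix), $$\widehat\theta_n=\Big(\sum_{i=1}^n\frac{a_{i-1}^*\zeta_{i-1}\zeta_{i-1}^*a_{i-1}}{\sigma_i^2}\Big)^{-1}\Big(\sum_{i=1}^n\frac{a_{i-1}^*\zeta_{i-1}\,\ell^*\zeta_i}{\sigma_i^2}\Big)$$ (defined when the matrix is invertible). *)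

theory Defs
  imports
    "HOL-Probability.Probability"
    "HOL-Library.Landau_Symbols"
    "Jordan_Normal_Form.Spectral_Radius"
    "Jordan_Normal_Form.Gauss_Jordan_Elimination"
begin

no_notation vec_nth (infixl \<open>$\<close> 90)

text \<open>
  Processes are families of random variables indexed by \<^typ>\<open>nat\<close>; for the noise and its
  innovations only the indices \<open>n \<ge> 1\<close> are meaningful, index \<open>0\<close> is unconstrained.
  Dirac measures count as (degenerate) Gaussian laws.
\<close>

definition gaussian_rv :: "'w measure \<Rightarrow> ('w \<Rightarrow> real) \<Rightarrow> bool" where
  "gaussian_rv M Y \<longleftrightarrow> Y \<in> borel_measurable M \<and>
     ((\<exists>m s. s > 0 \<and> distributed M lborel Y (\<lambda>x. ennreal (normal_density m s x))) \<or>
      (\<exists>m. AE w in M. Y w = m))"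

definition gaussian_process :: "'w measure \<Rightarrow> (nat \<Rightarrow> 'w \<Rightarrow> real) \<Rightarrow> bool" where
  "gaussian_process M xi \<longleftrightarrow>
     (\<forall>I c. finite I \<longrightarrow> I \<subseteq> {1..} \<longrightarrow> gaussian_rv M (\<lambda>w. \<Sum>i\<in>I. c i * xi i w))"

definition covariance_function :: "'w measure \<Rightarrow> (nat \<Rightarrow> 'w \<Rightarrow> real) \<Rightarrow> nat \<Rightarrow> real" where
  "covariance_function M xi n = integral\<^sup>L M (\<lambda>w. xi 1 w * xi (1 + n) w)"

text \<open>For a centered Gaussian process, stationarity is the invariance of the covariance under
  time shifts.\<close>

definition stationary_centered_gaussian :: "'w measure \<Rightarrow> (nat \<Rightarrow> 'w \<Rightarrow> real) \<Rightarrow> bool" where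
  "stationary_centered_gaussian M xi \<longleftrightarrow>
     gaussian_process M xi \<and>
     (\<forall>n\<ge>1. integral\<^sup>L M (xi n) = 0) \<and>
     (\<forall>m\<ge>1. \<forall>n. integral\<^sup>L M (\<lambda>w. xi m w * xi (m + n) w) = covariance_function M xi n)"

text \<open>Normalisation: \<open>r n = \<integral> exp (\<i> n \<lambda>) f \<lambda> d\<lambda>\<close> over \<open>[-\<pi>, \<pi>]\<close>. The alternative convention
  with a factor \<open>1 / (2 \<pi>)\<close> only changes \<open>log f\<close> by an additive constant.\<close>

definition spectral_density :: "(nat \<Rightarrow> real) \<Rightarrow> (real \<Rightarrow> real) \<Rightarrow> bool" where
  "spectral_density r f \<longleftrightarrow>
     f \<in> borel_measurable borel \<and>
     (\<forall>l\<in>{-pi..pi}. f l \<ge> 0) \<and>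
     set_integrable lborel {-pi..pi} f \<and>
     (\<forall>n. complex_of_real (r n) = (LINT l:{-pi..pi}|lborel. f l *\<^sub>R cis (real n * l)))"

text \<open>The library has \<open>ln 0 = 0\<close>; here \<open>\<bar>log 0\<bar> = \<infinity>\<close>, so that integrability of \<open>\<bar>log f\<bar>\<close> excludes
  vanishing of \<open>f\<close> on a set of positive measure.\<close>

definition abs_log :: "real \<Rightarrow> ennreal" where
  "abs_log x = (if x > 0 then ennreal \<bar>ln x\<bar> else \<infinity>)"

definition past :: "'w measure \<Rightarrow> (nat \<Rightarrow> 'w \<Rightarrow> real) \<Rightarrow> nat \<Rightarrow> 'w measure" where
  "past M xi n = sigma (space M) (\<Union>i\<in>{1..<n}. {xi i -` B \<inter> space M | B. B \<in> sets borel})"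

definition innovation :: "'w measure \<Rightarrow> (nat \<Rightarrow> 'w \<Rightarrow> real) \<Rightarrow> nat \<Rightarrow> 'w \<Rightarrow> real" where
  "innovation M xi n =
     (if n = 1 then xi 1 else (\<lambda>w. xi n w - real_cond_exp M (past M xi n) (xi n) w))"

text \<open>The data \<open>\<sigma>\<^sub>n\<close>, \<open>\<epsilon>\<^sub>n\<close>, \<open>k(n,i)\<close> attached to the noise. Since the innovation of a Gaussian
  process with \<open>\<sigma>\<^sub>n > 0\<close> is a non-degenerate linear combination of \<open>\<xi>\<^sub>1, \<dots>, \<xi>\<^sub>n\<close>, they exist and
  the numbers \<open>\<sigma>\<^sub>n\<close> and \<open>k(n,i)\<close>, \<open>1 \<le> i \<le> n\<close>, are determined by the noise.\<close>

definition innovation_decomposition ::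
  "'w measure \<Rightarrow> (nat \<Rightarrow> 'w \<Rightarrow> real) \<Rightarrow> (nat \<Rightarrow> real) \<Rightarrow> (nat \<Rightarrow> 'w \<Rightarrow> real)
   \<Rightarrow> (nat \<Rightarrow> nat \<Rightarrow> real) \<Rightarrow> bool" where
  "innovation_decomposition M xi sig eps k \<longleftrightarrow>
     sig 1 = 1 \<and>
     (\<forall>n\<ge>1. sig n > 0) \<and>
     prob_space.indep_vars M (\<lambda>_. borel) eps {1..} \<and>
     (\<forall>n\<ge>1. distributed M lborel (eps n) (\<lambda>x. ennreal (std_normal_density x))) \<and>
     (\<forall>n\<ge>1. AE w in M. sig n * eps n w = innovation M xi n w) \<and>
     (\<forall>n\<ge>1. k n n = 1) \<and>
     (\<forall>n\<ge>1. AE w in M. sig n * eps n w = (\<Sum>i=1..n. k n i * xi i w))"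

definition pacf :: "(nat \<Rightarrow> nat \<Rightarrow> real) \<Rightarrow> nat \<Rightarrow> real" where
  "pacf k n = (if n = 0 then 1 else - k (n + 1) 1)"

text \<open>Vectors and matrices are indexed from \<open>0\<close>, so the coefficient \<open>\<theta>\<^sub>i\<close> is \<open>\<theta> $ (i - 1)\<close>.\<close>

definition companion :: "nat \<Rightarrow> real Matrix.vec \<Rightarrow> real mat" where
  "companion p \<theta> = Matrix.mat p p
     (\<lambda>(i, j). if i = 0 then \<theta> $ j else if i = j + 1 then 1 else 0)"

definition Theta :: "nat \<Rightarrow> real Matrix.vec set" where
  "Theta p = {\<theta> \<in> carrier_vec p. spectral_radius (map_mat complex_of_real (companion p \<theta>)) < 1}"

definition ar_model ::
  "'w measure \<Rightarrow> nat \<Rightarrow> real Matrix.vec \<Rightarrow> (nat \<Rightarrow> 'w \<Rightarrow> real) \<Rightarrow> (int \<Rightarrow> 'w \<Rightarrow> real) \<Rightarrow> bool" where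
  "ar_model M p \<theta> xi X \<longleftrightarrow> (\<forall>w\<in>space M.
     (\<forall>n\<le>0. X n w = 0) \<and>
     (\<forall>n\<ge>1. X n w = (\<Sum>i=1..p. \<theta> $ (i - 1) * X (n - int i) w) + xi (nat n) w))"

text \<open>Everything below is a function of one trajectory \<open>x\<close> of the process \<open>X\<close>.\<close>

definition Yvec :: "nat \<Rightarrow> (int \<Rightarrow> real) \<Rightarrow> nat \<Rightarrow> real Matrix.vec" where
  "Yvec p x n = Matrix.vec p (\<lambda>j. x (int n - int j))"

definition Zvec :: "nat \<Rightarrow> (nat \<Rightarrow> nat \<Rightarrow> real) \<Rightarrow> (int \<Rightarrow> real) \<Rightarrow> nat \<Rightarrow> real Matrix.vec" where
  "Zvec p k x n = Matrix.vec p (\<lambda>j. \<Sum>i=1..n. k n i * Yvec p x i $ j)"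

definition zeta :: "nat \<Rightarrow> (nat \<Rightarrow> nat \<Rightarrow> real) \<Rightarrow> (int \<Rightarrow> real) \<Rightarrow> nat \<Rightarrow> real Matrix.vec" where
  "zeta p k x n =
     (if n = 0 then 0\<^sub>v (2 * p)
      else Zvec p k x n @\<^sub>v Matrix.vec p (\<lambda>j. \<Sum>m=1..<n. pacf k m * Zvec p k x m $ j))"

definition amat :: "nat \<Rightarrow> (nat \<Rightarrow> nat \<Rightarrow> real) \<Rightarrow> nat \<Rightarrow> real mat" where
  "amat p k n = 1\<^sub>m p @\<^sub>r (pacf k n \<cdot>\<^sub>m 1\<^sub>m p)"

definition outer :: "real Matrix.vec \<Rightarrow> real Matrix.vec \<Rightarrow> real mat" where
  "outer u v = Matrix.mat (dim_vec u) (dim_vec v) (\<lambda>(i, j). u $ i * v $ j)"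

definition mle_matrix ::
  "nat \<Rightarrow> (nat \<Rightarrow> nat \<Rightarrow> real) \<Rightarrow> (nat \<Rightarrow> real) \<Rightarrow> (int \<Rightarrow> real) \<Rightarrow> nat \<Rightarrow> real mat" where
  "mle_matrix p k sig x n = Matrix.mat p p (\<lambda>rc. \<Sum>i=1..n.
     (transpose_mat (amat p k (i - 1)) * outer (zeta p k x (i - 1)) (zeta p k x (i - 1))
        * amat p k (i - 1)) $$ rc / (sig i)\<^sup>2)"

definition mle_vector ::
  "nat \<Rightarrow> (nat \<Rightarrow> nat \<Rightarrow> real) \<Rightarrow> (nat \<Rightarrow> real) \<Rightarrow> (int \<Rightarrow> real) \<Rightarrow> nat \<Rightarrow> real Matrix.vec" where
  "mle_vector p k sig x n = Matrix.vec p (\<lambda>j. \<Sum>i=1..n.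
     (transpose_mat (amat p k (i - 1)) *\<^sub>v zeta p k x (i - 1)) $ j
        * (unit_vec (2 * p) 0 \<bullet> zeta p k x i) / (sig i)\<^sup>2)"

text \<open>The estimator is \<^const>\<open>None\<close> exactly when the matrix is not invertible.\<close>

definition mle ::
  "nat \<Rightarrow> (nat \<Rightarrow> nat \<Rightarrow> real) \<Rightarrow> (nat \<Rightarrow> real) \<Rightarrow> (int \<Rightarrow> real) \<Rightarrow> nat \<Rightarrow> real Matrix.vec option" where
  "mle p k sig x n =
     map_option (\<lambda>B. B *\<^sub>v mle_vector p k sig x n) (mat_inverse (mle_matrix p k sig x n))"

text \<open>Convergence of an estimator sequence: it is eventually defined and converges componentwise
  (vectors from \<^theory>\<open>Jordan_Normal_Form.Matrix\<close> carry no topology).\<close>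

definition estimator_tendsto ::
  "nat \<Rightarrow> (nat \<Rightarrow> real Matrix.vec option) \<Rightarrow> real Matrix.vec \<Rightarrow> bool" where
  "estimator_tendsto p T \<theta> \<longleftrightarrow>
     (\<forall>\<^sub>F n in sequentially. T n \<noteq> None) \<and>
     (\<forall>j<p. (\<lambda>n. the (T n) $ j) \<longlonglongrightarrow> \<theta> $ j)"

end

theory Submission
  imports Defs "HOL-Library.Discrete_Functions"
begin

text \<open>The innovations are linear combinations of the noise and conversely, so they are orthogonal to the
  past, which yields the Durbin-Levinson recursion for the coefficients \<open>k(n,i)\<close>. It turns the
  likelihood into a linear regression of the first coordinate of \<open>Z\<^sub>n\<^sub>+\<^sub>1\<close> on
  \<open>H\<^sub>n = a\<^sub>n\<^sup>* \<zeta>\<^sub>n = Z\<^sub>n + u\<^sub>n\<close>, with independent errors \<open>\<sigma>\<^sub>n \<epsilon>\<^sub>n\<close> and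
  \<open>Z\<^sub>n\<^sub>+\<^sub>1 = A\<^sub>0 H\<^sub>n + \<sigma>\<^sub>n\<^sub>+\<^sub>1 \<epsilon>\<^sub>n\<^sub>+\<^sub>1 e\<^sub>1\<close>, where \<open>u\<^sub>n = \<beta>\<^sub>n \<Sum>\<^sub>k\<^sub><\<^sub>n \<beta>\<^sub>k Z\<^sub>k\<close>.

  The long memory is only a small perturbation of a stable autoregression: by Cauchy-Schwarz and a
  discrete Gronwall argument \<open>\<parallel>u\<^sub>n\<parallel>\<^sup>2\<close> is at most a constant times
  \<open>\<beta>\<^sub>n\<^sup>2 \<Sum>\<^sub>i\<^sub>\<le>\<^sub>n \<epsilon>\<^sub>i\<^sup>2\<close> on every trajectory, which tends to \<open>0\<close> because \<open>n \<beta>\<^sub>n\<^sup>2\<close> does. Hence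
  \<open>\<Sum>\<^sub>i\<^sub><\<^sub>n (v \<bullet> H\<^sub>i)\<^sup>2\<close> grows at least linearly in \<open>n\<close>, uniformly over unit vectors \<open>v\<close>, while the
  noise term \<open>\<Sum>\<^sub>i\<^sub>\<le>\<^sub>n H\<^sub>i\<^sub>-\<^sub>1 \<epsilon>\<^sub>i / \<sigma>\<^sub>i\<close> is a sum of orthogonal variables with bounded variances and so
  is \<open>o(n)\<close> almost surely.\<close>

section \<open>Perturbed stable recursions\<close>

text \<open>The recursion matrices of \<open>zeta\<close> tend to the block diagonal matrix of
  \<open>A_0\<close> and the identity, which has eigenvalue 1, so that recursion does not contract
  and bounds nothing by itself. The proof therefore keeps only the first block \<open>Z n\<close> as
  state, on which the stable companion matrix acts, and feeds the second block back as an input. The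
  decay of the partial autocorrelations is used in two ways: their square summability makes the
  Gronwall factor finite and keeps the innovation variances away from 0, while
  \<open>n * beta n ^ 2\<close> tending to 0 beats the linear growth of the noise energy.

  The estimation error is the inverse of the weighted Gram matrix of the regressors applied to the
  noise term. A lower bound of order \<open>n\<close> for the former and \<open>o(n)\<close> for the
  latter already force the error to 0. All bounds on a trajectory hold with nonrandom constants, so
  they can also be integrated; the resulting second moments feed a strong law for orthogonal
  variables. To apply it, each regressor must be a finite linear combination of earlier innovations
  with nonrandom coefficients.\<close>

lemma weighted_Cauchy_Schwarz:
  fixes w x :: "'a \<Rightarrow> real"
  assumes "\<And>i. i \<in> I \<Longrightarrow> w i \<ge> 0"
  shows "(\<Sum>i\<in>I. w i * x i)\<^sup>2 \<le> (\<Sum>i\<in>I. w i) * (\<Sum>i\<in>I. w i * (x i)\<^sup>2)"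
proof -
  have "(\<Sum>i\<in>I. w i * x i) = (\<Sum>i\<in>I. sqrt (w i) * (sqrt (w i) * x i))"
    by (rule sum.cong) (use assms in \<open>auto simp flip: mult.assoc\<close>)
  also have "\<dots>\<^sup>2 \<le> (\<Sum>i\<in>I. (sqrt (w i))\<^sup>2) * (\<Sum>i\<in>I. (sqrt (w i) * x i)\<^sup>2)"
    by (rule Cauchy_Schwarz_ineq_sum)
  also have "(\<Sum>i\<in>I. (sqrt (w i))\<^sup>2) = (\<Sum>i\<in>I. w i)"
    by (rule sum.cong) (use assms in auto)
  also have "(\<Sum>i\<in>I. (sqrt (w i) * x i)\<^sup>2) = (\<Sum>i\<in>I. w i * (x i)\<^sup>2)"
    by (rule sum.cong) (use assms in \<open>auto simp: power_mult_distrib\<close>)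
  finally show ?thesis .
qed

lemma square_add_le: "(x + y)\<^sup>2 \<le> 2 * x\<^sup>2 + 2 * (y::real)\<^sup>2"
  using sum_squares_bound[of x y] by (simp add: power2_sum)

lemma Cesaro_tendsto:
  fixes x :: "nat \<Rightarrow> real"
  assumes "x \<longlonglongrightarrow> L"
  shows "(\<lambda>n. (\<Sum>i<n. x i) / real n) \<longlonglongrightarrow> L"
proof (rule LIMSEQ_I)
  fix r :: real assume r: "r > 0"
  obtain N where N: "\<And>i. i \<ge> N \<Longrightarrow> \<bar>x i - L\<bar> < r / 2"
    using LIMSEQ_D[OF assms, of "r / 2"] r by auto
  define C where "C = (\<Sum>i<N. \<bar>x i - L\<bar>)"
  have C: "C \<ge> 0" unfolding C_def by (rule sum_nonneg) auto
  obtain N1 :: nat where N1: "real N1 > 2 * C / r" using reals_Archimedean2 by blast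
  show "\<exists>no. \<forall>n\<ge>no. norm ((\<Sum>i<n. x i) / real n - L) < r"
  proof (intro exI allI impI)
    fix n assume n: "n \<ge> max (Suc N) (Suc N1)"
    have "\<bar>\<Sum>i<n. x i - L\<bar> \<le> (\<Sum>i<n. \<bar>x i - L\<bar>)" by (rule sum_abs)
    also have "\<dots> = C + (\<Sum>i=N..<n. \<bar>x i - L\<bar>)"
      unfolding C_def using n by (simp add: lessThan_atLeast0 sum.atLeastLessThan_concat)
    also have "(\<Sum>i=N..<n. \<bar>x i - L\<bar>) \<le> (\<Sum>i=N..<n. r / 2)"
      by (rule sum_mono) (use N in \<open>auto intro: less_imp_le\<close>)
    also have "\<dots> \<le> real n * (r / 2)" using r by (simp add: mult_right_mono)
    also have "C < real n * (r / 2)"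
    proof -
      have "2 * C / r < real n" using N1 n by linarith
      then show ?thesis using r by (simp add: field_simps)
    qed
    finally have "\<bar>\<Sum>i<n. x i - L\<bar> < r * real n" by (simp add: mult.commute)
    moreover have "(\<Sum>i<n. x i) / real n - L = (\<Sum>i<n. x i - L) / real n"
      using n by (simp add: sum_subtractf field_simps)
    ultimately show "norm ((\<Sum>i<n. x i) / real n - L) < r"
      using n by (simp add: abs_divide pos_divide_less_eq)
  qed
qed

text \<open>Only the averages are assumed to converge: the application is to products of noise
  values, which have no limit themselves.\<close>

lemma Cesaro_shift:
  fixes x :: "nat \<Rightarrow> real"
  assumes "(\<lambda>n. (\<Sum>i<n. x i) / real n) \<longlonglongrightarrow> L"
  shows "(\<lambda>n. (\<Sum>i<n. x (i + c)) / real n) \<longlonglongrightarrow> L"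
proof -
  let ?S = "\<lambda>n. \<Sum>i<n. x i"
  have *: "(\<Sum>i<n. x (i + c)) = ?S (n + c) - ?S c" for n
    by (induction n) auto
  have "(\<lambda>n. ?S (n + c) / real (n + c) * (real (n + c) / real n) - ?S c / real n) \<longlonglongrightarrow> L * 1 - 0"
  proof (intro tendsto_diff tendsto_mult)
    show "(\<lambda>n. ?S (n + c) / real (n + c)) \<longlonglongrightarrow> L"
      using LIMSEQ_ignore_initial_segment[OF assms, of c] .
    show "(\<lambda>n. real (n + c) / real n) \<longlonglongrightarrow> 1"
    proof -
      have "(\<lambda>n. 1 + real c / real n) \<longlonglongrightarrow> 1 + 0"
        by (intro tendsto_add tendsto_const lim_const_over_n)
      moreover have "\<forall>\<^sub>F n in sequentially. 1 + real c / real n = real (n + c) / real n"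
        using eventually_gt_at_top[of 0] by eventually_elim (simp add: field_simps)
      ultimately show ?thesis by (auto intro: Lim_transform_eventually)
    qed
    show "(\<lambda>n. ?S c / real n) \<longlonglongrightarrow> 0" by (rule lim_const_over_n)
  qed
  moreover have "\<forall>\<^sub>F n in sequentially. ?S (n + c) / real (n + c) * (real (n + c) / real n) - ?S c / real n
      = (\<Sum>i<n. x (i + c)) / real n"
    using eventually_gt_at_top[of 0] by eventually_elim (simp add: * diff_divide_distrib)
  ultimately show ?thesis by (auto intro: Lim_transform_eventually)
qed

text \<open>In the induction step, monotonicity replaces every earlier \<open>E m\<close> by
  \<open>E n\<close>. What remains, one plus the sum of \<open>b m\<close> times the partial
  products, telescopes to the full product.\<close>

lemma discrete_Gronwall:
  fixes x E b :: "nat \<Rightarrow> real"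
  assumes x: "\<And>n. x n \<le> E n + (\<Sum>m<n. b m * x m)"
    and b: "\<And>n. b n \<ge> 0" and E: "mono E" "\<And>n. E n \<ge> 0"
  shows "x n \<le> E n * (\<Prod>m<n. 1 + b m)"
proof (induction n rule: less_induct)
  case (less n)
  let ?P = "\<lambda>n. \<Prod>m<n. 1 + b m"
  have P: "?P m \<ge> 0" for m using b by (intro prod_nonneg) (auto simp: add_nonneg_nonneg)
  have "(\<Sum>m<n. b m * x m) \<le> (\<Sum>m<n. b m * (E n * ?P m))"
  proof (rule sum_mono)
    fix m assume m: "m \<in> {..<n}"
    have "x m \<le> E m * ?P m" using less m by auto
    also have "\<dots> \<le> E n * ?P m" using m by (intro mult_right_mono P monoD[OF E(1)]) auto
    finally show "b m * x m \<le> b m * (E n * ?P m)" using b by (rule mult_left_mono)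
  qed
  also have "\<dots> = E n * (\<Sum>m<n. b m * ?P m)" by (simp add: sum_distrib_left mult_ac)
  also have "(\<Sum>m<n. b m * ?P m) = ?P n - 1" by (induction n) (auto simp: algebra_simps)
  finally show ?case using x[of n] by (simp add: algebra_simps)
qed

lemma geometric_convolution_sum_le:
  fixes G :: "nat \<Rightarrow> real"
  assumes q: "0 < q" "q < 1" and G: "\<And>n. G n \<ge> 0"
  shows "(\<Sum>n=1..N. \<Sum>m=1..n. q ^ (n - m) * G m) \<le> (\<Sum>m=1..N. G m) / (1 - q)"
proof -
  define C where "C = (\<lambda>n. \<Sum>m=1..n. q ^ (n - m) * G m)"
  have C0: "C 0 = 0" unfolding C_def by simp
  have rec: "C (Suc n) = q * C n + G (Suc n)" for n
    unfolding C_def by (auto simp: sum_distrib_left Suc_diff_le intro!: sum.cong)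
  have "(1 - q) * (\<Sum>n=1..N. C n) + q * C N = (\<Sum>m=1..N. G m)"
  proof (induction N)
    case (Suc N)
    have "(1 - q) * (\<Sum>n=1..Suc N. C n) + q * C (Suc N)
        = ((1 - q) * (\<Sum>n=1..N. C n) + q * C N) + (C (Suc N) - q * C N)"
      by (simp add: algebra_simps)
    also have "\<dots> = (\<Sum>m=1..Suc N. G m)" unfolding Suc.IH by (simp add: rec)
    finally show ?case .
  qed (simp add: C0)
  moreover have "C N \<ge> 0" unfolding C_def using q G by (intro sum_nonneg) auto
  ultimately have "(1 - q) * (\<Sum>n=1..N. C n) \<le> (\<Sum>m=1..N. G m)"
    using q by (smt (verit) mult_nonneg_nonneg)
  then show ?thesis using q unfolding C_def by (simp add: pos_le_divide_eq mult.commute)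
qed

lemma geometric_sum_le:
  fixes q :: real
  assumes q: "0 < q" "q < 1"
  shows "(\<Sum>m=1..n. q ^ (n - m)) \<le> 1 / (1 - q)"
proof -
  have rec: "(\<Sum>m=1..n. q ^ (n - m)) = (\<Sum>i<n. q ^ i)"
    by (rule sum.reindex_bij_witness[of _ "\<lambda>i. n - i" "\<lambda>m. n - m"]) auto
  have "(\<Sum>i<n. q ^ i) = (1 - q ^ n) / (1 - q)" using q by (simp add: sum_gp_strict)
  also have "\<dots> \<le> 1 / (1 - q)" using q by (intro divide_right_mono) auto
  finally show ?thesis unfolding rec .
qed

text \<open>Variation of constants. \<open>P k\<close> stands for the \<open>k\<close>-th power of
  the matrix \<open>a\<close>, given by entries and by left multiplication with
  \<open>a\<close>.\<close>

lemma linear_recursion_solution: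
  fixes a :: "nat \<Rightarrow> nat \<Rightarrow> real"
  assumes P0: "\<And>j l. j < p \<Longrightarrow> l < p \<Longrightarrow> P 0 j l = (if j = l then 1 else 0)"
    and PS: "\<And>k j l. j < p \<Longrightarrow> l < p \<Longrightarrow> P (Suc k) j l = (\<Sum>i<p. a j i * P k i l)"
    and z0: "\<And>j. j < p \<Longrightarrow> z 0 j = 0"
    and zS: "\<And>n j. j < p \<Longrightarrow> z (Suc n) j = (\<Sum>l<p. a j l * z n l) + g (Suc n) j"
    and j: "j < p"
  shows "z n j = (\<Sum>m=1..n. \<Sum>l<p. P (n - m) j l * g m l)"
  using j
proof (induction n arbitrary: j)
  case 0
  then show ?case using z0 by simp
next
  case (Suc n)
  have "(\<Sum>m=1..n. \<Sum>l<p. P (Suc n - m) j l * g m l)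
      = (\<Sum>m=1..n. \<Sum>l<p. \<Sum>i<p. a j i * P (n - m) i l * g m l)"
    using Suc.prems by (auto simp: Suc_diff_le PS sum_distrib_right intro!: sum.cong)
  also have "\<dots> = (\<Sum>m=1..n. \<Sum>i<p. \<Sum>l<p. a j i * P (n - m) i l * g m l)"
    by (rule sum.cong[OF refl], rule sum.swap)
  also have "\<dots> = (\<Sum>i<p. \<Sum>m=1..n. \<Sum>l<p. a j i * P (n - m) i l * g m l)"
    by (rule sum.swap)
  also have "\<dots> = (\<Sum>i<p. a j i * z n i)"
    using Suc.IH by (auto simp: sum_distrib_left mult.assoc intro!: sum.cong)
  finally have 1: "(\<Sum>m=1..n. \<Sum>l<p. P (Suc n - m) j l * g m l) = (\<Sum>i<p. a j i * z n i)" .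
  have "(\<Sum>l<p. P 0 j l * g (Suc n) l) = (\<Sum>l<p. if l = j then g (Suc n) l else 0)"
    using Suc.prems P0 by (intro sum.cong) auto
  then have 2: "(\<Sum>l<p. P 0 j l * g (Suc n) l) = g (Suc n) j"
    using Suc.prems by simp
  show ?case using 1 2 zS[OF Suc.prems, of n] by simp
qed

text \<open>Cauchy-Schwarz is applied with the weights \<open>q ^ (n - m)\<close>, of total mass at
  most \<open>p / (1 - q)\<close>. One copy of the geometric weight thus survives in the bound, so
  that summing over \<open>n\<close> later costs only another factor
  \<open>1 / (1 - q)\<close>.\<close>

lemma stable_recursion_bound:
  fixes a :: "nat \<Rightarrow> nat \<Rightarrow> real"
  assumes P0: "\<And>j l. j < p \<Longrightarrow> l < p \<Longrightarrow> P 0 j l = (if j = l then 1 else 0)"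
    and PS: "\<And>k j l. j < p \<Longrightarrow> l < p \<Longrightarrow> P (Suc k) j l = (\<Sum>i<p. a j i * P k i l)"
    and Pq: "\<And>k j l. j < p \<Longrightarrow> l < p \<Longrightarrow> \<bar>P k j l\<bar> \<le> c * q ^ k"
    and q: "0 < q" "q < 1"
    and z0: "\<And>j. j < p \<Longrightarrow> z 0 j = 0"
    and zS: "\<And>n j. j < p \<Longrightarrow> z (Suc n) j = (\<Sum>l<p. a j l * z n l) + g (Suc n) j"
    and j: "j < p"
  shows "(z n j)\<^sup>2 \<le> c\<^sup>2 * p / (1 - q) * (\<Sum>m=1..n. q ^ (n - m) * (\<Sum>l<p. (g m l)\<^sup>2))"
proof -
  let ?I = "{1..n} \<times> {..<p}"
  let ?w = "\<lambda>i. q ^ (n - fst i)"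
  have "\<bar>z n j\<bar> = \<bar>\<Sum>i\<in>?I. P (n - fst i) j (snd i) * g (fst i) (snd i)\<bar>"
    using linear_recursion_solution[where P = P and a = a and z = z and g = g, OF P0 PS z0 zS j]
    by (simp add: sum.cartesian_product case_prod_unfold)
  also have "\<dots> \<le> (\<Sum>i\<in>?I. \<bar>P (n - fst i) j (snd i) * g (fst i) (snd i)\<bar>)"
    by (rule sum_abs)
  also have "\<dots> \<le> (\<Sum>i\<in>?I. c * ?w i * \<bar>g (fst i) (snd i)\<bar>)"
    by (intro sum_mono) (use j in \<open>auto simp: abs_mult intro!: mult_right_mono Pq\<close>)
  finally have "\<bar>z n j\<bar> \<le> c * (\<Sum>i\<in>?I. ?w i * \<bar>g (fst i) (snd i)\<bar>)"
    by (simp add: sum_distrib_left mult.assoc)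
  then have "\<bar>z n j\<bar>\<^sup>2 \<le> (c * (\<Sum>i\<in>?I. ?w i * \<bar>g (fst i) (snd i)\<bar>))\<^sup>2"
    by (rule power_mono) simp
  also have "\<dots> = c\<^sup>2 * (\<Sum>i\<in>?I. ?w i * \<bar>g (fst i) (snd i)\<bar>)\<^sup>2" by (rule power_mult_distrib)
  also have "\<dots> \<le> c\<^sup>2 * ((\<Sum>i\<in>?I. ?w i) * (\<Sum>i\<in>?I. ?w i * \<bar>g (fst i) (snd i)\<bar>\<^sup>2))"
    by (intro mult_left_mono weighted_Cauchy_Schwarz) (use q in auto)
  also have "\<dots> \<le> c\<^sup>2 * ((p / (1 - q)) * (\<Sum>i\<in>?I. ?w i * \<bar>g (fst i) (snd i)\<bar>\<^sup>2))"
  proof (intro mult_left_mono mult_right_mono)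
    have "(\<Sum>i\<in>?I. ?w i) = p * (\<Sum>m=1..n. q ^ (n - m))"
      using sum.cartesian_product[of "\<lambda>m l. q ^ (n - m)" "{..<p}" "{1..n}"]
      by (simp add: case_prod_unfold sum_distrib_left)
    also have "\<dots> \<le> p * (1 / (1 - q))" by (intro mult_left_mono geometric_sum_le q) auto
    finally show "(\<Sum>i\<in>?I. ?w i) \<le> p / (1 - q)" by simp
    show "0 \<le> (\<Sum>i\<in>?I. ?w i * \<bar>g (fst i) (snd i)\<bar>\<^sup>2)" using q by (intro sum_nonneg) auto
  qed simp
  also have "(\<Sum>i\<in>?I. ?w i * \<bar>g (fst i) (snd i)\<bar>\<^sup>2) = (\<Sum>m=1..n. q ^ (n - m) * (\<Sum>l<p. (g m l)\<^sup>2))"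
    by (simp add: sum_distrib_left sum.cartesian_product case_prod_unfold)
  finally show ?thesis by (simp add: mult.assoc)
qed

text \<open>The loop is closed through the total energy \<open>T\<close> of \<open>z\<close>: the
  memory \<open>u m\<close> is at most a constant times \<open>(\<beta> m)^2 * T m\<close>, and as
  part of the forcing it adds to \<open>T n\<close> a sum of such terms over \<open>m < n\<close>.
  These coefficients are summable, so Gronwall bounds \<open>T\<close> by the energy of
  \<open>e\<close>. The constant is quantified before \<open>z\<close>, \<open>u\<close> and
  \<open>e\<close>, hence is the same for all trajectories.\<close>

lemma perturbed_recursion_bound:
  fixes a :: "nat \<Rightarrow> nat \<Rightarrow> real" and \<beta> :: "nat \<Rightarrow> real"
  assumes P0: "\<And>j l. j < p \<Longrightarrow> l < p \<Longrightarrow> P 0 j l = (if j = l then 1 else 0)"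
    and PS: "\<And>k j l. j < p \<Longrightarrow> l < p \<Longrightarrow> P (Suc k) j l = (\<Sum>i<p. a j i * P k i l)"
    and Pq: "\<And>k j l. j < p \<Longrightarrow> l < p \<Longrightarrow> \<bar>P k j l\<bar> \<le> c * q ^ k"
    and q: "0 < q" "q < 1"
    and \<beta>: "summable (\<lambda>n. (\<beta> n)\<^sup>2)"
  shows "\<exists>K\<ge>0. \<forall>z u e.
    (\<forall>j<p. z 0 j = 0) \<longrightarrow>
    (\<forall>n. \<forall>j<p. z (Suc n) j = (\<Sum>l<p. a j l * (z n l + u n l)) + (if j = 0 then e (Suc n) else 0)) \<longrightarrow>
    (\<forall>n. \<forall>j<p. u n j = \<beta> n * (\<Sum>m=1..<n. \<beta> m * z m j)) \<longrightarrow>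
    (\<forall>n. \<forall>j<p. (z n j)\<^sup>2 \<le> K * (\<Sum>m=1..n. q ^ (n - m) * ((e m)\<^sup>2 + (\<Sum>l<p. (u (m - 1) l)\<^sup>2)))) \<and>
    (\<forall>n. (\<Sum>l<p. (u n l)\<^sup>2) \<le> K * (\<beta> n)\<^sup>2 * (\<Sum>i=1..n. (e i)\<^sup>2))"
proof -
  \<comment> \<open>\<open>F\<close> is the squared Frobenius norm of \<open>a\<close>;
    \<open>K1\<close> serves for a single \<open>z n j\<close>; \<open>K2\<close> arises after
    summing over coordinates and times; \<open>exp (K2 * B * B)\<close> bounds the Gronwall product
    because \<open>B\<close> is the sum of all \<open>(\<beta> n)^2\<close>. \<open>K\<close>
    dominates both constants that are needed in the conclusion.\<close>
  define F where "F = (\<Sum>j<p. \<Sum>l<p. (a j l)\<^sup>2)"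
  define K1 where "K1 = c\<^sup>2 * p / (1 - q) * (2 * (F + 1))"
  define K2 where "K2 = p * K1 / (1 - q)"
  define B where "B = (\<Sum>n. (\<beta> n)\<^sup>2)"
  define K where "K = K1 + B * (K2 * exp (K2 * B * B))"
  have F: "F \<ge> 0" unfolding F_def by (intro sum_nonneg) auto
  have K1: "K1 \<ge> 0" unfolding K1_def using F q by simp
  have K2: "K2 \<ge> 0" unfolding K2_def using K1 q by simp
  have B: "B \<ge> 0" unfolding B_def by (rule suminf_nonneg[OF \<beta>]) simp
  have B_ge: "(\<Sum>n\<in>I. (\<beta> n)\<^sup>2) \<le> B" if "finite I" for I
    unfolding B_def using that by (intro sum_le_suminf[OF \<beta>]) auto
  have K: "K \<ge> 0" "K1 \<le> K" "B * (K2 * exp (K2 * B * B)) \<le> K"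
    unfolding K_def using K1 K2 B by auto
  show ?thesis
  proof (intro exI[of _ K] conjI K(1) allI impI)
    fix z u :: "nat \<Rightarrow> nat \<Rightarrow> real" and e :: "nat \<Rightarrow> real"
    assume z0: "\<forall>j<p. z 0 j = 0"
      and zS: "\<forall>n. \<forall>j<p. z (Suc n) j = (\<Sum>l<p. a j l * (z n l + u n l)) + (if j = 0 then e (Suc n) else 0)"
      and u: "\<forall>n. \<forall>j<p. u n j = \<beta> n * (\<Sum>m=1..<n. \<beta> m * z m j)"
    define U where "U = (\<lambda>n. \<Sum>l<p. (u n l)\<^sup>2)"
    \<comment> \<open>The memory is counted as forcing, delayed by one step, so that only the stable
      matrix \<open>a\<close> acts on \<open>z\<close>.\<close>
    define g where "g = (\<lambda>n j. (\<Sum>l<p. a j l * u (n - 1) l) + (if j = 0 then e n else 0))"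
    define T where "T = (\<lambda>n. \<Sum>m=1..n. \<Sum>j<p. (z m j)\<^sup>2)"
    define E where "E = (\<lambda>n. \<Sum>i=1..n. (e i)\<^sup>2)"
    have U0: "U n \<ge> 0" for n unfolding U_def by (intro sum_nonneg) auto
    have T0: "T n \<ge> 0" for n unfolding T_def by (intro sum_nonneg) auto
    have g2: "(\<Sum>j<p. (g m j)\<^sup>2) \<le> 2 * (F + 1) * ((e m)\<^sup>2 + U (m - 1))" for m
    proof -
      have "(\<Sum>j<p. (g m j)\<^sup>2) \<le> (\<Sum>j<p. 2 * ((\<Sum>l<p. (a j l)\<^sup>2) * U (m - 1)) + 2 * (if j = 0 then (e m)\<^sup>2 else 0))"
      proof (rule sum_mono)
        fix j
        have "(g m j)\<^sup>2 \<le> 2 * (\<Sum>l<p. a j l * u (m - 1) l)\<^sup>2 + 2 * (if j = 0 then e m else 0)\<^sup>2"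
          unfolding g_def by (rule square_add_le)
        also have "(\<Sum>l<p. a j l * u (m - 1) l)\<^sup>2 \<le> (\<Sum>l<p. (a j l)\<^sup>2) * U (m - 1)"
          unfolding U_def by (rule Cauchy_Schwarz_ineq_sum)
        finally show "(g m j)\<^sup>2 \<le> 2 * ((\<Sum>l<p. (a j l)\<^sup>2) * U (m - 1)) + 2 * (if j = 0 then (e m)\<^sup>2 else 0)"
          by (auto split: if_splits)
      qed
      also have "\<dots> = 2 * (F * U (m - 1)) + 2 * (\<Sum>j<p. if j = 0 then (e m)\<^sup>2 else 0)"
        unfolding F_def by (simp only: sum.distrib sum_distrib_left sum_distrib_right)
      also have "(\<Sum>j<p. if j = 0 then (e m)\<^sup>2 else 0) \<le> (e m)\<^sup>2"
        by (simp add: sum.delta)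
      also have "2 * (F * U (m - 1)) + 2 * (e m)\<^sup>2 \<le> 2 * (F + 1) * ((e m)\<^sup>2 + U (m - 1))"
        using F U0[of "m - 1"] by (simp add: algebra_simps)
      finally show ?thesis by simp
    qed
    have z_bound: "(z n j)\<^sup>2 \<le> K1 * (\<Sum>m=1..n. q ^ (n - m) * ((e m)\<^sup>2 + U (m - 1)))" if "j < p" for n j
    proof -
      have "(z n j)\<^sup>2 \<le> c\<^sup>2 * p / (1 - q) * (\<Sum>m=1..n. q ^ (n - m) * (\<Sum>l<p. (g m l)\<^sup>2))"
      proof (rule stable_recursion_bound[where P = P and a = a and z = z and g = g, OF P0 PS Pq q _ _ that])
        show "z (Suc n) j = (\<Sum>l<p. a j l * z n l) + g (Suc n) j" if "j < p" for n j
          using zS that by (simp add: g_def sum.distrib distrib_left)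
      qed (use z0 in auto)
      also have "\<dots> \<le> c\<^sup>2 * p / (1 - q) * (\<Sum>m=1..n. q ^ (n - m) * (2 * (F + 1) * ((e m)\<^sup>2 + U (m - 1))))"
        by (intro mult_left_mono sum_mono g2) (use q in auto)
      also have "\<dots> = K1 * (\<Sum>m=1..n. q ^ (n - m) * ((e m)\<^sup>2 + U (m - 1)))"
        unfolding K1_def by (simp only: sum_distrib_left mult_ac)
      finally show ?thesis .
    qed
    have U_bound: "U n \<le> (\<beta> n)\<^sup>2 * (B * T n)" for n
    proof -
      have "U n \<le> (\<Sum>l<p. (\<beta> n)\<^sup>2 * (B * (\<Sum>m=1..n. (z m l)\<^sup>2)))"
        unfolding U_def
      proof (rule sum_mono)
        fix l assume l: "l \<in> {..<p}"
        have "(\<Sum>m=1..<n. \<beta> m * z m l)\<^sup>2 \<le> (\<Sum>m=1..<n. (\<beta> m)\<^sup>2) * (\<Sum>m=1..<n. (z m l)\<^sup>2)"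
          by (rule Cauchy_Schwarz_ineq_sum)
        also have "\<dots> \<le> B * (\<Sum>m=1..n. (z m l)\<^sup>2)"
          by (intro mult_mono B_ge B sum_mono2 sum_nonneg) auto
        finally have "(\<beta> n)\<^sup>2 * (\<Sum>m=1..<n. \<beta> m * z m l)\<^sup>2 \<le> (\<beta> n)\<^sup>2 * (B * (\<Sum>m=1..n. (z m l)\<^sup>2))"
          by (rule mult_left_mono) simp
        then show "(u n l)\<^sup>2 \<le> (\<beta> n)\<^sup>2 * (B * (\<Sum>m=1..n. (z m l)\<^sup>2))"
          using u l by (simp add: power_mult_distrib)
      qed
      also have "\<dots> = (\<beta> n)\<^sup>2 * (B * (\<Sum>l<p. \<Sum>m=1..n. (z m l)\<^sup>2))"
        by (simp only: sum_distrib_left)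
      also have "(\<Sum>l<p. \<Sum>m=1..n. (z m l)\<^sup>2) = T n"
        unfolding T_def by (rule sum.swap)
      finally show ?thesis .
    qed
    have T_rec: "T n \<le> K2 * E n + (\<Sum>m<n. (K2 * B * (\<beta> m)\<^sup>2) * T m)" for n
    proof -
      have "T n \<le> (\<Sum>k=1..n. \<Sum>j<p. K1 * (\<Sum>m=1..k. q ^ (k - m) * ((e m)\<^sup>2 + U (m - 1))))"
        unfolding T_def by (intro sum_mono z_bound) auto
      also have "\<dots> = p * K1 * (\<Sum>k=1..n. (\<Sum>m=1..k. q ^ (k - m) * ((e m)\<^sup>2 + U (m - 1))))"
        by (simp add: sum_distrib_left mult_ac)
      also have "\<dots> \<le> p * K1 * ((\<Sum>m=1..n. (e m)\<^sup>2 + U (m - 1)) / (1 - q))"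
        by (intro mult_left_mono geometric_convolution_sum_le q) (use K1 U0 in auto)
      also have "\<dots> = K2 * E n + K2 * (\<Sum>m=1..n. U (m - 1))"
        unfolding K2_def E_def by (simp add: sum.distrib field_simps add_divide_distrib)
      also have "(\<Sum>m=1..n. U (m - 1)) = (\<Sum>m<n. U m)"
        by (rule sum.reindex_bij_witness[of _ Suc "\<lambda>m. m - 1"]) auto
      also have "K2 * (\<Sum>m<n. U m) \<le> K2 * (\<Sum>m<n. (\<beta> m)\<^sup>2 * (B * T m))"
        by (intro mult_left_mono sum_mono U_bound K2)
      also have "\<dots> = (\<Sum>m<n. (K2 * B * (\<beta> m)\<^sup>2) * T m)"
        by (simp add: sum_distrib_left mult_ac)
      finally show ?thesis by simp
    qed
    have E0: "E n \<ge> 0" for n unfolding E_def by (intro sum_nonneg) auto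
    have T_bound: "T n \<le> K2 * E n * exp (K2 * B * B)" for n
    proof -
      have "T n \<le> K2 * E n * (\<Prod>m<n. 1 + K2 * B * (\<beta> m)\<^sup>2)"
      proof (rule discrete_Gronwall[OF T_rec])
        show "mono (\<lambda>n. K2 * E n)"
          unfolding mono_def E_def using K2 by (auto intro!: mult_left_mono sum_mono2)
      qed (use K2 B E0 in auto)
      also have "(\<Prod>m<n. 1 + K2 * B * (\<beta> m)\<^sup>2) \<le> (\<Prod>m<n. exp (K2 * B * (\<beta> m)\<^sup>2))"
        using K2 B by (intro prod_mono) (auto simp: add_nonneg_nonneg)
      also have "\<dots> = exp (K2 * B * (\<Sum>m<n. (\<beta> m)\<^sup>2))"
        by (simp add: exp_sum sum_distrib_left)
      also have "\<dots> \<le> exp (K2 * B * B)"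
        using K2 B B_ge[of "{..<n}"] by (simp add: mult_left_mono)
      finally show ?thesis using K2 E0 by (simp add: mult_left_mono)
    qed
    show "(z n j)\<^sup>2 \<le> K * (\<Sum>m=1..n. q ^ (n - m) * ((e m)\<^sup>2 + (\<Sum>l<p. (u (m - 1) l)\<^sup>2)))" if "j < p" for n j
    proof -
      have "K1 * (\<Sum>m=1..n. q ^ (n - m) * ((e m)\<^sup>2 + U (m - 1))) \<le> K * (\<Sum>m=1..n. q ^ (n - m) * ((e m)\<^sup>2 + U (m - 1)))"
        by (intro mult_right_mono K sum_nonneg) (use q U0 in auto)
      with z_bound[OF that, of n] show ?thesis unfolding U_def by linarith
    qed
    show "(\<Sum>l<p. (u n l)\<^sup>2) \<le> K * (\<beta> n)\<^sup>2 * (\<Sum>i=1..n. (e i)\<^sup>2)" for n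
    proof -
      have "U n \<le> (\<beta> n)\<^sup>2 * (B * T n)" by (rule U_bound)
      also have "\<dots> \<le> (\<beta> n)\<^sup>2 * (B * (K2 * E n * exp (K2 * B * B)))"
        by (intro mult_left_mono T_bound B) simp
      also have "\<dots> = (B * (K2 * exp (K2 * B * B))) * ((\<beta> n)\<^sup>2 * E n)" by (simp add: mult_ac)
      also have "\<dots> \<le> K * ((\<beta> n)\<^sup>2 * E n)" by (intro mult_right_mono K) (use E0 in auto)
      finally show ?thesis unfolding U_def E_def by (simp add: mult_ac)
    qed
  qed
qed

section \<open>Geometric decay of the powers of a matrix with spectral radius below 1\<close>

lemma eigenvector_smult:
  fixes A :: "complex mat"
  assumes A: "A \<in> carrier_mat n n" and v: "eigenvector (a \<cdot>\<^sub>m A) v \<mu>" and a: "a \<noteq> 0"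
  shows "eigenvector A v (\<mu> / a)"
proof -
  have vc: "v \<in> carrier_vec n" "v \<noteq> 0\<^sub>v n" and eq: "(a \<cdot>\<^sub>m A) *\<^sub>v v = \<mu> \<cdot>\<^sub>v v"
    using v A unfolding eigenvector_def by auto
  have "A *\<^sub>v v = (\<mu> / a) \<cdot>\<^sub>v v"
  proof (rule eq_vecI)
    fix i assume i: "i < dim_vec ((\<mu> / a) \<cdot>\<^sub>v v)"
    have "((a \<cdot>\<^sub>m A) *\<^sub>v v) $ i = (\<mu> \<cdot>\<^sub>v v) $ i" using eq by simp
    moreover have "((a \<cdot>\<^sub>m A) *\<^sub>v v) $ i = a * (A *\<^sub>v v) $ i"
      using i vc A by (simp add: scalar_prod_def sum_distrib_left mult.assoc)
    ultimately show "(A *\<^sub>v v) $ i = ((\<mu> / a) \<cdot>\<^sub>v v) $ i"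
      using i a vc by (simp add: field_simps)
  qed (use A vc in auto)
  then show ?thesis using vc A unfolding eigenvector_def by auto
qed

lemma smult_pow_mat:
  fixes A :: "'a :: comm_semiring_1 mat"
  assumes A: "A \<in> carrier_mat n n"
  shows "(a \<cdot>\<^sub>m A) ^\<^sub>m k = a ^ k \<cdot>\<^sub>m (A ^\<^sub>m k)"
proof (induction k)
  case 0
  then show ?case using A by (auto intro!: eq_matI)
next
  case (Suc k)
  have Ak: "A ^\<^sub>m k \<in> carrier_mat n n" using A by simp
  have "(a \<cdot>\<^sub>m A) ^\<^sub>m Suc k = (a ^ k \<cdot>\<^sub>m (A ^\<^sub>m k)) * (a \<cdot>\<^sub>m A)" using Suc by simp
  also have "\<dots> = a ^ Suc k \<cdot>\<^sub>m (A ^\<^sub>m Suc k)"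
    using A Ak by (intro eq_matI) (auto simp: scalar_prod_def sum_distrib_left mult_ac)
  finally show ?case .
qed

lemma pow_mat_Suc_left:
  fixes A :: "'a :: semiring_1 mat"
  assumes A: "A \<in> carrier_mat n n"
  shows "A ^\<^sub>m Suc k = A * A ^\<^sub>m k"
proof (induction k)
  case 0
  then show ?case using A by simp
next
  case (Suc k)
  have Ak: "A ^\<^sub>m k \<in> carrier_mat n n" using A by simp
  have "A ^\<^sub>m Suc (Suc k) = A * A ^\<^sub>m k * A" using Suc by simp
  also have "\<dots> = A * (A ^\<^sub>m k * A)" using A Ak by (rule assoc_mult_mat) (rule A)
  finally show ?case by simp
qed

text \<open>Dividing the matrix by some \<open>q < 1\<close> above its spectral radius leaves the
  spectral radius below 1. The powers of the rescaled matrix are then bounded by its Jordan normal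
  form, and scaling back produces the factor \<open>q ^ k\<close>.\<close>

lemma spectral_radius_lt_1_geometric_bound:
  fixes A :: "real mat"
  assumes A: "A \<in> carrier_mat n n" and n: "n > 0"
    and sr: "spectral_radius (map_mat complex_of_real A) < 1"
  obtains c q where "0 < q" "q < 1"
    "\<And>k i j. i < n \<Longrightarrow> j < n \<Longrightarrow> \<bar>(A ^\<^sub>m k) $$ (i, j)\<bar> \<le> c * q ^ k"
proof -
  define C where "C = map_mat complex_of_real A"
  have C: "C \<in> carrier_mat n n" unfolding C_def using A by simp
  \<comment> \<open>The midpoint between the spectral radius and 1; the maximum with 0 makes
    \<open>q\<close> positive outright.\<close>
  define q where "q = (max (spectral_radius C) 0 + 1) / 2"
  have q: "0 < q" "q < 1" "spectral_radius C < q"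
    using sr unfolding q_def C_def by (auto simp: max_def)
  define D where "D = complex_of_real (1 / q) \<cdot>\<^sub>m C"
  have D: "D \<in> carrier_mat n n" unfolding D_def using C by simp
  have "spectral_radius D < 1"
  proof -
    obtain \<mu> where \<mu>: "eigenvalue D \<mu>" "spectral_radius D = norm \<mu>"
      using spectral_radius_mem_max(1)[OF D n] unfolding spectrum_def by auto
    then obtain v where "eigenvector D v \<mu>" unfolding eigenvalue_def by auto
    then have "eigenvector C v (\<mu> / complex_of_real (1 / q))"
      unfolding D_def using q by (intro eigenvector_smult[OF C]) auto
    then have "\<mu> / complex_of_real (1 / q) \<in> spectrum C"
      unfolding spectrum_def eigenvalue_def by blast
    then have "norm (\<mu> / complex_of_real (1 / q)) \<le> spectral_radius C"
      by (intro spectral_radius_mem_max(2)[OF C n] imageI)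
    then have "norm \<mu> * q \<le> spectral_radius C" using q by (simp add: norm_divide norm_mult)
    then have "norm \<mu> * q < 1 * q" using q by linarith
    then show ?thesis using \<mu>(2) q by (metis mult_less_cancel_right_pos)
  qed
  then obtain c where c: "\<And>k. norm_bound (D ^\<^sub>m k) c"
    using spectral_radius_jnf_norm_bound_less_1_upper_triangular[OF D] by blast
  have "\<bar>(A ^\<^sub>m k) $$ (i, j)\<bar> \<le> c * q ^ k" if ij: "i < n" "j < n" for k i j
  proof -
    have "norm ((D ^\<^sub>m k) $$ (i, j)) \<le> c"
      using c[of k] ij D unfolding norm_bound_def by simp
    moreover have "(D ^\<^sub>m k) $$ (i, j) = complex_of_real ((1 / q) ^ k * (A ^\<^sub>m k) $$ (i, j))"
      unfolding D_def smult_pow_mat[OF C] using ij A C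
      unfolding C_def of_real_hom.mat_hom_pow[OF A, symmetric] by simp
    ultimately have "(1 / q) ^ k * \<bar>(A ^\<^sub>m k) $$ (i, j)\<bar> \<le> c"
      using q by (simp add: norm_mult norm_power norm_divide power_divide)
    then show ?thesis using q by (simp add: power_divide field_simps)
  qed
  with q show ?thesis by (intro that[of q c])
qed

text \<open>Applying the autoregressive polynomial in the shift to \<open>v \<bullet> h\<close> leaves, up to a vanishing error, the moving
  average \<open>\<Sum>\<^sub>j v\<^sub>j e\<^sub>n\<^sub>-\<^sub>j\<close>, whose mean square tends to \<open>s \<parallel>v\<parallel>\<^sup>2\<close> by the assumption on the
  empirical autocovariances. So the excitation can be bounded below without computing the limiting
  Gram matrix.\<close>

lemma excitation_lower_bound:
  fixes h d :: "nat \<Rightarrow> nat \<Rightarrow> real" and e th :: "nat \<Rightarrow> real"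
  assumes p: "p \<ge> 1" and s: "s > 0"
    and h0: "\<And>n. h (Suc n) 0 = (\<Sum>l<p. th l * h n l) + e (Suc n) + d (Suc n) 0"
    and hS: "\<And>n j. Suc j < p \<Longrightarrow> h (Suc n) (Suc j) = h n j + d (Suc n) (Suc j)"
    and d0: "\<And>j. j < p \<Longrightarrow> (\<lambda>n. d n j) \<longlonglongrightarrow> 0"
    and av: "\<And>a b. a \<ge> 1 \<Longrightarrow> b \<ge> 1 \<Longrightarrow>
      (\<lambda>N. (\<Sum>m<N. e (m + a) * e (m + b)) / real N) \<longlonglongrightarrow> (if a = b then s else 0)"
  obtains c where "c > 0"
    "\<forall>\<^sub>F n in sequentially. \<forall>v. c * real n * (\<Sum>j<p. (v j)\<^sup>2) \<le> (\<Sum>i<n. (\<Sum>j<p. v j * h i j)\<^sup>2)"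
proof -
  \<comment> \<open>Up to a vanishing error, coordinate \<open>j\<close> is coordinate 0 delayed by
    \<open>j\<close> steps.\<close>
  have shift: "(\<lambda>n. h (n + j) j - h n 0) \<longlonglongrightarrow> 0" if "j < p" for j
    using that
  proof (induction j)
    case (Suc j)
    have "(\<lambda>n. (h (n + j) j - h n 0) + d (n + Suc j) (Suc j)) \<longlonglongrightarrow> 0 + 0"
      using Suc by (intro tendsto_add LIMSEQ_ignore_initial_segment d0) auto
    moreover have "(h (n + j) j - h n 0) + d (n + Suc j) (Suc j) = h (n + Suc j) (Suc j) - h n 0" for n
      using hS[of j "n + j"] Suc.prems by simp
    ultimately show ?case by (simp only: add_0)
  qed simp
  have shift': "(\<lambda>m. h (m + a + j) j - h (m + a) 0) \<longlonglongrightarrow> 0" if "j < p" for j a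
    using LIMSEQ_ignore_initial_segment[OF shift[OF that], of a] .
  \<comment> \<open>The error made when the autoregressive polynomial, applied to coordinate
    \<open>j\<close> at time \<open>m + (2 * p + 1)\<close>, is replaced by the noise delayed by
    \<open>j\<close>. The offset keeps all the differences \<open>2 * p + 1 - j\<close>,
    \<open>2 * p - l\<close> and \<open>2 * p - j - l\<close> free of truncation.\<close>
  define D where "D = (\<lambda>m j. e (m + (2 * p + 1 - j)) - (h (m + (2 * p + 1)) j - (\<Sum>l<p. th l * h (m + (2 * p - l)) j)))"
  have D: "(\<lambda>m. D m j) \<longlonglongrightarrow> 0" if j: "j < p" for j
  proof -
    let ?f = "\<lambda>m. - (h (m + (2 * p + 1 - j) + j) j - h (m + (2 * p + 1 - j)) 0)
        - (\<Sum>l<p. th l * ((h (m + (2 * p - j - l) + l) l - h (m + (2 * p - j - l)) 0)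
             - (h (m + (2 * p - j - l) + j) j - h (m + (2 * p - j - l)) 0)))
        - d (m + (2 * p + 1 - j)) 0"
    have "?f \<longlonglongrightarrow> - 0 - (\<Sum>l<p. th l * (0 - 0)) - 0"
      using p j by (intro tendsto_diff tendsto_minus tendsto_sum tendsto_mult tendsto_const shift'
          LIMSEQ_ignore_initial_segment d0) auto
    moreover have "?f m = D m j" for m
    proof -
      have "m + (2 * p + 1 - j) = Suc (m + (2 * p - j))" using j by simp
      then have "e (m + (2 * p + 1 - j)) = h (m + (2 * p + 1 - j)) 0 - (\<Sum>l<p. th l * h (m + (2 * p - j)) l)
          - d (m + (2 * p + 1 - j)) 0"
        using h0[of "m + (2 * p - j)"] by simp
      moreover have "m + (2 * p + 1 - j) + j = m + (2 * p + 1)" using j by simp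
      moreover have idx: "m + (2 * p - j - l) + l = m + (2 * p - j)" "m + (2 * p - j - l) + j = m + (2 * p - l)"
        if "l \<in> {..<p}" for l using that j by auto
      moreover have "(\<Sum>l<p. th l * ((h (m + (2 * p - j - l) + l) l - h (m + (2 * p - j - l)) 0)
             - (h (m + (2 * p - j - l) + j) j - h (m + (2 * p - j - l)) 0)))
          = (\<Sum>l<p. th l * (h (m + (2 * p - j)) l - h (m + (2 * p - l)) j))"
        by (intro sum.cong refl) (simp only: idx, simp)
      ultimately show ?thesis
        unfolding D_def by (simp only: sum_subtractf right_diff_distrib)
    qed
    ultimately show ?thesis by simp
  qed
  \<comment> \<open>The squared length of the coefficient vector
    \<open>(1, - th 0, ..., - th (p - 1))\<close> of the autoregressive polynomial.\<close>
  define \<Phi> where "\<Phi> = 1 + (\<Sum>l<p. (th l)\<^sup>2)"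
  have \<Phi>: "\<Phi> \<ge> 1" unfolding \<Phi>_def by (simp add: sum_nonneg)
  \<comment> \<open>With \<open>V\<close> the squared length of \<open>v\<close>, the moving average
    has energy at least \<open>s / 2 * V\<close> per time step and the errors \<open>D\<close> take
    away at most \<open>s / 4 * V\<close>. The rest is at most \<open>2 * \<Phi> * (p + 1)\<close>
    times the energy of \<open>v\<close> against \<open>h\<close>, which gives \<open>2 * c\<close>.
    The last factor 2 pays for passing from \<open>N\<close> to
    \<open>n = N + (2 * p + 2)\<close>.\<close>
  define c where "c = s / (16 * \<Phi> * (real p + 1))"
  have c: "c > 0" unfolding c_def using s \<Phi> by simp
  \<comment> \<open>Entrywise accuracy \<open>s / (2 * p)\<close> of the empirical autocovariances
    changes their quadratic form by at most \<open>s / 2 * V\<close>, since the square of the sum of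
    the \<open>\<bar>v j\<bar>\<close> is at most \<open>p * V\<close>. The condition does not
    mention \<open>v\<close>, hence the uniformity.\<close>
  have "\<forall>\<^sub>F N in sequentially. \<forall>j\<in>{..<p}. \<forall>l\<in>{..<p}.
      \<bar>(\<Sum>m<N. e (m + (2 * p + 1 - j)) * e (m + (2 * p + 1 - l))) / real N - (if j = l then s else 0)\<bar> < s / (2 * p)"
  proof (intro eventually_ball_finite ballI finite_lessThan)
    fix j l assume jl: "j \<in> {..<p}" "l \<in> {..<p}"
    then have "(2 * p + 1 - j = 2 * p + 1 - l) = (j = l)" by auto
    then show "\<forall>\<^sub>F N in sequentially.
      \<bar>(\<Sum>m<N. e (m + (2 * p + 1 - j)) * e (m + (2 * p + 1 - l))) / real N - (if j = l then s else 0)\<bar> < s / (2 * p)"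
      using tendstoD[OF av[of "2 * p + 1 - j" "2 * p + 1 - l"], of "s / (2 * p)"] s p jl
      by (simp add: dist_real_def)
  qed
  moreover have "\<forall>\<^sub>F N in sequentially. (\<Sum>m<N. \<Sum>j<p. (D m j)\<^sup>2) / real N < s / 8"
  proof -
    have "(\<lambda>m. \<Sum>j<p. (D m j)\<^sup>2) \<longlonglongrightarrow> (\<Sum>j<p. 0\<^sup>2)"
      by (intro tendsto_sum tendsto_power D) auto
    from Cesaro_tendsto[OF this] show ?thesis
      using s by (intro order_tendstoD(2)[of _ 0]) auto
  qed
  moreover note eventually_ge_at_top[of "2 * p + 2"]
  ultimately have ev: "\<forall>\<^sub>F N in sequentially. \<forall>v. 2 * c * real N * (\<Sum>j<p. (v j)\<^sup>2)
      \<le> (\<Sum>i<N + (2 * p + 2). (\<Sum>j<p. v j * h i j)\<^sup>2)"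
  proof eventually_elim
    case (elim N)
    have N: "N > 0" using elim p by simp
    show ?case
    proof
      fix v :: "nat \<Rightarrow> real"
      define V where "V = (\<Sum>j<p. (v j)\<^sup>2)"
      define y where "y = (\<lambda>i. \<Sum>j<p. v j * h i j)"
      define R where "R = (\<lambda>j l. (\<Sum>m<N. e (m + (2 * p + 1 - j)) * e (m + (2 * p + 1 - l))) / real N)"
      define x where "x = (\<lambda>m. \<Sum>j<p. v j * e (m + (2 * p + 1 - j)))"
      define Y where "Y = (\<Sum>i<N + (2 * p + 2). (y i)\<^sup>2)"
      have V: "V \<ge> 0" unfolding V_def by (rule sum_nonneg) simp
      have "(\<Sum>m<N. (x m)\<^sup>2) = (\<Sum>m<N. \<Sum>j<p. \<Sum>l<p. v j * v l * (e (m + (2 * p + 1 - j)) * e (m + (2 * p + 1 - l))))"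
        unfolding x_def by (simp add: power2_eq_square sum_product mult_ac)
      also have "\<dots> = (\<Sum>j<p. \<Sum>m<N. \<Sum>l<p. v j * v l * (e (m + (2 * p + 1 - j)) * e (m + (2 * p + 1 - l))))"
        by (rule sum.swap)
      also have "\<dots> = (\<Sum>j<p. \<Sum>l<p. \<Sum>m<N. v j * v l * (e (m + (2 * p + 1 - j)) * e (m + (2 * p + 1 - l))))"
        by (rule sum.cong[OF refl], rule sum.swap)
      also have "\<dots> = real N * (\<Sum>j<p. \<Sum>l<p. v j * v l * R j l)"
      proof -
        have "real N * (v j * v l * R j l) = (\<Sum>m<N. v j * v l * (e (m + (2 * p + 1 - j)) * e (m + (2 * p + 1 - l))))" for j l
          unfolding R_def sum_distrib_left[symmetric] using N by simp
        then show ?thesis by (simp only: sum_distrib_left)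
      qed
      finally have x_eq: "(\<Sum>m<N. (x m)\<^sup>2) = real N * (\<Sum>j<p. \<Sum>l<p. v j * v l * R j l)" .
      have "s * V - s / 2 * V \<le> (\<Sum>j<p. \<Sum>l<p. v j * v l * R j l)"
      proof -
        have "(\<Sum>j<p. \<Sum>l<p. v j * v l * (if j = l then s else 0)) = (\<Sum>j<p. \<Sum>l<p. if l = j then s * (v j)\<^sup>2 else 0)"
          by (intro sum.cong) (auto simp: power2_eq_square)
        also have "\<dots> = s * V" unfolding V_def by (simp add: sum_distrib_left)
        finally have 1: "(\<Sum>j<p. \<Sum>l<p. v j * v l * (if j = l then s else 0)) = s * V" .
        have "\<bar>\<Sum>j<p. \<Sum>l<p. v j * v l * (R j l - (if j = l then s else 0))\<bar>
            \<le> (\<Sum>j<p. \<Sum>l<p. \<bar>v j\<bar> * \<bar>v l\<bar> * (s / (2 * p)))"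
        proof (intro order_trans[OF sum_abs] sum_mono)
          fix j l assume jl: "j \<in> {..<p}" "l \<in> {..<p}"
          have "\<bar>R j l - (if j = l then s else 0)\<bar> \<le> s / (2 * p)"
            unfolding R_def by (rule less_imp_le[OF elim(1)[THEN bspec, OF jl(1), THEN bspec, OF jl(2)]])
          then show "\<bar>v j * v l * (R j l - (if j = l then s else 0))\<bar> \<le> \<bar>v j\<bar> * \<bar>v l\<bar> * (s / (2 * p))"
            unfolding abs_mult by (intro mult_left_mono) auto
        qed
        also have "\<dots> = (\<Sum>j<p. \<bar>v j\<bar>)\<^sup>2 * (s / (2 * p))"
          unfolding power2_eq_square sum_product by (simp only: sum_distrib_right)
        also have "(\<Sum>j<p. \<bar>v j\<bar>)\<^sup>2 \<le> p * V"
          using Cauchy_Schwarz_ineq_sum[of "\<lambda>_. 1" "\<lambda>j. \<bar>v j\<bar>" "{..<p}"] unfolding V_def by simp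
        finally have "\<bar>\<Sum>j<p. \<Sum>l<p. v j * v l * (R j l - (if j = l then s else 0))\<bar> \<le> s / 2 * V"
          using s p by (simp add: mult_right_mono field_simps)
        moreover have "(\<Sum>j<p. \<Sum>l<p. v j * v l * (R j l - (if j = l then s else 0)))
            = (\<Sum>j<p. \<Sum>l<p. v j * v l * R j l) - s * V"
          unfolding 1[symmetric] by (simp add: right_diff_distrib sum_subtractf)
        ultimately show ?thesis by linarith
      qed
      then have "real N * (s * V - s / 2 * V) \<le> (\<Sum>m<N. (x m)\<^sup>2)"
        unfolding x_eq by (rule mult_left_mono) simp
      moreover have "s * V - s / 2 * V = s / 2 * V" by (simp add: field_simps)
      ultimately have low: "real N * (s / 2 * V) \<le> (\<Sum>m<N. (x m)\<^sup>2)" by (simp only:)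
      have Y_seg: "(\<Sum>m<N. (y (m + a))\<^sup>2) \<le> Y" if "a \<le> 2 * p + 1" for a
      proof -
        have "(\<Sum>m<N. (y (m + a))\<^sup>2) = (\<Sum>i\<in>(\<lambda>m. m + a) ` {..<N}. (y i)\<^sup>2)"
          by (subst sum.reindex) (auto simp: inj_on_def)
        also have "\<dots> \<le> Y" unfolding Y_def using that by (intro sum_mono2) auto
        finally show ?thesis .
      qed
      have "(\<Sum>m<N. (x m)\<^sup>2) \<le> (\<Sum>m<N. 2 * (\<Phi> * ((y (m + (2 * p + 1)))\<^sup>2 + (\<Sum>l<p. (y (m + (2 * p - l)))\<^sup>2)))
          + 2 * (V * (\<Sum>j<p. (D m j)\<^sup>2)))"
      proof (rule sum_mono)
        fix m
        let ?y = "y (m + (2 * p + 1)) - (\<Sum>l<p. th l * y (m + (2 * p - l)))"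
        have "(\<Sum>j<p. v j * (\<Sum>l<p. th l * h (m + (2 * p - l)) j)) = (\<Sum>l<p. th l * y (m + (2 * p - l)))"
          unfolding y_def sum_distrib_left by (subst sum.swap) (simp add: mult_ac)
        then have "x m = ?y + (\<Sum>j<p. v j * D m j)"
          unfolding x_def D_def by (simp add: right_diff_distrib sum_subtractf y_def)
        then have "(x m)\<^sup>2 \<le> 2 * ?y\<^sup>2 + 2 * (\<Sum>j<p. v j * D m j)\<^sup>2"
          using square_add_le by simp
        also have "(\<Sum>j<p. v j * D m j)\<^sup>2 \<le> V * (\<Sum>j<p. (D m j)\<^sup>2)"
          unfolding V_def by (rule Cauchy_Schwarz_ineq_sum)
        also have "?y\<^sup>2 \<le> \<Phi> * ((y (m + (2 * p + 1)))\<^sup>2 + (\<Sum>l<p. (y (m + (2 * p - l)))\<^sup>2))"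
        proof -
          let ?b = "\<lambda>i. case i of 0 \<Rightarrow> 1 | Suc l \<Rightarrow> - th l"
          let ?z = "\<lambda>i. case i of 0 \<Rightarrow> y (m + (2 * p + 1)) | Suc l \<Rightarrow> y (m + (2 * p - l))"
          have "(\<Sum>i<Suc p. ?b i * ?z i)\<^sup>2 \<le> (\<Sum>i<Suc p. (?b i)\<^sup>2) * (\<Sum>i<Suc p. (?z i)\<^sup>2)"
            by (rule Cauchy_Schwarz_ineq_sum)
          then show ?thesis
            unfolding sum.lessThan_Suc_shift \<Phi>_def by (simp add: sum_negf)
        qed
        finally show "(x m)\<^sup>2 \<le> 2 * (\<Phi> * ((y (m + (2 * p + 1)))\<^sup>2 + (\<Sum>l<p. (y (m + (2 * p - l)))\<^sup>2)))
            + 2 * (V * (\<Sum>j<p. (D m j)\<^sup>2))" by simp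
      qed
      also have "\<dots> = 2 * (\<Phi> * ((\<Sum>m<N. (y (m + (2 * p + 1)))\<^sup>2) + (\<Sum>l<p. \<Sum>m<N. (y (m + (2 * p - l)))\<^sup>2)))
          + 2 * (V * (\<Sum>m<N. \<Sum>j<p. (D m j)\<^sup>2))"
        by (subst sum.swap[of _ "{..<N}" "{..<p}"])
          (simp only: sum.distrib sum_distrib_left[symmetric])
      also have "\<dots> \<le> 2 * (\<Phi> * (Y + (\<Sum>l<p. Y))) + 2 * (V * (real N * (s / 8)))"
      proof (intro add_mono mult_left_mono sum_mono Y_seg)
        show "(\<Sum>m<N. \<Sum>j<p. (D m j)\<^sup>2) \<le> real N * (s / 8)"
          using elim(2) N by (simp add: field_simps)
      qed (use \<Phi> V in auto)
      finally have "real N * (s / 4 * V) \<le> 2 * (\<Phi> * (Y + p * Y))"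
        using low by (simp add: algebra_simps)
      then have "real N * (s / 4 * V) \<le> Y * (2 * (\<Phi> * (real p + 1)))"
        by (simp add: algebra_simps)
      then have "real N * (s / 4 * V) / (2 * (\<Phi> * (real p + 1))) \<le> Y"
        using \<Phi> by (subst pos_divide_le_eq) auto
      moreover have "2 * c * real N * V = real N * (s / 4 * V) / (2 * (\<Phi> * (real p + 1)))"
        unfolding c_def by simp
      ultimately have "2 * c * real N * V \<le> Y" by linarith
      then show "2 * c * real N * (\<Sum>j<p. (v j)\<^sup>2) \<le> (\<Sum>i<N + (2 * p + 2). (\<Sum>j<p. v j * h i j)\<^sup>2)"
        unfolding V_def Y_def y_def .
    qed
  qed
  have "\<forall>\<^sub>F n in sequentially. \<forall>v. c * real n * (\<Sum>j<p. (v j)\<^sup>2) \<le> (\<Sum>i<n. (\<Sum>j<p. v j * h i j)\<^sup>2)"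
  proof -
    obtain N0 where N0: "\<And>N v. N \<ge> N0 \<Longrightarrow> 2 * c * real N * (\<Sum>j<p. (v j)\<^sup>2)
      \<le> (\<Sum>i<N + (2 * p + 2). (\<Sum>j<p. v j * h i j)\<^sup>2)"
      using ev unfolding eventually_sequentially by blast
    show ?thesis
    proof (rule eventually_sequentiallyI, rule allI)
      fix n and v :: "nat \<Rightarrow> real" assume n: "n \<ge> N0 + 2 * (2 * p + 2)"
      have "c * real n \<le> 2 * c * real (n - (2 * p + 2))" using n c by (simp add: of_nat_diff)
      then have "c * real n * (\<Sum>j<p. (v j)\<^sup>2) \<le> 2 * c * real (n - (2 * p + 2)) * (\<Sum>j<p. (v j)\<^sup>2)"
        by (intro mult_right_mono sum_nonneg) auto
      also have "\<dots> \<le> (\<Sum>i<n. (\<Sum>j<p. v j * h i j)\<^sup>2)"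
      proof -
        have "n - (2 * p + 2) \<ge> N0" "n - (2 * p + 2) + (2 * p + 2) = n" using n by simp_all
        then show ?thesis using N0[of "n - (2 * p + 2)" v] by (simp only:)
      qed
      finally show "c * real n * (\<Sum>j<p. (v j)\<^sup>2) \<le> (\<Sum>i<n. (\<Sum>j<p. v j * h i j)\<^sup>2)" .
    qed
  qed
  with c show ?thesis by (rule that)
qed

section \<open>Strong laws for orthogonal sequences\<close>

text \<open>The sum of the series has finite integral, so it is finite almost everywhere, and its
  terms tend to 0 there.\<close>

lemma AE_tendsto_0_of_summable_integral:
  fixes f :: "nat \<Rightarrow> 'a \<Rightarrow> real"
  assumes int: "\<And>n. integrable M (f n)" and nonneg: "\<And>n w. f n w \<ge> 0"
    and summ: "summable (\<lambda>n. integral\<^sup>L M (f n))"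
  shows "AE w in M. (\<lambda>n. f n w) \<longlonglongrightarrow> 0"
proof -
  have [measurable]: "f n \<in> borel_measurable M" for n using int by auto
  have "(\<integral>\<^sup>+w. (\<Sum>n. ennreal (f n w)) \<partial>M) = (\<Sum>n. \<integral>\<^sup>+w. ennreal (f n w) \<partial>M)"
    by (rule nn_integral_suminf) simp
  also have "\<dots> = (\<Sum>n. ennreal (integral\<^sup>L M (f n)))"
    using int nonneg by (simp add: nn_integral_eq_integral)
  also have "\<dots> = ennreal (\<Sum>n. integral\<^sup>L M (f n))"
    using summ nonneg by (intro suminf_ennreal2) auto
  finally have "(\<integral>\<^sup>+w. (\<Sum>n. ennreal (f n w)) \<partial>M) \<noteq> \<infinity>" by simp
  then have "AE w in M. (\<Sum>n. ennreal (f n w)) \<noteq> \<infinity>"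
    by (intro nn_integral_PInf_AE) auto
  then show ?thesis
  proof eventually_elim
    case (elim w)
    then have "summable (\<lambda>n. f n w)" using nonneg by (intro summable_suminf_not_top) auto
    then show ?case by (rule summable_LIMSEQ_zero)
  qed
qed

lemma integrable_mult_of_squares:
  fixes f g :: "'a \<Rightarrow> real"
  assumes [measurable]: "f \<in> borel_measurable M" "g \<in> borel_measurable M"
    and "integrable M (\<lambda>w. (f w)\<^sup>2)" "integrable M (\<lambda>w. (g w)\<^sup>2)"
  shows "integrable M (\<lambda>w. f w * g w)"
proof (rule Bochner_Integration.integrable_bound)
  show "integrable M (\<lambda>w. (f w)\<^sup>2 + (g w)\<^sup>2)" using assms by simp
  have "\<bar>x * y\<bar> \<le> x\<^sup>2 + y\<^sup>2" for x y :: real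
    using sum_squares_bound[of x y] sum_squares_bound[of x "-y"] sum_squares_ge_zero[of x y]
    by (auto simp: abs_if power2_eq_square)
  then show "AE w in M. norm (f w * g w) \<le> norm ((f w)\<^sup>2 + (g w)\<^sup>2)" by auto
qed simp

lemma integral_square_sum_orthogonal:
  fixes X :: "'i \<Rightarrow> 'a \<Rightarrow> real"
  assumes [measurable]: "\<And>n. X n \<in> borel_measurable M"
    and int2: "\<And>n. integrable M (\<lambda>w. (X n w)\<^sup>2)"
    and orth: "\<And>m n. m \<noteq> n \<Longrightarrow> integral\<^sup>L M (\<lambda>w. X m w * X n w) = 0"
    and I: "finite I"
  shows "integrable M (\<lambda>w. (\<Sum>i\<in>I. X i w)\<^sup>2)"
    and "integral\<^sup>L M (\<lambda>w. (\<Sum>i\<in>I. X i w)\<^sup>2) = (\<Sum>i\<in>I. integral\<^sup>L M (\<lambda>w. (X i w)\<^sup>2))"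
proof -
  have int: "integrable M (\<lambda>w. X i w * X j w)" for i j
    by (intro integrable_mult_of_squares int2) auto
  have eq: "(\<lambda>w. (\<Sum>i\<in>I. X i w)\<^sup>2) = (\<lambda>w. \<Sum>i\<in>I. \<Sum>j\<in>I. X i w * X j w)"
    by (simp add: power2_eq_square sum_product)
  show "integrable M (\<lambda>w. (\<Sum>i\<in>I. X i w)\<^sup>2)" unfolding eq using int by auto
  have "integral\<^sup>L M (\<lambda>w. (\<Sum>i\<in>I. X i w)\<^sup>2) = (\<Sum>i\<in>I. \<Sum>j\<in>I. integral\<^sup>L M (\<lambda>w. X i w * X j w))"
    unfolding eq using int by (subst Bochner_Integration.integral_sum; force)+
  also have "\<dots> = (\<Sum>i\<in>I. \<Sum>j\<in>I. if j = i then integral\<^sup>L M (\<lambda>w. (X i w)\<^sup>2) else 0)"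
    by (intro sum.cong refl) (auto simp: orth power2_eq_square)
  also have "\<dots> = (\<Sum>i\<in>I. integral\<^sup>L M (\<lambda>w. (X i w)\<^sup>2))" using I by simp
  finally show "integral\<^sup>L M (\<lambda>w. (\<Sum>i\<in>I. X i w)\<^sup>2) = (\<Sum>i\<in>I. integral\<^sup>L M (\<lambda>w. (X i w)\<^sup>2))" .
qed

text \<open>Along the squares the normalised variances are of order \<open>1 / n^2\<close>, hence
  summable. Between consecutive squares there are only about \<open>2 * n\<close> indices, so adding
  the squares of all partial sums of the gap is still cheap enough and takes the place of a maximal
  inequality.\<close>

lemma orthogonal_strong_law:
  fixes X :: "nat \<Rightarrow> 'a \<Rightarrow> real"
  assumes meas [measurable]: "\<And>n. X n \<in> borel_measurable M"
    and int2: "\<And>n. integrable M (\<lambda>w. (X n w)\<^sup>2)"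
    and orth: "\<And>m n. m < n \<Longrightarrow> integral\<^sup>L M (\<lambda>w. X m w * X n w) = 0"
    and bound: "\<And>n. integral\<^sup>L M (\<lambda>w. (X n w)\<^sup>2) \<le> C"
  shows "AE w in M. (\<lambda>n. (\<Sum>i<n. X i w) / real n) \<longlonglongrightarrow> 0"
proof -
  have orth': "integral\<^sup>L M (\<lambda>w. X m w * X n w) = 0" if "m \<noteq> n" for m n
    using that orth[of m n] orth[of n m] by (cases "m < n") (auto simp: mult.commute)
  note sq = integral_square_sum_orthogonal[where X = X, OF meas int2 orth']
  have C: "C \<ge> 0" using bound[of 0] by (smt (verit) Bochner_Integration.integral_nonneg zero_le_power2)
  have sq_le: "integral\<^sup>L M (\<lambda>w. (\<Sum>i\<in>I. X i w)\<^sup>2) \<le> real (card I) * C" if "finite I" for I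
    using sum_bounded_above[of I "\<lambda>i. integral\<^sup>L M (\<lambda>w. (X i w)\<^sup>2)" C] bound that by (simp add: sq)
  \<comment> \<open>Controls both the partial sum at \<open>n^2\<close> and every partial sum of the
    gap that follows, relative to the square of \<open>n^2\<close>.\<close>
  define Q where "Q = (\<lambda>n w. ((\<Sum>i<n\<^sup>2. X i w)\<^sup>2 + (\<Sum>m=n\<^sup>2..<(Suc n)\<^sup>2. (\<Sum>i=n\<^sup>2..<m. X i w)\<^sup>2)) / real n ^ 4)"
  have Q_int: "integrable M (Q n)" for n
    unfolding Q_def by (intro Bochner_Integration.integrable_divide Bochner_Integration.integrable_add Bochner_Integration.integrable_sum sq) auto
  have Q_nonneg: "Q n w \<ge> 0" for n w
    unfolding Q_def by (intro divide_nonneg_nonneg add_nonneg_nonneg sum_nonneg) auto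
  \<comment> \<open>The factor 10 is \<open>1 + 9\<close>: one part from the sum up to
    \<open>n^2\<close>, and at most \<open>3 * n\<close> gap sums, each with second moment at most
    \<open>3 * n * C\<close>. At \<open>n = 0\<close> both sides vanish because division by 0 gives
    0.\<close>
  have Q_le: "integral\<^sup>L M (Q n) \<le> 10 * C * inverse (real n ^ 2)" for n
  proof (cases "n = 0")
    case False
    have "integral\<^sup>L M (Q n) = (integral\<^sup>L M (\<lambda>w. (\<Sum>i<n\<^sup>2. X i w)\<^sup>2)
        + (\<Sum>m=n\<^sup>2..<(Suc n)\<^sup>2. integral\<^sup>L M (\<lambda>w. (\<Sum>i=n\<^sup>2..<m. X i w)\<^sup>2))) / real n ^ 4"
      unfolding Q_def using sq(1) by (simp add: integral_add integral_sum)
    also have "\<dots> \<le> (real (card {..<n\<^sup>2}) * C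
        + (\<Sum>m=n\<^sup>2..<(Suc n)\<^sup>2. real (card {n\<^sup>2..<m}) * C)) / real n ^ 4"
      by (intro divide_right_mono add_mono sum_mono sq_le) auto
    also have "\<dots> \<le> (real n ^ 2 * C + (\<Sum>m=n\<^sup>2..<(Suc n)\<^sup>2. (3 * real n) * C)) / real n ^ 4"
    proof (intro divide_right_mono add_mono sum_mono mult_right_mono C)
      fix m assume "m \<in> {n\<^sup>2..<(Suc n)\<^sup>2}"
      then have "m \<le> n\<^sup>2 + 2 * n" by (simp add: power2_eq_square)
      then have "m - n\<^sup>2 \<le> 3 * n" by linarith
      then have "card {n\<^sup>2..<m} \<le> 3 * n" by (simp only: card_atLeastLessThan)
      then show "real (card {n\<^sup>2..<m}) \<le> 3 * real n" by linarith
    qed auto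
    also have "(\<Sum>m=n\<^sup>2..<(Suc n)\<^sup>2. (3 * real n) * C) = real ((Suc n)\<^sup>2 - n\<^sup>2) * (3 * real n * C)"
      by simp
    also have "\<dots> \<le> real (3 * n) * (3 * real n * C)"
    proof (intro mult_right_mono)
      have "(Suc n)\<^sup>2 - n\<^sup>2 \<le> 3 * n" using False by (simp add: power2_eq_square)
      then show "real ((Suc n)\<^sup>2 - n\<^sup>2) \<le> real (3 * n)" by linarith
    qed (use C in auto)
    also have "(real n ^ 2 * C + real (3 * n) * (3 * real n * C)) / real n ^ 4 = 10 * C * inverse (real n ^ 2)"
      using False by (simp add: field_simps power2_eq_square power4_eq_xxxx)
    finally show ?thesis by (simp add: divide_right_mono)
  qed (simp add: Q_def)
  have "AE w in M. (\<lambda>n. Q n w) \<longlonglongrightarrow> 0"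
  proof (rule AE_tendsto_0_of_summable_integral[OF Q_int Q_nonneg])
    have "summable (\<lambda>n. 10 * C * inverse (real n ^ 2))"
      by (intro summable_mult inverse_power_summable) simp
    then show "summable (\<lambda>n. integral\<^sup>L M (Q n))"
    proof (rule summable_comparison_test')
      show "norm (integral\<^sup>L M (Q n)) \<le> 10 * C * inverse (real n ^ 2)" for n
        using Q_le[of n] Bochner_Integration.integral_nonneg[of M "Q n"] Q_nonneg by simp
    qed
  qed
  then show ?thesis
  proof eventually_elim
    case (elim w)
    define S where "S = (\<lambda>n. \<Sum>i<n. X i w)"
    have le: "(S k / real k)\<^sup>2 \<le> 2 * Q (floor_sqrt k) w" if k: "k \<ge> 1" for k
    proof -
      define n where "n = floor_sqrt k"
      have n: "n\<^sup>2 \<le> k" "k < (Suc n)\<^sup>2" "n \<ge> 1"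
        using k Suc_floor_sqrt_power2_gt[of k] by (auto simp: n_def le_floor_sqrt_iff)
      have S: "S k = S (n\<^sup>2) + (\<Sum>i=n\<^sup>2..<k. X i w)"
        unfolding S_def using n(1) by (simp add: lessThan_atLeast0 sum.atLeastLessThan_concat)
      have "(S k)\<^sup>2 \<le> 2 * (S (n\<^sup>2))\<^sup>2 + 2 * (\<Sum>i=n\<^sup>2..<k. X i w)\<^sup>2"
        unfolding S using sum_squares_bound[of "S (n\<^sup>2)" "\<Sum>i=n\<^sup>2..<k. X i w"]
        by (simp add: power2_sum)
      also have "(\<Sum>i=n\<^sup>2..<k. X i w)\<^sup>2 \<le> (\<Sum>m=n\<^sup>2..<(Suc n)\<^sup>2. (\<Sum>i=n\<^sup>2..<m. X i w)\<^sup>2)"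
        using n by (intro member_le_sum[of k _ "\<lambda>m. (\<Sum>i=n\<^sup>2..<m. X i w)\<^sup>2"]) auto
      finally have 1: "(S k)\<^sup>2 \<le> 2 * (Q n w * real n ^ 4)"
        using n unfolding Q_def S_def by simp
      have "real (n\<^sup>2) \<le> real k" using n(1) by (rule of_nat_mono)
      then have "(real n ^ 2)\<^sup>2 \<le> (real k)\<^sup>2" by (intro power_mono) auto
      then have 2: "real n ^ 4 \<le> (real k)\<^sup>2" by simp
      have "(S k)\<^sup>2 \<le> 2 * (Q n w * (real k)\<^sup>2)"
        using 1 mult_left_mono[OF 2 Q_nonneg[of n w]] by linarith
      then show ?thesis using k by (simp add: power_divide divide_le_eq n_def mult.assoc)
    qed
    have "filterlim floor_sqrt sequentially sequentially"
      unfolding filterlim_at_top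
    proof
      fix Z
      show "\<forall>\<^sub>F x in sequentially. Z \<le> floor_sqrt x"
        using eventually_ge_at_top[of "Z\<^sup>2"] by eventually_elim (simp add: le_floor_sqrt_iff)
    qed
    then have "(\<lambda>k. Q (floor_sqrt k) w) \<longlonglongrightarrow> 0"
      by (rule filterlim_compose[OF elim])
    then have lim: "(\<lambda>k. 2 * Q (floor_sqrt k) w) \<longlonglongrightarrow> 0"
      by (rule tendsto_mult_right_zero)
    have "(\<lambda>k. (S k / real k)\<^sup>2) \<longlonglongrightarrow> 0"
    proof (rule tendsto_sandwich[OF _ _ tendsto_const lim])
      show "\<forall>\<^sub>F k in sequentially. (S k / real k)\<^sup>2 \<le> 2 * Q (floor_sqrt k) w"
        by (rule eventually_sequentiallyI[of 1]) (rule le)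
      show "\<forall>\<^sub>F k in sequentially. 0 \<le> (S k / real k)\<^sup>2"
        by (intro always_eventually allI zero_le_power2)
    qed
    then show ?case unfolding S_def by (subst (asm) power_tendsto_0_iff) simp_all
  qed
qed

section \<open>Strong laws driven by independent standard normal variables\<close>

locale gaussian_white_noise = prob_space +
  fixes eps :: "nat \<Rightarrow> 'a \<Rightarrow> real"
  assumes indep: "indep_vars (\<lambda>_. borel) eps {1..}"
    and normal: "\<And>n. n \<ge> 1 \<Longrightarrow> distributed M lborel (eps n) (\<lambda>x. ennreal (std_normal_density x))"
begin

lemma eps_measurable [measurable]: "n \<ge> 1 \<Longrightarrow> eps n \<in> borel_measurable M"
  using indep by (auto simp: indep_vars_def)

lemma integrable_eps_power: "n \<ge> 1 \<Longrightarrow> integrable M (\<lambda>w. eps n w ^ k)"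
  using distributed_integrable[OF normal, of n "\<lambda>x. x ^ k"] integrable_std_normal_moment by auto

lemma expectation_eps_power:
  "n \<ge> 1 \<Longrightarrow> expectation (\<lambda>w. eps n w ^ k) = (\<integral>x. std_normal_density x * x ^ k \<partial>lborel)"
  using distributed_integral[OF normal, of n "\<lambda>x. x ^ k"] by auto

lemma expectation_eps: "n \<ge> 1 \<Longrightarrow> expectation (eps n) = 0"
  using expectation_eps_power[of n 1] integral_std_normal_moment_odd[of 0] by simp

lemma expectation_eps_square: "n \<ge> 1 \<Longrightarrow> expectation (\<lambda>w. (eps n w)\<^sup>2) = 1"
  using expectation_eps_power[of n 2] integral_std_normal_moment_even[of 1] by (simp add: fact_numeral)

lemma expectation_eps_power4: "n \<ge> 1 \<Longrightarrow> expectation (\<lambda>w. eps n w ^ 4) = 3"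
  using expectation_eps_power[of n 4] integral_std_normal_moment_even[of 2] by (simp add: fact_numeral)

lemma integrable_eps: "n \<ge> 1 \<Longrightarrow> integrable M (eps n)"
  using integrable_eps_power[of n 1] by simp

text \<open>The independence used below always has this form: one noise variable against a
  functional of others.\<close>

lemma indep_var_eps_functional:
  assumes "m \<ge> 1" "J \<subseteq> {1..}" "m \<notin> J"
    and "g \<in> borel_measurable borel" "f \<in> borel_measurable (Pi\<^sub>M J (\<lambda>_. borel))"
  shows "indep_var borel (\<lambda>w. g (eps m w)) borel (\<lambda>w. f (restrict (\<lambda>i. eps i w) J))"
proof -
  have "indep_var borel ((\<lambda>x. g (x m)) \<circ> (\<lambda>w. restrict (\<lambda>i. eps i w) {m}))
      borel (f \<circ> (\<lambda>w. restrict (\<lambda>i. eps i w) J))"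
  proof (rule indep_var_compose[OF indep_var_restrict[OF indep]])
    show "(\<lambda>x. g (x m)) \<in> borel_measurable (Pi\<^sub>M {m} (\<lambda>_. borel))"
      by (rule measurable_compose[OF _ assms(4)]) simp
  qed (use assms in auto)
  then show ?thesis by (simp add: comp_def)
qed

lemma expectation_eps_mult:
  assumes "i \<ge> 1" "j \<ge> 1" "i \<noteq> j"
  shows "expectation (\<lambda>w. eps i w * eps j w) = 0"
proof -
  have "indep_var borel (\<lambda>w. eps i w) borel (\<lambda>w. (\<lambda>x. x j) (restrict (\<lambda>i. eps i w) {j}))"
    by (rule indep_var_eps_functional) (use assms in auto)
  then show ?thesis
    using indep_var_lebesgue_integral[of "eps i" "eps j"] assms
    by (simp add: integrable_eps expectation_eps)
qed

lemma integrable_eps_mult: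
  assumes "i \<ge> 1" "j \<ge> 1"
  shows "integrable M (\<lambda>w. eps i w * eps j w)"
  using assms by (intro integrable_mult_of_squares integrable_eps_power) auto

lemma integrable_linear_square:
  "integrable M (\<lambda>w. (\<Sum>i=1..<n. a i * eps i w)\<^sup>2)"
proof -
  have eq: "(\<lambda>w. (\<Sum>i=1..<n. a i * eps i w)\<^sup>2)
      = (\<lambda>w. \<Sum>i=1..<n. \<Sum>j=1..<n. (a i * a j) * (eps i w * eps j w))"
    by (simp add: power2_eq_square sum_product mult_ac)
  show ?thesis unfolding eq
    by (intro Bochner_Integration.integrable_sum integrable_mult_right integrable_eps_mult) auto
qed

text \<open>The products \<open>F\<^sub>n \<epsilon>\<^sub>n\<close> with \<open>F\<^sub>n\<close> in the span of the earlier noise are orthogonal, because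
  the last noise factor is independent of everything else.\<close>

lemma predictable_strong_law:
  fixes a :: "nat \<Rightarrow> nat \<Rightarrow> real"
  assumes bound: "\<And>n. n \<ge> 1 \<Longrightarrow> expectation (\<lambda>w. (\<Sum>i=1..<n. a n i * eps i w)\<^sup>2) \<le> C"
  shows "AE w in M. (\<lambda>n. (\<Sum>m=1..n. (\<Sum>i=1..<m. a m i * eps i w) * eps m w) / real n) \<longlonglongrightarrow> 0"
proof -
  define F where "F = (\<lambda>n w. \<Sum>i=1..<n. a n i * eps i w)"
  define X where "X = (\<lambda>n w. F (Suc n) w * eps (Suc n) w)"
  have F_meas [measurable]: "F n \<in> borel_measurable M" for n
    unfolding F_def by (intro borel_measurable_sum borel_measurable_times borel_measurable_const eps_measurable) auto
  have F_sq: "integrable M (\<lambda>w. (F n w)\<^sup>2)" for n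
    unfolding F_def by (rule integrable_linear_square)
  have ind_sq: "indep_var borel (\<lambda>w. (eps n w)\<^sup>2) borel (\<lambda>w. (F n w)\<^sup>2)" if n: "n \<ge> 1" for n
  proof -
    have "indep_var borel (\<lambda>w. (eps n w)\<^sup>2) borel
        (\<lambda>w. (\<lambda>x. (\<Sum>i=1..<n. a n i * x i)\<^sup>2) (restrict (\<lambda>i. eps i w) {1..<n}))"
      by (rule indep_var_eps_functional) (use n in auto)
    then show ?thesis unfolding F_def by simp
  qed
  have X_sq_eq: "(X n w)\<^sup>2 = (eps (Suc n) w)\<^sup>2 * (F (Suc n) w)\<^sup>2" for n w
    unfolding X_def by (simp add: power_mult_distrib mult.commute)
  have X_meas [measurable]: "X n \<in> borel_measurable M" for n unfolding X_def by measurable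
  have X_sq: "integrable M (\<lambda>w. (X n w)\<^sup>2)" for n
    unfolding X_sq_eq by (intro indep_var_integrable[OF ind_sq] integrable_eps_power F_sq) auto
  have "AE w in M. (\<lambda>n. (\<Sum>i<n. X i w) / real n) \<longlonglongrightarrow> 0"
  proof (rule orthogonal_strong_law[OF X_meas X_sq])
    show "integral\<^sup>L M (\<lambda>w. (X n w)\<^sup>2) \<le> C" for n
    proof -
      have "integral\<^sup>L M (\<lambda>w. (X n w)\<^sup>2) = 1 * integral\<^sup>L M (\<lambda>w. (F (Suc n) w)\<^sup>2)"
        unfolding X_sq_eq
        by (subst indep_var_lebesgue_integral[OF ind_sq])
          (use F_sq integrable_eps_power expectation_eps_square in auto)
      then show ?thesis using bound[of "Suc n"] unfolding F_def by simp
    qed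
    show "integral\<^sup>L M (\<lambda>w. X m w * X n w) = 0" if mn: "m < n" for m n
    proof -
      have "indep_var borel (\<lambda>w. eps (Suc n) w) borel
          (\<lambda>w. (\<lambda>x. (\<Sum>i=1..<Suc m. a (Suc m) i * x i) * x (Suc m) * (\<Sum>i=1..<Suc n. a (Suc n) i * x i))
            (restrict (\<lambda>i. eps i w) {1..<Suc n}))"
      proof (rule indep_var_eps_functional)
        show "(\<lambda>x. (\<Sum>i=1..<Suc m. a (Suc m) i * x i) * x (Suc m) * (\<Sum>i=1..<Suc n. a (Suc n) i * x i))
            \<in> borel_measurable (Pi\<^sub>M {1..<Suc n} (\<lambda>_. borel))"
          using mn by (intro borel_measurable_times borel_measurable_sum borel_measurable_const
              measurable_component_singleton) auto
      qed auto
      moreover have "(\<lambda>w. (\<lambda>x. (\<Sum>i=1..<Suc m. a (Suc m) i * x i) * x (Suc m) * (\<Sum>i=1..<Suc n. a (Suc n) i * x i))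
            (restrict (\<lambda>i. eps i w) {1..<Suc n})) = (\<lambda>w. X m w * F (Suc n) w)"
        unfolding X_def F_def using mn by (auto intro!: ext arg_cong2[of _ _ _ _ "(*)"] sum.cong)
      ultimately have ind: "indep_var borel (eps (Suc n)) borel (\<lambda>w. X m w * F (Suc n) w)" by simp
      have int: "integrable M (\<lambda>w. X m w * F (Suc n) w)"
        by (intro integrable_mult_of_squares X_sq F_sq) auto
      have "integral\<^sup>L M (\<lambda>w. X m w * X n w) = integral\<^sup>L M (\<lambda>w. eps (Suc n) w * (X m w * F (Suc n) w))"
        by (rule Bochner_Integration.integral_cong) (auto simp: X_def mult_ac)
      also have "\<dots> = 0"
        using indep_var_lebesgue_integral[OF ind _ int] by (simp add: integrable_eps expectation_eps)
      finally show ?thesis .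
    qed
  qed
  moreover have "(\<Sum>i<n. X i w) = (\<Sum>m=1..n. F m w * eps m w)" for n w
    unfolding X_def by (rule sum.reindex_bij_witness[of _ "\<lambda>i. i - 1" Suc]) auto
  ultimately show ?thesis unfolding F_def by simp
qed

lemma weighted_squares_strong_law:
  fixes s :: "nat \<Rightarrow> real"
  assumes bound: "\<And>n. \<bar>s n\<bar> \<le> C"
  shows "AE w in M. (\<lambda>n. (\<Sum>i<n. s i * ((eps (Suc i) w)\<^sup>2 - 1)) / real n) \<longlonglongrightarrow> 0"
proof -
  define X where "X = (\<lambda>i w. s i * ((eps (Suc i) w)\<^sup>2 - 1))"
  have [measurable]: "eps (Suc n) \<in> borel_measurable M" for n by simp
  have X_meas [measurable]: "X n \<in> borel_measurable M" for n unfolding X_def by measurable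
  have X_sq_eq: "(X n w)\<^sup>2 = (s n)\<^sup>2 * (eps (Suc n) w ^ 4 - 2 * (eps (Suc n) w)\<^sup>2 + 1)" for n w
    unfolding X_def by (simp add: power_mult_distrib power2_diff)
  have int: "integrable M (\<lambda>w. eps (Suc n) w ^ 4)" "integrable M (\<lambda>w. (eps (Suc n) w)\<^sup>2)" for n
    by (rule integrable_eps_power; simp)+
  have X_sq: "integrable M (\<lambda>w. (X n w)\<^sup>2)" for n
    unfolding X_sq_eq using int by simp
  have "AE w in M. (\<lambda>n. (\<Sum>i<n. X i w) / real n) \<longlonglongrightarrow> 0"
  proof (rule orthogonal_strong_law[OF X_meas X_sq])
    \<comment> \<open>The square of a standard normal variable has variance
      \<open>3 - 2 + 1 = 2\<close>.\<close>
    show "integral\<^sup>L M (\<lambda>w. (X n w)\<^sup>2) \<le> C\<^sup>2 * 2" for n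
    proof -
      have "integral\<^sup>L M (\<lambda>w. (X n w)\<^sup>2) = (s n)\<^sup>2 * 2"
        unfolding X_sq_eq using int by (simp add: expectation_eps_power4 expectation_eps_square prob_space)
      also have "\<dots> \<le> C\<^sup>2 * 2"
        using power_mono[OF bound[of n], of 2] by (intro mult_right_mono) auto
      finally show ?thesis .
    qed
    show "integral\<^sup>L M (\<lambda>w. X m w * X n w) = 0" if mn: "m < n" for m n
    proof -
      have "indep_var borel (\<lambda>w. s m * ((eps (Suc m) w)\<^sup>2 - 1)) borel
          (\<lambda>w. (\<lambda>x. s n * ((x (Suc n))\<^sup>2 - 1)) (restrict (\<lambda>i. eps i w) {Suc n}))"
        by (rule indep_var_eps_functional) (use mn in auto)
      then have ind: "indep_var borel (X m) borel (X n)" unfolding X_def by simp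
      have "integrable M (X k)" for k unfolding X_def using int by simp
      moreover have "integral\<^sup>L M (X k) = 0" for k
        unfolding X_def using int by (simp add: expectation_eps_square prob_space)
      ultimately show ?thesis using indep_var_lebesgue_integral[OF ind] by simp
    qed
  qed
  then show ?thesis unfolding X_def .
qed

end

section \<open>Innovations and the Durbin-Levinson recursion\<close>

lemma sum_split_last: "n \<ge> 1 \<Longrightarrow> (\<Sum>i=1..<n. f i) = (\<Sum>i=1..n. f i) - (f n :: real)" for n :: nat
  by (cases n) (auto simp: atLeastLessThanSuc_atLeastAtMost)

text \<open>The Yule-Walker system of the innovations \<open>\<Sum>\<^sub>i k(n,i) \<xi>\<^sub>i\<close>. It determines \<open>k\<close> because the
  triangular array \<open>k\<close> itself diagonalises the Toeplitz matrix of \<open>r\<close>.\<close>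

locale yule_walker =
  fixes r :: "int \<Rightarrow> real" and k :: "nat \<Rightarrow> nat \<Rightarrow> real" and v :: "nat \<Rightarrow> real"
  assumes r_minus: "\<And>z. r (- z) = r z"
    and k_diag: "\<And>n. n \<ge> 1 \<Longrightarrow> k n n = 1"
    and v_pos: "\<And>n. n \<ge> 1 \<Longrightarrow> v n > 0"
    and k_eq: "\<And>n j. 1 \<le> j \<Longrightarrow> j \<le> n \<Longrightarrow>
      (\<Sum>i=1..n. k n i * r (int i - int j)) = (if j = n then v n else 0)"
begin

lemma r_swap: "r (a - b) = r (b - a)"
  using r_minus[of "a - b"] by simp

text \<open>Let \<open>t\<close> be the last index with \<open>c t\<close> nonzero. Combining the
  equations with the weights \<open>k t j\<close> and using the symmetry of \<open>r\<close>, the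
  property \<open>k_eq\<close> removes every term except \<open>c t * v t\<close>, which would then
  be 0.\<close>

lemma toeplitz_nondegenerate:
  assumes c: "\<And>j. j \<in> {1..m} \<Longrightarrow> (\<Sum>i=1..m. c i * r (int i - int j)) = 0" and i: "i \<in> {1..m}"
  shows "c i = 0"
proof (rule ccontr)
  assume "c i \<noteq> 0"
  define T where "T = {i\<in>{1..m}. c i \<noteq> 0}"
  define t where "t = Max T"
  have T: "finite T" "T \<noteq> {}" unfolding T_def using \<open>c i \<noteq> 0\<close> i by auto
  then have t: "t \<in> T" unfolding t_def by (rule Max_in)
  have t': "t \<ge> 1" "t \<le> m" "c t \<noteq> 0" using t unfolding T_def by auto
  have zero: "c i = 0" if "i \<in> {1..m}" "i > t" for i
  proof (rule ccontr)
    assume "c i \<noteq> 0"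
    then have "i \<in> T" using that unfolding T_def by simp
    then show False using Max_ge[OF T(1)] that unfolding t_def by force
  qed
  have "0 = (\<Sum>j=1..t. k t j * (\<Sum>i=1..m. c i * r (int i - int j)))"
    using c t' by (intro sum.neutral[symmetric]) auto
  also have "\<dots> = (\<Sum>j=1..t. k t j * (\<Sum>i=1..t. c i * r (int i - int j)))"
    using t' zero by (intro sum.cong refl arg_cong2[of _ _ _ _ "(*)"] sum.mono_neutral_right) auto
  also have "\<dots> = (\<Sum>i=1..t. c i * (\<Sum>j=1..t. k t j * r (int j - int i)))"
    unfolding sum_distrib_left by (subst sum.swap) (intro sum.cong refl, simp add: r_swap)
  also have "\<dots> = (\<Sum>i=1..t. if i = t then c t * v t else 0)"
  proof (intro sum.cong refl)
    fix i assume "i \<in> {1..t}"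
    then show "c i * (\<Sum>j=1..t. k t j * r (int j - int i)) = (if i = t then c t * v t else 0)"
      using k_eq[of i t] by simp
  qed
  also have "\<dots> = c t * v t" using t' by simp
  finally show False using t' v_pos[of t] by simp
qed

text \<open>The shifted row \<open>Suc n\<close> and the combination of row \<open>n\<close> with
  its reversal satisfy the same interior Yule-Walker equations; the reversal is admissible because
  \<open>r\<close> is even. Their difference solves a homogeneous Toeplitz system of order
  \<open>n - 1\<close> and therefore vanishes.\<close>

lemma Durbin_Levinson_interior:
  assumes i: "1 \<le> i" "i < n"
  shows "k (Suc n) (Suc i) = k n i + k (Suc n) 1 * k n (n - i)"
proof -
  define b where "b = k (Suc n) 1"
  define c where "c = (\<lambda>i. k (Suc n) (Suc i) - k n i - b * k n (n - i))"
  have n: "n \<ge> 1" using i by simp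
  have "c i = 0"
  proof (rule toeplitz_nondegenerate[where m = "n - 1"])
    fix j assume j: "j \<in> {1..n - 1}"
    have S: "{1..n - 1} = {1..<n}" using n by auto
    have 1: "(\<Sum>i=1..<n. k (Suc n) (Suc i) * r (int i - int j)) = - b * r (int j) - r (int n - int j)"
    proof -
      have "0 = (\<Sum>i=1..Suc n. k (Suc n) i * r (int i - int (Suc j)))"
        using k_eq[of "Suc j" "Suc n"] j by auto
      also have "\<dots> = (\<Sum>i=0..n. k (Suc n) (Suc i) * r (int i - int j))"
        unfolding One_nat_def sum.shift_bounds_cl_Suc_ivl by simp
      also have "\<dots> = (\<Sum>i=1..n. k (Suc n) (Suc i) * r (int i - int j)) + b * r (int j)"
        using r_minus[of "int j"] by (subst sum.atLeast_Suc_atMost) (auto simp: b_def)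
      also have "(\<Sum>i=1..n. k (Suc n) (Suc i) * r (int i - int j))
          = (\<Sum>i=1..<n. k (Suc n) (Suc i) * r (int i - int j)) + r (int n - int j)"
        using n by (subst sum_split_last) (auto simp: k_diag)
      finally show ?thesis by simp
    qed
    have 2: "(\<Sum>i=1..<n. k n i * r (int i - int j)) = - r (int n - int j)" if "j \<in> {1..n - 1}" for j
      using that n k_eq[of j n] by (subst sum_split_last) (auto simp: k_diag)
    have "(\<Sum>i=1..<n. k n (n - i) * r (int i - int j)) = (\<Sum>i=1..<n. k n i * r (int i - int (n - j)))"
    proof (rule sum.reindex_bij_witness[of _ "\<lambda>i. n - i" "\<lambda>i. n - i"])
      fix i assume i: "i \<in> {1..<n}"
      have "i \<le> n" "j \<le> n" using i j by auto
      then have "int (n - i) - int (n - j) = int j - int i" by (simp add: of_nat_diff)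
      then have "r (int (n - i) - int (n - j)) = r (int j - int i)" by (rule arg_cong)
      then show "k n (n - i) * r (int (n - i) - int (n - j)) = k n (n - i) * r (int i - int j)"
        by (simp add: r_swap)
    qed auto
    also have "\<dots> = - r (int n - int (n - j))" by (rule 2) (use j in auto)
    also have "int n - int (n - j) = int j"
    proof -
      have "j \<le> n" using j by auto
      then show ?thesis by (simp add: of_nat_diff)
    qed
    finally have 3: "(\<Sum>i=1..<n. k n (n - i) * r (int i - int j)) = - r (int j)" .
    have "(\<Sum>i=1..n - 1. c i * r (int i - int j)) = (\<Sum>i=1..<n. k (Suc n) (Suc i) * r (int i - int j))
        - (\<Sum>i=1..<n. k n i * r (int i - int j)) - b * (\<Sum>i=1..<n. k n (n - i) * r (int i - int j))"
      unfolding S c_def by (simp add: left_diff_distrib sum_subtractf sum_distrib_left mult.assoc)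
    then show "(\<Sum>i=1..n - 1. c i * r (int i - int j)) = 0"
      unfolding 1 3 using 2[OF j] by simp
  qed (use i in auto)
  then show ?thesis unfolding c_def b_def by simp
qed

text \<open>Since \<open>k n n = 1\<close>, the boundary terms \<open>g (Suc n)\<close> and
  \<open>g 1\<close> complete the two interior sums. The function \<open>g\<close> is arbitrary
  because the recursion is applied both to covariances and to trajectories.\<close>

lemma Durbin_Levinson:
  assumes n: "n \<ge> 1"
  shows "(\<Sum>i=1..Suc n. k (Suc n) i * g i)
    = (\<Sum>i=1..n. k n i * g (Suc i)) + k (Suc n) 1 * (\<Sum>i=1..n. k n i * g (Suc n - i))"
proof -
  define b where "b = k (Suc n) 1"
  have "(\<Sum>i=1..Suc n. k (Suc n) i * g i) = (\<Sum>i=0..n. k (Suc n) (Suc i) * g (Suc i))"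
    unfolding One_nat_def sum.shift_bounds_cl_Suc_ivl ..
  also have "\<dots> = b * g 1 + (\<Sum>i=1..n. k (Suc n) (Suc i) * g (Suc i))"
    by (subst sum.atLeast_Suc_atMost) (auto simp: b_def)
  also have "(\<Sum>i=1..n. k (Suc n) (Suc i) * g (Suc i))
      = (\<Sum>i=1..<n. k (Suc n) (Suc i) * g (Suc i)) + g (Suc n)"
    using n by (subst sum_split_last) (auto simp: k_diag)
  also have "(\<Sum>i=1..<n. k (Suc n) (Suc i) * g (Suc i))
      = (\<Sum>i=1..<n. k n i * g (Suc i)) + b * (\<Sum>i=1..<n. k n (n - i) * g (Suc i))"
    unfolding b_def using Durbin_Levinson_interior
    by (simp add: distrib_right sum.distrib sum_distrib_left mult.assoc)
  also have "(\<Sum>i=1..<n. k n i * g (Suc i)) = (\<Sum>i=1..n. k n i * g (Suc i)) - g (Suc n)"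
    using n by (subst sum_split_last) (auto simp: k_diag)
  also have "(\<Sum>i=1..<n. k n (n - i) * g (Suc i)) = (\<Sum>i=1..<n. k n i * g (Suc n - i))"
    by (rule sum.reindex_bij_witness[of _ "\<lambda>i. n - i" "\<lambda>i. n - i"]) (auto simp: Suc_diff_le)
  also have "\<dots> = (\<Sum>i=1..n. k n i * g (Suc n - i)) - g 1"
    using n by (subst sum_split_last) (auto simp: k_diag Suc_diff_le)
  finally show ?thesis unfolding b_def by (simp add: algebra_simps)
qed

text \<open>The recursion is tested against two covariance rows. Time \<open>Suc n\<close> gives
  \<open>v (Suc n) = v n + b * s\<close>; orthogonality to time 1 gives
  \<open>s + b * v n = 0\<close>. Eliminating \<open>s\<close> leaves the factor
  \<open>1 - b^2\<close>.\<close>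

lemma innovation_variance_Suc:
  assumes n: "n \<ge> 1"
  shows "v (Suc n) = v n * (1 - (k (Suc n) 1)\<^sup>2)"
proof -
  define b where "b = k (Suc n) 1"
  define s where "s = (\<Sum>i=1..n. k n i * r (int i))"
  have vn: "(\<Sum>i=1..n. k n i * r (int i - int n)) = v n" using k_eq[of n n] n by simp
  have "v (Suc n) = (\<Sum>i=1..Suc n. k (Suc n) i * r (int i - int (Suc n)))"
    using k_eq[of "Suc n" "Suc n"] by simp
  also have "\<dots> = (\<Sum>i=1..n. k n i * r (int (Suc i) - int (Suc n)))
      + b * (\<Sum>i=1..n. k n i * r (int (Suc n - i) - int (Suc n)))"
    unfolding b_def by (rule Durbin_Levinson[OF n])
  also have "(\<Sum>i=1..n. k n i * r (int (Suc n - i) - int (Suc n))) = s"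
    unfolding s_def using r_minus by (intro sum.cong refl) (auto simp: of_nat_diff)
  finally have 1: "v (Suc n) = v n + b * s" using vn by simp
  have "0 = (\<Sum>i=1..Suc n. k (Suc n) i * r (int i - int 1))"
    using k_eq[of 1 "Suc n"] n by simp
  also have "\<dots> = (\<Sum>i=1..n. k n i * r (int (Suc i) - int 1))
      + b * (\<Sum>i=1..n. k n i * r (int (Suc n - i) - int 1))"
    unfolding b_def by (rule Durbin_Levinson[OF n])
  also have "(\<Sum>i=1..n. k n i * r (int (Suc n - i) - int 1)) = v n"
    unfolding vn[symmetric]
  proof (intro sum.cong refl)
    fix i assume "i \<in> {1..n}"
    then have "int (Suc n - i) - int 1 = int n - int i" by (simp add: of_nat_diff)
    then show "k n i * r (int (Suc n - i) - int 1) = k n i * r (int i - int n)" by (simp add: r_swap)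
  qed
  finally have "s = - b * v n" unfolding s_def by simp
  with 1 show ?thesis unfolding b_def by (simp add: power2_eq_square algebra_simps)
qed

text \<open>This is where the second block of \<open>zeta\<close> comes from. Let \<open>Z\<close>
  be the forward filter and \<open>R\<close> the one with reversed coefficients. Durbin-Levinson
  gives \<open>R (Suc n) = R n - pacf k n * Z n\<close>, and \<open>R 1 = 0\<close> because the
  trajectory vanishes up to time 0, so \<open>R\<close> is minus the accumulated sum of
  \<open>pacf k m * Z m\<close>. The delayed filter of order \<open>Suc n\<close> is
  \<open>Z n - pacf k n * R n\<close>.\<close>

lemma filter_shift:
  fixes x :: "int \<Rightarrow> real"
  assumes x: "\<And>m. m \<le> 0 \<Longrightarrow> x m = 0"
  shows "(\<Sum>i=1..Suc n. k (Suc n) i * x (int i - 1 - int j))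
    = (\<Sum>i=1..n. k n i * x (int i - int j))
      + pacf k n * (\<Sum>m=1..<n. pacf k m * (\<Sum>i=1..m. k m i * x (int i - int j)))"
proof (cases "n = 0")
  case True
  then show ?thesis using x by simp
next
  case False
  define Z where "Z = (\<lambda>n. \<Sum>i=1..n. k n i * x (int i - int j))"
  define R where "R = (\<lambda>n. \<Sum>i=1..n. k n i * x (int n - int i - int j))"
  have b: "k (Suc n) 1 = - pacf k n" if "n \<ge> 1" for n using that by (simp add: pacf_def)
  have R: "R n = - (\<Sum>m=1..<n. pacf k m * Z m)" if "n \<ge> 1" for n
    using that
  proof (induction n rule: nat_induct_at_least)
    case base
    then show ?case using x unfolding R_def by simp
  next
    case (Suc n)
    have "R (Suc n) = (\<Sum>i=1..n. k n i * x (int (Suc n) - int (Suc i) - int j))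
        + k (Suc n) 1 * (\<Sum>i=1..n. k n i * x (int (Suc n) - int (Suc n - i) - int j))"
      unfolding R_def by (rule Durbin_Levinson[OF Suc.hyps])
    also have "\<dots> = R n - pacf k n * Z n"
      unfolding R_def Z_def b[OF Suc.hyps] by (simp add: of_nat_diff)
    finally show ?case using Suc by simp
  qed
  have n: "n \<ge> 1" using False by simp
  have "(\<Sum>i=1..Suc n. k (Suc n) i * x (int i - 1 - int j))
      = (\<Sum>i=1..n. k n i * x (int (Suc i) - 1 - int j))
        + k (Suc n) 1 * (\<Sum>i=1..n. k n i * x (int (Suc n - i) - 1 - int j))"
    by (rule Durbin_Levinson[OF n])
  also have "\<dots> = Z n - pacf k n * R n"
    unfolding R_def Z_def b[OF n] by (simp add: of_nat_diff)
  finally show ?thesis unfolding R[OF n] Z_def by simp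
qed

end

text \<open>From an index \<open>N\<close> on, where the tails of \<open>b\<close> have sum below
  \<open>1 / 2\<close>, the product of the factors \<open>1 - b n\<close> is at least one minus
  their sum, so at least half of \<open>x N\<close> remains. Applied to the innovation variances,
  this bounds the weights \<open>1 / (sig n)^2\<close>.\<close>

lemma discounted_product_limit:
  fixes x b :: "nat \<Rightarrow> real"
  assumes x: "\<And>n. x n > 0" and rec: "\<And>n. x (Suc n) = x n * (1 - b n)"
    and b: "\<And>n. b n \<ge> 0" and summ: "summable b"
  obtains s where "s > 0" "x \<longlonglongrightarrow> s" "\<And>n. s \<le> x n"
proof -
  have dec: "decseq x"
    using x b by (intro decseq_SucI) (simp add: rec mult_le_cancel_left1 less_imp_le)
  then obtain s where s: "x \<longlonglongrightarrow> s" "\<And>n. s \<le> x n"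
    using decseq_convergent[of x 0] x less_imp_le by metis
  obtain N where N: "\<And>m. (\<Sum>i<m. b (N + i)) < 1 / 2"
  proof -
    have "\<exists>N. \<forall>m\<ge>N. \<forall>n. norm (sum b {m..<n}) < 1 / 2"
      using summ unfolding summable_Cauchy by (elim allE[of _ "1 / 2"]) simp
    then obtain N where N: "\<And>n. norm (sum b {N..<n}) < 1 / 2" by blast
    have "(\<Sum>i<m. b (N + i)) = sum b {N..<N + m}" for m
      by (rule sum.reindex_bij_witness[of _ "\<lambda>i. i - N" "\<lambda>i. N + i"]) auto
    moreover have "sum b {N..<N + m} < 1 / 2" for m
      using N[of "N + m"] by (simp only: real_norm_def)
    ultimately show ?thesis by (intro that[of N]) simp
  qed
  have "x (N + m) \<ge> x N * (1 - (\<Sum>i<m. b (N + i)))" for m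
  proof (induction m)
    case (Suc m)
    have "x (N + m) * b (N + m) \<le> x N * b (N + m)"
      using dec b by (intro mult_right_mono) (auto simp: decseq_def)
    then show ?case using Suc by (simp add: rec algebra_simps)
  qed simp
  moreover have "x N * (1 - (\<Sum>i<m. b (N + i))) \<ge> x N / 2" for m
  proof -
    have "x N * (1 / 2) \<le> x N * (1 - (\<Sum>i<m. b (N + i)))"
      using x[of N] N[of m] by (intro mult_left_mono) auto
    then show ?thesis by simp
  qed
  ultimately have "x N / 2 \<le> x (N + m)" for m using order_trans by blast
  then have "x N / 2 \<le> s"
    using LIMSEQ_ignore_initial_segment[OF s(1), of N] by (intro LIMSEQ_le_const) (auto simp: add.commute)
  then have "s > 0" using x[of N] by simp
  then show ?thesis using s by (rule that)
qed

section \<open>The covariance equations satisfied by the innovation coefficients\<close>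

context gaussian_white_noise
begin

text \<open>Inversion of a triangular system with unit diagonal. The value
  \<open>a n = sig n\<close> is recorded because it becomes the diagonal entry
  \<open>(sig n)^2\<close> in the orthogonality relation.\<close>

lemma noise_in_innovation_span:
  assumes k_diag: "\<And>n. n \<ge> 1 \<Longrightarrow> k n n = 1"
    and dec: "\<And>n. n \<ge> 1 \<Longrightarrow> AE w in M. sig n * eps n w = (\<Sum>i=1..n. k n i * xi i w)"
  shows "n \<ge> 1 \<Longrightarrow> \<exists>a. (\<forall>i>n. a i = 0) \<and> a n = sig n \<and> (AE w in M. xi n w = (\<Sum>i=1..n. a i * eps i w))"
proof (induction n rule: less_induct)
  case (less n)
  define P where "P = (\<lambda>m a. (\<forall>i>m. a i = 0) \<and> (AE w in M. xi m w = (\<Sum>i=1..m. a i * eps i w)))"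
  have "\<forall>m\<in>{1..<n}. \<exists>a. P m a"
  proof
    fix m assume "m \<in> {1..<n}"
    then have "m < n" "1 \<le> m" by auto
    from less.IH[OF this] show "\<exists>a. P m a" unfolding P_def by blast
  qed
  then obtain a where "\<forall>m\<in>{1..<n}. P m (a m)" by (rule bchoice[THEN exE])
  then have a: "\<And>m i. m \<in> {1..<n} \<Longrightarrow> i > m \<Longrightarrow> a m i = 0"
    "\<And>m. m \<in> {1..<n} \<Longrightarrow> AE w in M. xi m w = (\<Sum>i=1..m. a m i * eps i w)"
    unfolding P_def by blast+
  define c where "c = (\<lambda>i. if i = n then sig n else - (\<Sum>m=1..<n. k n m * a m i))"
  have "AE w in M. \<forall>m\<in>{1..<n}. xi m w = (\<Sum>i=1..m. a m i * eps i w)"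
    using a(2) by (intro AE_finite_allI) auto
  moreover have "AE w in M. sig n * eps n w = (\<Sum>i=1..n. k n i * xi i w)"
    using dec less.prems by auto
  ultimately have "AE w in M. xi n w = (\<Sum>i=1..n. c i * eps i w)"
  proof eventually_elim
    case (elim w)
    have split: "{1..n} = insert n {1..<n}" using less.prems by auto
    have "xi n w = sig n * eps n w - (\<Sum>m=1..<n. k n m * xi m w)"
      using elim(2) less.prems k_diag unfolding split by simp
    also have "(\<Sum>m=1..<n. k n m * xi m w) = (\<Sum>m=1..<n. k n m * (\<Sum>i=1..<n. a m i * eps i w))"
    proof (intro sum.cong refl arg_cong2[of _ _ _ _ "(*)"])
      fix m assume m: "m \<in> {1..<n}"
      then have "xi m w = (\<Sum>i=1..m. a m i * eps i w)" using elim(1) by blast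
      also have "\<dots> = (\<Sum>i=1..<n. a m i * eps i w)"
        using m a(1)[OF m] by (intro sum.mono_neutral_left) auto
      finally show "xi m w = (\<Sum>i=1..<n. a m i * eps i w)" .
    qed
    also have "\<dots> = (\<Sum>i=1..<n. (\<Sum>m=1..<n. k n m * a m i) * eps i w)"
      unfolding sum_distrib_left sum_distrib_right by (subst sum.swap) (simp add: mult.assoc)
    finally show ?case unfolding split by (simp add: c_def sum_negf)
  qed
  moreover have "c i = 0" if "i > n" for i
  proof -
    have "(\<Sum>m=1..<n. k n m * a m i) = 0" using that a(1) by (intro sum.neutral) auto
    then show ?thesis using that unfolding c_def by simp
  qed
  ultimately show ?case by (intro exI[of _ c]) (auto simp: c_def)
qed

text \<open>The sum is the expectation of \<open>sig n * eps n\<close> times \<open>xi j\<close>,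
  and \<open>xi j\<close> lies in the span of \<open>eps 1, ..., eps j\<close>. A nonzero
  contribution needs \<open>eps n\<close> itself, hence \<open>j = n\<close>. This supplies
  \<open>k_eq\<close> of \<open>yule_walker\<close>.\<close>

lemma innovation_orthogonality:
  fixes xi :: "nat \<Rightarrow> 'a \<Rightarrow> real"
  assumes meas [measurable]: "\<And>n. n \<ge> 1 \<Longrightarrow> xi n \<in> borel_measurable M"
    and k_diag: "\<And>n. n \<ge> 1 \<Longrightarrow> k n n = 1"
    and dec: "\<And>n. n \<ge> 1 \<Longrightarrow> AE w in M. sig n * eps n w = (\<Sum>i=1..n. k n i * xi i w)"
    and j: "1 \<le> j" "j \<le> n"
  shows "(\<Sum>i=1..n. k n i * expectation (\<lambda>w. xi i w * xi j w)) = (if j = n then (sig n)\<^sup>2 else 0)"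
proof -
  have span: "\<exists>a. (\<forall>i>n. a i = 0) \<and> a n = sig n \<and> (AE w in M. xi n w = (\<Sum>i=1..n. a i * eps i w))"
    if "n \<ge> 1" for n
    by (rule noise_in_innovation_span[of k sig xi, OF _ _ that]) (use k_diag dec in auto)
  have int2: "integrable M (\<lambda>w. (xi i w)\<^sup>2)" if i: "i \<ge> 1" for i
  proof -
    obtain a where "AE w in M. xi i w = (\<Sum>l=1..i. a l * eps l w)" using span[OF i] by blast
    then have "AE w in M. (\<Sum>l=1..<Suc i. a l * eps l w)\<^sup>2 = (xi i w)\<^sup>2"
      by eventually_elim (simp add: atLeastLessThanSuc_atLeastAtMost)
    moreover have "(\<lambda>w. (xi i w)\<^sup>2) \<in> borel_measurable M" using meas[OF i] by simp
    ultimately show ?thesis by (intro integrable_cong_AE_imp[OF integrable_linear_square])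
  qed
  obtain a where a: "a j = sig j" "AE w in M. xi j w = (\<Sum>l=1..j. a l * eps l w)"
    using span[OF j(1)] by blast
  have int: "integrable M (\<lambda>w. xi i w * xi j w)" if "i \<ge> 1" for i
    using that j by (intro integrable_mult_of_squares int2) auto
  have "(\<Sum>i=1..n. k n i * expectation (\<lambda>w. xi i w * xi j w))
      = expectation (\<lambda>w. \<Sum>i=1..n. k n i * (xi i w * xi j w))"
    using int by (subst Bochner_Integration.integral_sum) auto
  also have "\<dots> = expectation (\<lambda>w. \<Sum>l=1..j. (sig n * a l) * (eps n w * eps l w))"
  proof (rule integral_cong_AE)
    show "(\<lambda>w. \<Sum>i=1..n. k n i * (xi i w * xi j w)) \<in> borel_measurable M"
      using int by (intro borel_measurable_integrable Bochner_Integration.integrable_sum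
          integrable_mult_right) auto
    show "(\<lambda>w. \<Sum>l=1..j. (sig n * a l) * (eps n w * eps l w)) \<in> borel_measurable M"
      using j by (intro borel_measurable_integrable Bochner_Integration.integrable_sum
          integrable_mult_right integrable_eps_mult) auto
    have "AE w in M. sig n * eps n w = (\<Sum>i=1..n. k n i * xi i w)" using dec j by simp
    with a(2) show "AE w in M. (\<Sum>i=1..n. k n i * (xi i w * xi j w))
        = (\<Sum>l=1..j. (sig n * a l) * (eps n w * eps l w))"
    proof eventually_elim
      case (elim w)
      have "(\<Sum>i=1..n. k n i * (xi i w * xi j w)) = (sig n * eps n w) * xi j w"
        unfolding elim(2) by (simp add: sum_distrib_right mult.assoc)
      then show ?case unfolding elim(1) by (simp add: sum_distrib_left mult_ac)
    qed
  qed
  also have "\<dots> = (\<Sum>l=1..j. (sig n * a l) * expectation (\<lambda>w. eps n w * eps l w))"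
    using j integrable_eps_mult by (subst Bochner_Integration.integral_sum) auto
  also have "\<dots> = (\<Sum>l=1..j. if l = n then sig n * a l else 0)"
  proof (intro sum.cong refl)
    fix l assume l: "l \<in> {1..j}"
    show "(sig n * a l) * expectation (\<lambda>w. eps n w * eps l w) = (if l = n then sig n * a l else 0)"
      using l j expectation_eps_mult[of n l] expectation_eps_square[of n]
      by (auto simp: power2_eq_square)
  qed
  also have "\<dots> = (if j = n then (sig n)\<^sup>2 else 0)"
    using j a by (auto simp: power2_eq_square intro!: sum.neutral)
  finally show ?thesis .
qed

end

section \<open>The likelihood regression\<close>

text \<open>These are the coordinates of \<open>Z\<^sub>n\<close>, of \<open>\<beta>\<^sub>n \<Sum>\<^sub>k\<^sub><\<^sub>n \<beta>\<^sub>k Z\<^sub>k\<close> and of \<open>a\<^sub>n\<^sup>* \<zeta>\<^sub>n\<close>.\<close>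

definition filtered :: "(nat \<Rightarrow> nat \<Rightarrow> real) \<Rightarrow> (int \<Rightarrow> real) \<Rightarrow> nat \<Rightarrow> nat \<Rightarrow> real" where
  "filtered k x n j = (\<Sum>i=1..n. k n i * x (int i - int j))"

definition memory :: "(nat \<Rightarrow> nat \<Rightarrow> real) \<Rightarrow> (int \<Rightarrow> real) \<Rightarrow> nat \<Rightarrow> nat \<Rightarrow> real" where
  "memory k x n j = pacf k n * (\<Sum>m=1..<n. pacf k m * filtered k x m j)"

definition regressor :: "(nat \<Rightarrow> nat \<Rightarrow> real) \<Rightarrow> (int \<Rightarrow> real) \<Rightarrow> nat \<Rightarrow> nat \<Rightarrow> real" where
  "regressor k x n j = filtered k x n j + memory k x n j"

context yule_walker
begin

text \<open>One more coordinate means one more step of delay, which is what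
  \<open>filter_shift\<close> resolves. These are the subdiagonal rows of the companion
  matrix.\<close>

lemma filtered_Suc_Suc:
  assumes "\<And>m. m \<le> 0 \<Longrightarrow> x m = 0"
  shows "filtered k x (Suc n) (Suc j) = regressor k x n j"
  using filter_shift[of x n j, OF assms]
  by (simp add: filtered_def regressor_def memory_def algebra_simps)

text \<open>The filter is applied to the model equation itself: each delayed trajectory turns into a
  regressor, and the noise into its filtered version, which is the innovation.\<close>

lemma filtered_Suc_0:
  assumes x0: "\<And>m. m \<le> 0 \<Longrightarrow> x m = 0"
    and x: "\<And>n. n \<ge> 1 \<Longrightarrow> x n = (\<Sum>l=1..p. \<theta> $ (l - 1) * x (n - int l)) + \<xi> (nat n)"
  shows "filtered k x (Suc n) 0 = (\<Sum>l<p. \<theta> $ l * regressor k x n l) + (\<Sum>i=1..Suc n. k (Suc n) i * \<xi> i)"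
proof -
  have "x (int i) = (\<Sum>l<p. \<theta> $ l * x (int i - int (Suc l))) + \<xi> i" if "i \<in> {1..Suc n}" for i
  proof -
    have "(\<Sum>l=1..p. \<theta> $ (l - 1) * x (int i - int l)) = (\<Sum>l<p. \<theta> $ l * x (int i - int (Suc l)))"
      by (rule sum.reindex_bij_witness[of _ Suc "\<lambda>l. l - 1"]) auto
    then show ?thesis using x[of "int i"] that by simp
  qed
  then have "filtered k x (Suc n) 0
      = (\<Sum>i=1..Suc n. k (Suc n) i * ((\<Sum>l<p. \<theta> $ l * x (int i - int (Suc l))) + \<xi> i))"
    unfolding filtered_def by (intro sum.cong refl) simp
  also have "\<dots> = (\<Sum>i=1..Suc n. \<Sum>l<p. \<theta> $ l * (k (Suc n) i * x (int i - int (Suc l))))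
      + (\<Sum>i=1..Suc n. k (Suc n) i * \<xi> i)"
    by (simp only: distrib_left sum.distrib sum_distrib_left mult_ac)
  also have "(\<Sum>i=1..Suc n. \<Sum>l<p. \<theta> $ l * (k (Suc n) i * x (int i - int (Suc l))))
      = (\<Sum>l<p. \<theta> $ l * filtered k x (Suc n) (Suc l))"
    unfolding filtered_def by (subst sum.swap) (simp only: sum_distrib_left)
  finally show ?thesis using filtered_Suc_Suc[OF x0] by simp
qed

end

section \<open>The estimator in coordinates and its error\<close>

lemma Zvec_index: "j < p \<Longrightarrow> Zvec p k x n $ j = filtered k x n j"
  by (simp add: Zvec_def Yvec_def filtered_def)

lemma dim_zeta [simp]: "dim_vec (zeta p k x n) = 2 * p"
  by (simp add: zeta_def Zvec_def)

lemma dim_amat [simp]: "dim_row (amat p k n) = 2 * p" "dim_col (amat p k n) = p"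
  by (simp_all add: amat_def append_rows_def)

lemma amat_index:
  assumes "i < 2 * p" "j < p"
  shows "amat p k n $$ (i, j) = (if i = j then 1 else if i = p + j then pacf k n else 0)"
  using assms by (auto simp: amat_def append_rows_def)

text \<open>At \<open>n = 0\<close> both sums are empty, in agreement with the convention
  \<open>zeta 0 = 0\<close>.\<close>

lemma zeta_index:
  assumes "i < 2 * p"
  shows "zeta p k x n $ i = (if i < p then filtered k x n i else (\<Sum>m=1..<n. pacf k m * filtered k x m (i - p)))"
  using assms by (auto simp: zeta_def Zvec_index Zvec_def[of p] Yvec_def filtered_def)

lemma amat_transpose_zeta:
  assumes j: "j < p"
  shows "(\<Sum>i<2 * p. amat p k n $$ (i, j) * zeta p k x n $ i) = regressor k x n j"
proof -
  have "(\<Sum>i<2 * p. amat p k n $$ (i, j) * zeta p k x n $ i)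
      = (\<Sum>i<2 * p. (if i = j then filtered k x n j else 0)
          + (if i = p + j then memory k x n j else 0))"
    using j by (intro sum.cong refl) (auto simp: amat_index zeta_index memory_def)
  also have "\<dots> = regressor k x n j"
    using j by (simp add: sum.distrib regressor_def)
  finally show ?thesis .
qed

lemma transpose_amat_mult_zeta:
  assumes j: "j < p"
  shows "(transpose_mat (amat p k n) *\<^sub>v zeta p k x n) $ j = regressor k x n j"
  using amat_transpose_zeta[OF j, of k n x] j
  by (simp add: scalar_prod_def lessThan_atLeast0)

lemma mle_matrix_index:
  assumes "r < p" "c < p"
  shows "mle_matrix p k sig x n $$ (r, c)
    = (\<Sum>i=1..n. regressor k x (i - 1) r * regressor k x (i - 1) c / (sig i)\<^sup>2)"
proof -
  have "(transpose_mat (amat p k m) * outer (zeta p k x m) (zeta p k x m) * amat p k m) $$ (r, c)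
      = regressor k x m r * regressor k x m c" for m
  proof -
    let ?A = "amat p k m" and ?z = "zeta p k x m"
    have 1: "(transpose_mat ?A * outer ?z ?z) $$ (r, i) = regressor k x m r * ?z $ i" if "i < 2 * p" for i
    proof -
      have "(transpose_mat ?A * outer ?z ?z) $$ (r, i) = (\<Sum>l<2 * p. ?A $$ (l, r) * (?z $ l * ?z $ i))"
        using that assms by (simp add: scalar_prod_def outer_def lessThan_atLeast0)
      also have "\<dots> = (\<Sum>l<2 * p. ?A $$ (l, r) * ?z $ l) * ?z $ i"
        by (simp add: sum_distrib_right mult.assoc)
      finally show ?thesis using amat_transpose_zeta[OF assms(1)] by simp
    qed
    have "(transpose_mat ?A * outer ?z ?z * ?A) $$ (r, c)
        = (\<Sum>i<2 * p. (transpose_mat ?A * outer ?z ?z) $$ (r, i) * ?A $$ (i, c))"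
      using assms by (simp add: scalar_prod_def lessThan_atLeast0 outer_def)
    also have "\<dots> = (\<Sum>i<2 * p. regressor k x m r * (?A $$ (i, c) * ?z $ i))"
      by (intro sum.cong refl) (simp only: 1 lessThan_iff mult_ac)
    also have "\<dots> = regressor k x m r * regressor k x m c"
      using amat_transpose_zeta[OF assms(2)] by (simp flip: sum_distrib_left)
    finally show ?thesis .
  qed
  then show ?thesis using assms by (simp add: mle_matrix_def)
qed

lemma mle_vector_index:
  assumes "j < p"
  shows "mle_vector p k sig x n $ j
    = (\<Sum>i=1..n. regressor k x (i - 1) j * filtered k x i 0 / (sig i)\<^sup>2)"
proof -
  have "unit_vec (2 * p) 0 \<bullet> zeta p k x i = filtered k x i 0" for i
    using assms scalar_prod_left_unit[of "zeta p k x i" "2 * p" 0]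
    by (simp add: zeta_index carrier_vecI)
  then show ?thesis
    using assms by (simp add: mle_vector_def transpose_amat_mult_zeta del: index_mult_mat_vec)
qed

text \<open>The vector of the estimator is \<open>S n\<close> applied to the true parameter plus the
  noise \<open>N n\<close>, so the error \<open>d\<close> solves \<open>S n d = N n\<close>. Testing
  with \<open>d\<close> gives \<open>c * n * |d|^2 <= |d| * |N n|\<close>, that is
  \<open>|d| <= |N n| / (c * n)\<close>. The same lower bound excludes a kernel of
  \<open>S n\<close>, so the estimator is eventually defined. Since \<open>(sig i)^2 <= 1\<close>,
  the weights only enlarge the quadratic form.\<close>

lemma estimator_tendsto_of_excitation:
  fixes x :: "int \<Rightarrow> real" and e :: "nat \<Rightarrow> real"
  assumes p: "p \<ge> 1" and \<theta>: "\<theta> \<in> carrier_vec p" and c: "c > 0"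
    and sig: "\<And>n. n \<ge> 1 \<Longrightarrow> 0 < sig n \<and> (sig n)\<^sup>2 \<le> 1"
    and reg: "\<And>n. filtered k x (Suc n) 0 = (\<Sum>l<p. \<theta> $ l * regressor k x n l) + e (Suc n)"
    and exc: "\<forall>\<^sub>F n in sequentially. \<forall>v. c * real n * (\<Sum>j<p. (v j)\<^sup>2) \<le> (\<Sum>i<n. (\<Sum>j<p. v j * regressor k x i j)\<^sup>2)"
    and noise: "\<And>j. j < p \<Longrightarrow> (\<lambda>n. (\<Sum>i=1..n. regressor k x (i - 1) j * e i / (sig i)\<^sup>2) / real n) \<longlonglongrightarrow> 0"
  shows "estimator_tendsto p (mle p k sig x) \<theta>"
proof -
  define S where "S = mle_matrix p k sig x"
  define N where "N = (\<lambda>n j. \<Sum>i=1..n. regressor k x (i - 1) j * e i / (sig i)\<^sup>2)"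
  have S: "S n \<in> carrier_mat p p" for n unfolding S_def mle_matrix_def by simp
  have S_index: "S n $$ (r, l) = (\<Sum>i=1..n. regressor k x (i - 1) r * regressor k x (i - 1) l / (sig i)\<^sup>2)"
    if "r < p" "l < p" for n r l
    unfolding S_def using that by (rule mle_matrix_index)
  have Sv: "(S n *\<^sub>v v) $ r = (\<Sum>l<p. S n $$ (r, l) * v $ l)" if "r < p" "v \<in> carrier_vec p" for n r v
    using that S[of n] by (simp add: scalar_prod_def lessThan_atLeast0)
  have quad: "(\<Sum>r<p. v $ r * (S n *\<^sub>v v) $ r) \<ge> (\<Sum>i<n. (\<Sum>j<p. v $ j * regressor k x i j)\<^sup>2)"
    if v: "v \<in> carrier_vec p" for n v
  proof -
    have "(\<Sum>i<n. (\<Sum>j<p. v $ j * regressor k x i j)\<^sup>2) = (\<Sum>i=1..n. (\<Sum>j<p. v $ j * regressor k x (i - 1) j)\<^sup>2)"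
      by (rule sum.reindex_bij_witness[of _ "\<lambda>i. i - 1" Suc]) auto
    also have "\<dots> \<le> (\<Sum>i=1..n. (\<Sum>j<p. v $ j * regressor k x (i - 1) j)\<^sup>2 / (sig i)\<^sup>2)"
    proof (rule sum_mono)
      fix i assume "i \<in> {1..n}"
      then have "0 < (sig i)\<^sup>2" "(sig i)\<^sup>2 \<le> 1" using sig[of i] by auto
      then show "(\<Sum>j<p. v $ j * regressor k x (i - 1) j)\<^sup>2 \<le> (\<Sum>j<p. v $ j * regressor k x (i - 1) j)\<^sup>2 / (sig i)\<^sup>2"
        by (subst pos_le_divide_eq) (auto intro: mult_left_le)
    qed
    also have "\<dots> = (\<Sum>i=1..n. \<Sum>r<p. \<Sum>l<p. v $ r * (regressor k x (i - 1) r * regressor k x (i - 1) l / (sig i)\<^sup>2 * v $ l))"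
      by (simp add: power2_eq_square sum_product sum_divide_distrib mult_ac)
    also have "\<dots> = (\<Sum>r<p. \<Sum>l<p. \<Sum>i=1..n. v $ r * (regressor k x (i - 1) r * regressor k x (i - 1) l / (sig i)\<^sup>2 * v $ l))"
      by (subst sum.swap, rule sum.cong[OF refl], rule sum.swap)
    also have "\<dots> = (\<Sum>r<p. v $ r * (S n *\<^sub>v v) $ r)"
      using v by (simp add: Sv S_index sum_distrib_left sum_distrib_right)
    finally show ?thesis .
  qed
  have vec: "mle_vector p k sig x n = S n *\<^sub>v \<theta> + Matrix.vec p (N n)" for n
  proof (rule eq_vecI)
    fix j assume "j < dim_vec (S n *\<^sub>v \<theta> + Matrix.vec p (N n))"
    then have j: "j < p" using S[of n] by simp
    have "mle_vector p k sig x n $ j = (\<Sum>i=1..n. (\<Sum>l<p. regressor k x (i - 1) j * regressor k x (i - 1) l / (sig i)\<^sup>2 * \<theta> $ l)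
        + regressor k x (i - 1) j * e i / (sig i)\<^sup>2)"
      unfolding mle_vector_index[OF j]
    proof (intro sum.cong refl)
      fix i assume i: "i \<in> {1..n}"
      then have "filtered k x i 0 = (\<Sum>l<p. \<theta> $ l * regressor k x (i - 1) l) + e i"
        using reg[of "i - 1"] by simp
      then show "regressor k x (i - 1) j * filtered k x i 0 / (sig i)\<^sup>2
          = (\<Sum>l<p. regressor k x (i - 1) j * regressor k x (i - 1) l / (sig i)\<^sup>2 * \<theta> $ l)
        + regressor k x (i - 1) j * e i / (sig i)\<^sup>2"
        by (simp add: distrib_left add_divide_distrib sum_distrib_left sum_divide_distrib mult_ac)
    qed
    also have "\<dots> = (\<Sum>l<p. \<Sum>i=1..n. regressor k x (i - 1) j * regressor k x (i - 1) l / (sig i)\<^sup>2 * \<theta> $ l) + N n j"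
      unfolding sum.distrib N_def by (subst sum.swap) simp
    also have "\<dots> = (S n *\<^sub>v \<theta>) $ j + N n j"
      using j \<theta> by (simp add: Sv S_index sum_distrib_right)
    finally show "mle_vector p k sig x n $ j = (S n *\<^sub>v \<theta> + Matrix.vec p (N n)) $ j"
      using j S[of n] by simp
  qed (use S in \<open>simp add: mle_vector_def\<close>)
  have ev: "\<forall>\<^sub>F n in sequentially. \<exists>B. mat_inverse (S n) = Some B \<and>
      (\<forall>j<p. ((B *\<^sub>v mle_vector p k sig x n) $ j - \<theta> $ j)\<^sup>2 \<le> (\<Sum>l<p. (N n l / real n)\<^sup>2) / c\<^sup>2)"
    using exc eventually_gt_at_top[of 0]
  proof eventually_elim
    case (elim n)
    have low: "c * real n * (\<Sum>j<p. (v $ j)\<^sup>2) \<le> (\<Sum>r<p. v $ r * (S n *\<^sub>v v) $ r)"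
      if "v \<in> carrier_vec p" for v
      using elim(1)[rule_format, of "\<lambda>j. v $ j"] quad[OF that, of n] by linarith
    have "det (S n) \<noteq> 0"
    proof
      assume "det (S n) = 0"
      then obtain v where v: "v \<in> carrier_vec p" "v \<noteq> 0\<^sub>v p" "S n *\<^sub>v v = 0\<^sub>v p"
        using det_0_iff_vec_prod_zero_field[OF S] by blast
      have "c * real n * (\<Sum>j<p. (v $ j)\<^sup>2) \<le> 0"
        using low[OF v(1)] unfolding v(3) by simp
      then have "(\<Sum>j<p. (v $ j)\<^sup>2) \<le> 0" using c elim(2) by (simp add: mult_le_0_iff)
      then have "(\<Sum>j<p. (v $ j)\<^sup>2) = 0" by (intro antisym sum_nonneg) auto
      then have "\<forall>j<p. v $ j = 0" by (simp add: sum_nonneg_eq_0_iff)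
      then have "v = 0\<^sub>v p" using v(1) by (intro eq_vecI) auto
      with v(2) show False by simp
    qed
    then have "S n \<in> Units (ring_mat TYPE(real) p ())" by (rule det_non_zero_imp_unit[OF S])
    then obtain B where B: "mat_inverse (S n) = Some B"
      using mat_inverse(1)[OF S, of n "()"] by (cases "mat_inverse (S n)") auto
    have B': "S n * B = 1\<^sub>m p" "B * S n = 1\<^sub>m p" "B \<in> carrier_mat p p"
      using mat_inverse(2)[OF S B] by auto
    define d where "d = B *\<^sub>v Matrix.vec p (N n)"
    have d: "d \<in> carrier_vec p" unfolding d_def using B' by simp
    have est: "B *\<^sub>v mle_vector p k sig x n = \<theta> + d"
    proof -
      have "B *\<^sub>v (S n *\<^sub>v \<theta>) = (B * S n) *\<^sub>v \<theta>"
        using B'(3) S \<theta> by (intro assoc_mult_mat_vec[symmetric]) auto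
      then have "B *\<^sub>v (S n *\<^sub>v \<theta>) = \<theta>" unfolding B'(2) using \<theta> by simp
      moreover have "B *\<^sub>v (S n *\<^sub>v \<theta> + Matrix.vec p (N n)) = B *\<^sub>v (S n *\<^sub>v \<theta>) + d"
        unfolding d_def using B'(3) S[of n] \<theta> by (intro mult_add_distrib_mat_vec) auto
      ultimately show ?thesis unfolding vec by simp
    qed
    have Sd: "S n *\<^sub>v d = Matrix.vec p (N n)"
    proof -
      have "S n *\<^sub>v (B *\<^sub>v Matrix.vec p (N n)) = (S n * B) *\<^sub>v Matrix.vec p (N n)"
        using B'(3) S by (intro assoc_mult_mat_vec[symmetric]) auto
      then show ?thesis unfolding d_def B'(1) by simp
    qed
    define D where "D = (\<Sum>j<p. (d $ j)\<^sup>2)"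
    have D0: "D \<ge> 0" unfolding D_def by (rule sum_nonneg) simp
    have "c * real n * D \<le> (\<Sum>r<p. d $ r * N n r)"
      using low[OF d] unfolding Sd D_def by simp
    then have "(c * real n * D)\<^sup>2 \<le> (\<Sum>r<p. d $ r * N n r)\<^sup>2"
      using c D0 by (intro power_mono) auto
    also have "\<dots> \<le> D * (\<Sum>l<p. (N n l)\<^sup>2)"
      unfolding D_def by (rule Cauchy_Schwarz_ineq_sum)
    finally have "D * (D * (c * real n)\<^sup>2) \<le> D * (\<Sum>l<p. (N n l)\<^sup>2)"
      by (simp add: power2_eq_square mult_ac)
    then have "D * (c * real n)\<^sup>2 \<le> (\<Sum>l<p. (N n l)\<^sup>2)"
    proof (cases "D = 0")
      case False
      then show ?thesis using \<open>D * (D * (c * real n)\<^sup>2) \<le> D * (\<Sum>l<p. (N n l)\<^sup>2)\<close> D0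
        by (simp add: mult_le_cancel_left)
    qed (simp add: sum_nonneg)
    then have "D \<le> (\<Sum>l<p. (N n l)\<^sup>2) / (c * real n)\<^sup>2"
      using c elim(2) by (subst pos_le_divide_eq) auto
    also have "\<dots> = (\<Sum>l<p. (N n l / real n)\<^sup>2) / c\<^sup>2"
      by (simp add: power_mult_distrib power_divide sum_divide_distrib mult.commute)
    finally have D: "D \<le> (\<Sum>l<p. (N n l / real n)\<^sup>2) / c\<^sup>2" .
    have "((B *\<^sub>v mle_vector p k sig x n) $ j - \<theta> $ j)\<^sup>2 \<le> (\<Sum>l<p. (N n l / real n)\<^sup>2) / c\<^sup>2" if j: "j < p" for j
    proof -
      have "(B *\<^sub>v mle_vector p k sig x n) $ j - \<theta> $ j = d $ j"
        unfolding est using j d \<theta> by simp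
      moreover have "(d $ j)\<^sup>2 \<le> D" unfolding D_def using j by (intro member_le_sum) auto
      ultimately show ?thesis using D by simp
    qed
    with B show ?case by blast
  qed
  have lim: "(\<lambda>n. (\<Sum>l<p. (N n l / real n)\<^sup>2) / c\<^sup>2) \<longlonglongrightarrow> 0"
  proof -
    have "(\<lambda>n. (\<Sum>l<p. (N n l / real n)\<^sup>2) / c\<^sup>2) \<longlonglongrightarrow> (\<Sum>l<p. 0\<^sup>2) / c\<^sup>2"
      using c noise unfolding N_def by (intro tendsto_divide tendsto_sum tendsto_power tendsto_const) auto
    then show ?thesis by simp
  qed
  show ?thesis unfolding estimator_tendsto_def
  proof (intro conjI allI impI)
    show "\<forall>\<^sub>F n in sequentially. mle p k sig x n \<noteq> None"
      using ev by eventually_elim (auto simp: mle_def S_def)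
    fix j assume j: "j < p"
    have "\<forall>\<^sub>F n in sequentially. (the (mle p k sig x n) $ j - \<theta> $ j)\<^sup>2 \<le> (\<Sum>l<p. (N n l / real n)\<^sup>2) / c\<^sup>2"
      using ev by eventually_elim (use j in \<open>auto simp: mle_def S_def\<close>)
    then have "(\<lambda>n. (the (mle p k sig x n) $ j - \<theta> $ j)\<^sup>2) \<longlonglongrightarrow> 0"
      by (rule tendsto_sandwich[OF _ _ tendsto_const lim, rotated]) (intro always_eventually allI zero_le_power2)
    then have "(\<lambda>n. the (mle p k sig x n) $ j - \<theta> $ j) \<longlonglongrightarrow> 0"
      by (subst (asm) power_tendsto_0_iff) simp_all
    then show "(\<lambda>n. the (mle p k sig x n) $ j) \<longlonglongrightarrow> \<theta> $ j" by (rule LIM_zero_cancel)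
  qed
qed

text \<open>Equality on a fixed set \<open>G\<close> instead of almost everywhere: one coefficient
  vector serves all of \<open>G\<close>, and no null sets pile up along the recursion.\<close>

definition in_span :: "'w set \<Rightarrow> (nat \<Rightarrow> 'w \<Rightarrow> real) \<Rightarrow> nat \<Rightarrow> ('w \<Rightarrow> real) \<Rightarrow> bool" where
  "in_span G eps n F \<longleftrightarrow> (\<exists>a. \<forall>w\<in>G. F w = (\<Sum>i=1..n. a i * eps i w))"

lemma in_span_add: "in_span G eps n F \<Longrightarrow> in_span G eps n H \<Longrightarrow> in_span G eps n (\<lambda>w. F w + H w)"
  unfolding in_span_def
proof (elim exE)
  fix a b assume "\<forall>w\<in>G. F w = (\<Sum>i=1..n. a i * eps i w)" "\<forall>w\<in>G. H w = (\<Sum>i=1..n. b i * eps i w)"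
  then show "\<exists>a. \<forall>w\<in>G. F w + H w = (\<Sum>i=1..n. a i * eps i w)"
    by (intro exI[of _ "\<lambda>i. a i + b i"]) (simp add: distrib_right sum.distrib)
qed

lemma in_span_scale: "in_span G eps n F \<Longrightarrow> in_span G eps n (\<lambda>w. c * F w)"
  unfolding in_span_def
proof (elim exE)
  fix a assume "\<forall>w\<in>G. F w = (\<Sum>i=1..n. a i * eps i w)"
  then show "\<exists>a. \<forall>w\<in>G. c * F w = (\<Sum>i=1..n. a i * eps i w)"
    by (intro exI[of _ "\<lambda>i. c * a i"]) (simp add: sum_distrib_left mult.assoc)
qed

lemma in_span_zero: "in_span G eps n (\<lambda>w. 0)"
  unfolding in_span_def by (intro exI[of _ "\<lambda>i. 0"]) simp

lemma in_span_sum: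
  "(\<And>i. i \<in> I \<Longrightarrow> in_span G eps n (F i)) \<Longrightarrow> in_span G eps n (\<lambda>w. \<Sum>i\<in>I. F i w)"
  by (induction I rule: infinite_finite_induct) (auto intro: in_span_zero in_span_add)

lemma in_span_mono:
  assumes "in_span G eps m F" "m \<le> n"
  shows "in_span G eps n F"
proof -
  obtain a where a: "\<forall>w\<in>G. F w = (\<Sum>i=1..m. a i * eps i w)" using assms unfolding in_span_def by blast
  have "(\<Sum>i=1..m. a i * eps i w) = (\<Sum>i=1..n. (if i \<le> m then a i else 0) * eps i w)" for w
    using assms by (intro sum.mono_neutral_cong_left) auto
  with a show ?thesis unfolding in_span_def by (intro exI[of _ "\<lambda>i. if i \<le> m then a i else 0"]) simp
qed

lemma in_span_noise: "1 \<le> i \<Longrightarrow> i \<le> n \<Longrightarrow> in_span G eps n (eps i)"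
  unfolding in_span_def
proof (intro exI[of _ "\<lambda>l. if l = i then 1 else 0"] ballI)
  fix w assume "1 \<le> i" "i \<le> n"
  then have "eps i w = (\<Sum>l=1..n. if l = i then eps l w else 0)" by simp
  also have "\<dots> = (\<Sum>l=1..n. (if l = i then 1 else 0) * eps l w)" by (intro sum.cong) auto
  finally show "eps i w = (\<Sum>l=1..n. (if l = i then 1 else 0) * eps l w)" .
qed

lemma in_span_cong: "(\<And>w. w \<in> G \<Longrightarrow> F w = H w) \<Longrightarrow> in_span G eps n F = in_span G eps n H"
  unfolding in_span_def by simp

text \<open>Strong induction: step \<open>n\<close> adds the single new variable
  \<open>eps n\<close>, and \<open>u n\<close> involves only values of \<open>z\<close> before
  \<open>n\<close>. So the regressor at \<open>n\<close> is predictable for the noise at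
  \<open>Suc n\<close>.\<close>

lemma perturbed_recursion_in_span:
  fixes z u :: "'w \<Rightarrow> nat \<Rightarrow> nat \<Rightarrow> real"
  assumes z0: "\<And>w j. w \<in> G \<Longrightarrow> j < p \<Longrightarrow> z w 0 j = 0"
    and zS: "\<And>w n j. w \<in> G \<Longrightarrow> j < p \<Longrightarrow> z w (Suc n) j
      = (\<Sum>l<p. A j l * (z w n l + u w n l)) + (if j = 0 then s (Suc n) * eps (Suc n) w else 0)"
    and u: "\<And>w n j. w \<in> G \<Longrightarrow> j < p \<Longrightarrow> u w n j = \<beta> n * (\<Sum>m=1..<n. \<beta> m * z w m j)"
  shows "j < p \<Longrightarrow> in_span G eps n (\<lambda>w. z w n j + u w n j)"
proof -
  have u_span: "in_span G eps n (\<lambda>w. u w n j)"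
    if "j < p" "\<And>m j. m < n \<Longrightarrow> j < p \<Longrightarrow> in_span G eps m (\<lambda>w. z w m j)" for n j
  proof -
    have "in_span G eps n (\<lambda>w. \<beta> n * (\<Sum>m=1..<n. \<beta> m * z w m j))"
      by (intro in_span_scale in_span_sum in_span_mono[OF that(2)]) (use that(1) in auto)
    then show ?thesis using u that(1) by (subst in_span_cong) auto
  qed
  have z_span: "in_span G eps n (\<lambda>w. z w n j)" if "j < p" for n j
    using that
  proof (induction n arbitrary: j rule: less_induct)
    case (less n)
    show ?case
    proof (cases n)
      case 0
      have "in_span G eps n (\<lambda>w. 0)" by (rule in_span_zero)
      then show ?thesis using z0 less.prems 0 by (subst in_span_cong) auto
    next
      case (Suc m)
      have "in_span G eps n (\<lambda>w. z w m l + u w m l)" if "l < p" for l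
        by (rule in_span_mono[of _ _ m]) (use that less.IH Suc in \<open>auto intro!: in_span_add u_span\<close>)
      then have 1: "in_span G eps n (\<lambda>w. \<Sum>l<p. A j l * (z w m l + u w m l))"
        by (intro in_span_sum in_span_scale) auto
      have "in_span G eps n (\<lambda>w. if j = 0 then s n * eps n w else 0)"
        using Suc by (cases "j = 0") (auto intro!: in_span_scale in_span_noise in_span_zero)
      then have "in_span G eps n (\<lambda>w. (\<Sum>l<p. A j l * (z w m l + u w m l)) + (if j = 0 then s n * eps n w else 0))"
        by (rule in_span_add[OF 1])
      then show ?thesis using zS less.prems Suc by (subst in_span_cong) auto
    qed
  qed
  then show "j < p \<Longrightarrow> in_span G eps n (\<lambda>w. z w n j + u w n j)"
    by (intro in_span_add u_span) auto
qed

section \<open>Limits of noise averages and moments of the regressors\<close>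

context gaussian_white_noise
begin

lemma noise_energy_average: "AE w in M. (\<lambda>n. (\<Sum>i=1..n. (eps i w)\<^sup>2) / real n) \<longlonglongrightarrow> 1"
proof -
  have "AE w in M. (\<lambda>n. (\<Sum>i<n. 1 * ((eps (Suc i) w)\<^sup>2 - 1)) / real n) \<longlonglongrightarrow> 0"
    by (rule weighted_squares_strong_law[of "\<lambda>_. 1" 1]) simp
  then show ?thesis
  proof eventually_elim
    case (elim w)
    have eq: "\<forall>\<^sub>F n in sequentially. (\<Sum>i<n. 1 * ((eps (Suc i) w)\<^sup>2 - 1)) / real n + 1 = (\<Sum>i=1..n. (eps i w)\<^sup>2) / real n"
      using eventually_gt_at_top[of 0]
    proof eventually_elim
      case (elim n)
      have "(\<Sum>i<n. (eps (Suc i) w)\<^sup>2) = (\<Sum>i=1..n. (eps i w)\<^sup>2)"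
        by (rule sum.reindex_bij_witness[of _ "\<lambda>i. i - 1" Suc]) auto
      then show ?case using elim by (simp add: sum_subtractf diff_divide_distrib)
    qed
    have "(\<lambda>n. (\<Sum>i<n. 1 * ((eps (Suc i) w)\<^sup>2 - 1)) / real n + 1) \<longlonglongrightarrow> 0 + 1"
      by (rule tendsto_add[OF elim tendsto_const])
    from Lim_transform_eventually[OF this eq] show ?case by (simp only: add_0)
  qed
qed

lemma autocovariance_average:
  fixes sig :: "nat \<Rightarrow> real"
  assumes sig: "\<And>n. n \<ge> 1 \<Longrightarrow> (sig n)\<^sup>2 \<le> 1" and lim: "(\<lambda>n. (sig (Suc n))\<^sup>2) \<longlonglongrightarrow> s"
  shows "AE w in M. \<forall>a b. a \<ge> 1 \<longrightarrow> b \<ge> 1 \<longrightarrow>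
    (\<lambda>N. (\<Sum>m<N. (sig (m + a) * eps (m + a) w) * (sig (m + b) * eps (m + b) w)) / real N) \<longlonglongrightarrow> (if a = b then s else 0)"
proof -
  define e where "e = (\<lambda>n w. sig n * eps n w)"
  have diag: "AE w in M. (\<lambda>n. (\<Sum>i<n. (e (Suc i) w)\<^sup>2) / real n) \<longlonglongrightarrow> s"
  proof -
    have "AE w in M. (\<lambda>n. (\<Sum>i<n. (sig (Suc i))\<^sup>2 * ((eps (Suc i) w)\<^sup>2 - 1)) / real n) \<longlonglongrightarrow> 0"
      by (rule weighted_squares_strong_law[of _ 1]) (use sig in auto)
    then show ?thesis
    proof eventually_elim
      case (elim w)
      have "(\<lambda>n. (\<Sum>i<n. (sig (Suc i))\<^sup>2 * ((eps (Suc i) w)\<^sup>2 - 1)) / real n + (\<Sum>i<n. (sig (Suc i))\<^sup>2) / real n) \<longlonglongrightarrow> 0 + s"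
        by (rule tendsto_add[OF elim Cesaro_tendsto[OF lim]])
      moreover have "(\<Sum>i<n. (sig (Suc i))\<^sup>2 * ((eps (Suc i) w)\<^sup>2 - 1)) / real n + (\<Sum>i<n. (sig (Suc i))\<^sup>2) / real n
          = (\<Sum>i<n. (e (Suc i) w)\<^sup>2) / real n" for n
        unfolding add_divide_distrib[symmetric] sum.distrib[symmetric] e_def
        by (intro arg_cong2[of _ _ _ _ "(/)"] sum.cong refl) (simp add: power_mult_distrib right_diff_distrib)
      ultimately show ?case by (simp only: add_0)
    qed
  qed
  have lag: "AE w in M. (\<lambda>n. (\<Sum>m=1..n. if m > l then e (m - l) w * e m w else 0) / real n) \<longlonglongrightarrow> 0"
    if l: "l \<ge> 1" for l
  proof -
    \<comment> \<open>A row with its only possibly nonzero entry at \<open>n - l\<close> turns the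
      lagged products into the sums of \<open>predictable_strong_law\<close>.\<close>
    define a where "a = (\<lambda>n i. if i + l = n then sig n * sig i else (0::real))"
    have F: "(\<Sum>i=1..<m. a m i * eps i w) = (if m > l then sig m * sig (m - l) * eps (m - l) w else 0)" for m w
    proof -
      have "(\<Sum>i=1..<m. a m i * eps i w) = (\<Sum>i=1..<m. if i = m - l \<and> m > l then sig m * sig i * eps i w else 0)"
        unfolding a_def by (intro sum.cong refl) auto
      also have "\<dots> = (if m > l then sig m * sig (m - l) * eps (m - l) w else 0)"
        using l by (cases "m > l") auto
      finally show ?thesis .
    qed
    have *: "AE w in M. (\<lambda>n. (\<Sum>m=1..n. (\<Sum>i=1..<m. a m i * eps i w) * eps m w) / real n) \<longlonglongrightarrow> 0"
    proof (rule predictable_strong_law)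
      fix n :: nat
      show "expectation (\<lambda>w. (\<Sum>i=1..<n. a n i * eps i w)\<^sup>2) \<le> 1"
      proof (cases "n > l")
        case True
        then have "expectation (\<lambda>w. (\<Sum>i=1..<n. a n i * eps i w)\<^sup>2) = (sig n)\<^sup>2 * (sig (n - l))\<^sup>2"
          unfolding F by (simp add: power_mult_distrib expectation_eps_square)
        also have "\<dots> \<le> 1 * 1" using True sig by (intro mult_mono) auto
        finally show ?thesis by simp
      next
        case False
        then show ?thesis unfolding F by simp
      qed
    qed
    have eq: "(\<Sum>i=1..<m. a m i * eps i w) * eps m w = (if m > l then e (m - l) w * e m w else 0)" for m w
      unfolding F e_def by simp
    show ?thesis using * unfolding eq .
  qed
  have "AE w in M. \<forall>l. l \<ge> 1 \<longrightarrow> (\<lambda>n. (\<Sum>m=1..n. if m > l then e (m - l) w * e m w else 0) / real n) \<longlonglongrightarrow> 0"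
    unfolding AE_all_countable
  proof
    fix l
    show "AE w in M. l \<ge> 1 \<longrightarrow> (\<lambda>n. (\<Sum>m=1..n. if m > l then e (m - l) w * e m w else 0) / real n) \<longlonglongrightarrow> 0"
      using lag[of l] by (cases "l \<ge> 1") simp_all
  qed
  with diag have "AE w in M. \<forall>a b. a \<ge> 1 \<longrightarrow> b \<ge> 1 \<longrightarrow>
    (\<lambda>N. (\<Sum>m<N. e (m + a) w * e (m + b) w) / real N) \<longlonglongrightarrow> (if a = b then s else 0)"
  proof eventually_elim
    case (elim w)
    have off: "(\<lambda>N. (\<Sum>m<N. e (m + a) w * e (m + b) w) / real N) \<longlonglongrightarrow> 0" if "a \<ge> 1" "a < b" for a b
    proof -
      define y where "y = (\<lambda>m. if m > b - a then e (m - (b - a)) w * e m w else 0)"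
      have eq: "(\<Sum>m=1..n. y m) = (\<Sum>i<n. y (Suc i))" for n
        by (rule sum.reindex_bij_witness[of _ Suc "\<lambda>i. i - 1"]) auto
      have "b - a \<ge> 1" using that by simp
      then have "(\<lambda>n. (\<Sum>m=1..n. y m) / real n) \<longlonglongrightarrow> 0"
        unfolding y_def by (rule elim(2)[rule_format])
      then have "(\<lambda>n. (\<Sum>i<n. y (Suc (i + (b - 1)))) / real n) \<longlonglongrightarrow> 0"
        unfolding eq by (rule Cesaro_shift)
      moreover have "y (Suc (i + (b - 1))) = e (i + a) w * e (i + b) w" for i
      proof -
        have "Suc (i + (b - 1)) = i + b" "i + b - (b - a) = i + a" "i + b > b - a" using that by auto
        then show ?thesis unfolding y_def by simp
      qed
      ultimately show ?thesis by (simp only:)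
    qed
    show ?case
    proof (intro allI impI)
      fix a b :: nat assume ab: "a \<ge> 1" "b \<ge> 1"
      consider "a = b" | "a < b" | "b < a" by linarith
      then show "(\<lambda>N. (\<Sum>m<N. e (m + a) w * e (m + b) w) / real N) \<longlonglongrightarrow> (if a = b then s else 0)"
      proof cases
        case 1
        have "(\<lambda>n. (\<Sum>i<n. (e (Suc (i + (a - 1))) w)\<^sup>2) / real n) \<longlonglongrightarrow> s"
          by (rule Cesaro_shift[OF elim(1)])
        moreover have "Suc (i + (a - 1)) = i + a" for i using ab by simp
        ultimately show ?thesis using 1 by (simp only: power2_eq_square simp_thms if_True)
      next
        case 2
        then have "a \<noteq> b" by simp
        with off[OF ab(1) 2] show ?thesis by (simp only: if_False)
      next
        case 3
        then have "a \<noteq> b" by simp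
        moreover have "(\<lambda>N. (\<Sum>m<N. e (m + a) w * e (m + b) w) / real N) \<longlonglongrightarrow> 0"
          using off[OF ab(2) 3] by (simp only: mult.commute)
        ultimately show ?thesis by (simp only: if_False)
      qed
    qed
  qed
  then show ?thesis unfolding e_def .
qed

text \<open>\<open>dom\<close> has the shape of the bound on one trajectory of a regressor. In
  expectation the noise energy up to \<open>m\<close> is at most \<open>m\<close>, which
  \<open>b m * real m <= C\<close> compensates, so each bracket contributes at most
  \<open>1 + K * C\<close> and the geometric weights sum to at most
  \<open>1 / (1 - q)\<close>.\<close>

lemma second_moment_bound:
  fixes sig b :: "nat \<Rightarrow> real"
  assumes q: "0 < q" "q < 1" and K: "K \<ge> 0" and b: "\<And>n. b n \<ge> 0" "\<And>n. b n * real n \<le> C"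
    and sig: "\<And>n. n \<ge> 1 \<Longrightarrow> (sig n)\<^sup>2 \<le> 1"
    and dom: "AE w in M. (\<Sum>i=1..n. a i * eps i w)\<^sup>2
      \<le> 2 * (K * (\<Sum>m=1..n. q ^ (n - m) * ((sig m * eps m w)\<^sup>2 + K * b (m - 1) * (\<Sum>i=1..m - 1. (sig i * eps i w)\<^sup>2))))
        + 2 * (K * b n * (\<Sum>i=1..n. (sig i * eps i w)\<^sup>2))"
  shows "expectation (\<lambda>w. (\<Sum>i=1..n. a i * eps i w)\<^sup>2) \<le> 2 * (K * ((1 + K * C) / (1 - q))) + 2 * (K * C)"
proof -
  have int: "integrable M (\<lambda>w. (sig m * eps m w)\<^sup>2)" if "m \<ge> 1" for m
    unfolding power_mult_distrib using integrable_eps_power[OF that, of 2] by simp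
  have E: "expectation (\<lambda>w. (sig m * eps m w)\<^sup>2) \<le> 1" if "m \<ge> 1" for m
    unfolding power_mult_distrib using expectation_eps_square[OF that] sig[OF that] by simp
  define T where "T = (\<lambda>m w. \<Sum>i=1..m. (sig i * eps i w)\<^sup>2)"
  have T_int: "integrable M (T m)" for m
    unfolding T_def by (intro Bochner_Integration.integrable_sum int) auto
  have T_E: "expectation (T m) \<le> real m" for m
  proof -
    have "expectation (T m) = (\<Sum>i=1..m. expectation (\<lambda>w. (sig i * eps i w)\<^sup>2))"
      unfolding T_def by (rule Bochner_Integration.integral_sum) (auto intro: int)
    also have "\<dots> \<le> (\<Sum>i=1..m. 1)" by (intro sum_mono E) auto
    finally show ?thesis by simp
  qed
  have bT: "K * b m * expectation (T m) \<le> K * C" for m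
  proof -
    have "b m * expectation (T m) \<le> b m * real m" by (intro mult_left_mono T_E b)
    also have "\<dots> \<le> C" by (rule b)
    finally show ?thesis using K unfolding mult.assoc by (rule mult_left_mono)
  qed
  define g where "g = (\<lambda>m w. (sig m * eps m w)\<^sup>2 + K * b (m - 1) * T (m - 1) w)"
  have g_int: "integrable M (g m)" if "m \<ge> 1" for m
    unfolding g_def by (intro Bochner_Integration.integrable_add int integrable_mult_right T_int that)
  have g_E: "expectation (g m) \<le> 1 + K * C" if "m \<ge> 1" for m
  proof -
    have "expectation (g m) = expectation (\<lambda>w. (sig m * eps m w)\<^sup>2) + K * b (m - 1) * expectation (T (m - 1))"
      unfolding g_def by (subst Bochner_Integration.integral_add) (use int[OF that] T_int in auto)
    then show ?thesis using E[OF that] bT[of "m - 1"] by linarith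
  qed
  define S where "S = (\<lambda>w. \<Sum>m=1..n. q ^ (n - m) * g m w)"
  have S_int: "integrable M S"
    unfolding S_def by (intro Bochner_Integration.integrable_sum integrable_mult_right g_int) auto
  have S_E: "expectation S \<le> (1 + K * C) / (1 - q)"
  proof -
    have C: "C \<ge> 0" using b(2)[of 0] by simp
    have "expectation S = (\<Sum>m=1..n. q ^ (n - m) * expectation (g m))"
      unfolding S_def by (subst Bochner_Integration.integral_sum) (use g_int in auto)
    also have "\<dots> \<le> (\<Sum>m=1..n. q ^ (n - m) * (1 + K * C))"
      using q by (intro sum_mono mult_left_mono g_E) auto
    also have "\<dots> = (\<Sum>m=1..n. q ^ (n - m)) * (1 + K * C)" by (simp only: sum_distrib_right)
    also have "\<dots> \<le> (1 / (1 - q)) * (1 + K * C)"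
      using K C by (intro mult_right_mono geometric_sum_le q) auto
    finally show ?thesis by simp
  qed
  have "expectation (\<lambda>w. (\<Sum>i=1..n. a i * eps i w)\<^sup>2) \<le> expectation (\<lambda>w. 2 * (K * S w) + 2 * (K * b n * T n w))"
  proof (rule integral_mono_AE)
    show "integrable M (\<lambda>w. (\<Sum>i=1..n. a i * eps i w)\<^sup>2)"
      using integrable_linear_square[of a "Suc n"] by (simp only: atLeastLessThanSuc_atLeastAtMost)
    show "AE w in M. (\<Sum>i=1..n. a i * eps i w)\<^sup>2 \<le> 2 * (K * S w) + 2 * (K * b n * T n w)"
      using dom unfolding S_def g_def T_def .
  qed (use S_int T_int in auto)
  also have "\<dots> = 2 * (K * expectation S) + 2 * (K * b n * expectation (T n))"
    using S_int T_int by (subst Bochner_Integration.integral_add) auto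
  also have "\<dots> \<le> 2 * (K * ((1 + K * C) / (1 - q))) + 2 * (K * C)"
    using bT[of n] K by (intro add_mono mult_left_mono S_E) auto
  finally show ?thesis .
qed

end

section \<open>Strong consistency of the estimator\<close>

lemma bigo_powr_summable:
  fixes g :: "nat \<Rightarrow> real"
  assumes "g \<in> O(\<lambda>n. real n powr (- \<alpha>))" "\<alpha> > 1"
  shows "summable g" and "(\<lambda>n. g n * real n) \<longlonglongrightarrow> 0"
proof -
  obtain C where C: "\<forall>\<^sub>F n in sequentially. norm (g n) \<le> C * norm (real n powr (- \<alpha>))"
    using assms(1) by (auto elim: landau_o.bigE)
  have "summable (\<lambda>n. C * real n powr (- \<alpha>))"
    using assms(2) by (intro summable_mult) (simp add: summable_real_powr_iff)
  then show "summable g"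
    by (rule summable_comparison_test_ev[rotated]) (use C in simp)
  have lim: "(\<lambda>n. C * real n powr (1 - \<alpha>)) \<longlonglongrightarrow> 0"
    by (rule tendsto_mult_right_zero[OF tendsto_neg_powr[OF _ filterlim_real_sequentially]]) (use assms(2) in simp)
  have "\<forall>\<^sub>F n in sequentially. norm (g n * real n) \<le> C * real n powr (1 - \<alpha>)"
    using C eventually_gt_at_top[of 0]
  proof eventually_elim
    case (elim n)
    have "real n powr (1 - \<alpha>) = real n powr (- \<alpha>) * real n"
      using elim(2) powr_add[of "real n" "- \<alpha>" 1] by (simp add: add.commute)
    moreover have "norm (g n) * real n \<le> C * real n powr (- \<alpha>) * real n"
      using elim(1) by (intro mult_right_mono) auto
    ultimately show ?case by (simp add: abs_mult mult.assoc)
  qed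
  then show "(\<lambda>n. g n * real n) \<longlonglongrightarrow> 0"
    using lim by (rule Lim_null_comparison)
qed

theorem theorem3p1:
  fixes M :: "'w measure"
    and p :: nat
    and xi eps :: "nat \<Rightarrow> 'w \<Rightarrow> real"
    and sig :: "nat \<Rightarrow> real"
    and k :: "nat \<Rightarrow> nat \<Rightarrow> real"
    and f :: "real \<Rightarrow> real"
    and X :: "int \<Rightarrow> 'w \<Rightarrow> real"
    and \<theta> :: "real Matrix.vec"
    and \<alpha>1 \<alpha>2 :: real
  assumes "prob_space M"
    and "p \<ge> 1"
    and "stationary_centered_gaussian M xi"
    and "covariance_function M xi 0 = 1"
    and "spectral_density (covariance_function M xi) f"
    and "innovation_decomposition M xi sig eps k"
    and "\<theta> \<in> Theta p"
    and "ar_model M p \<theta> xi X"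
    and "\<alpha>1 > 0"
    and "covariance_function M xi \<in> O(\<lambda>n. real n powr (- \<alpha>1))"
    and "(\<integral>\<^sup>+ l \<in> {-pi..pi}. abs_log (f l) \<partial>lborel) < \<infinity>"
    and "\<alpha>2 > 1"
    and "(\<lambda>n. (pacf k n)\<^sup>2) \<in> O(\<lambda>n. real n powr (- \<alpha>2))"
  shows "AE w in M. estimator_tendsto p (\<lambda>n. mle p k sig (\<lambda>m. X m w) n) \<theta>"
proof -
  interpret prob_space M by fact
  have sig1: "sig 1 = 1" and sig_pos: "\<And>n. n \<ge> 1 \<Longrightarrow> sig n > 0"
    and k_diag: "\<And>n. n \<ge> 1 \<Longrightarrow> k n n = 1"
    and dec: "\<And>n. n \<ge> 1 \<Longrightarrow> AE w in M. sig n * eps n w = (\<Sum>i=1..n. k n i * xi i w)"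
    and indep: "indep_vars (\<lambda>_. borel) eps {1..}"
    and normal: "\<And>n. n \<ge> 1 \<Longrightarrow> distributed M lborel (eps n) (\<lambda>x. ennreal (std_normal_density x))"
    using assms(6) unfolding innovation_decomposition_def by blast+
  interpret W: gaussian_white_noise M eps
    by unfold_locales (use indep normal in auto)
  have xi_meas: "xi n \<in> borel_measurable M" if "n \<ge> 1" for n
  proof -
    have "\<forall>I c. finite I \<longrightarrow> I \<subseteq> {1..} \<longrightarrow> gaussian_rv M (\<lambda>w. \<Sum>i\<in>I. c i * xi i w)"
      using assms(3) unfolding stationary_centered_gaussian_def gaussian_process_def by blast
    then have "gaussian_rv M (\<lambda>w. \<Sum>i\<in>{n}. 1 * xi i w)"
      using that by (elim allE[of _ "{n}"] allE[of _ "\<lambda>_. 1"]) auto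
    then show ?thesis unfolding gaussian_rv_def by simp
  qed
  \<comment> \<open>The even extension to integer lags, so that the covariances can be indexed by
    differences of times in either order.\<close>
  define r where "r = (\<lambda>z. covariance_function M xi (nat \<bar>z\<bar>))"
  have cov_le: "expectation (\<lambda>w. xi i w * xi j w) = covariance_function M xi (j - i)" if "1 \<le> i" "i \<le> j" for i j
  proof -
    have "\<forall>m\<ge>1. \<forall>n. integral\<^sup>L M (\<lambda>w. xi m w * xi (m + n) w) = covariance_function M xi n"
      using assms(3) unfolding stationary_centered_gaussian_def by blast
    then have "integral\<^sup>L M (\<lambda>w. xi i w * xi (i + (j - i)) w) = covariance_function M xi (j - i)"
      using that(1) by blast
    then show ?thesis using that(2) by simp
  qed
  have cov: "expectation (\<lambda>w. xi i w * xi j w) = r (int i - int j)" if "1 \<le> i" "1 \<le> j" for i j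
  proof (cases "i \<le> j")
    case True
    then have eq: "nat \<bar>int i - int j\<bar> = j - i" by simp
    show ?thesis unfolding r_def eq by (rule cov_le[OF that(1) True])
  next
    case False
    then have eq: "nat \<bar>int i - int j\<bar> = i - j" and ji: "j \<le> i" by simp_all
    show ?thesis unfolding r_def eq using cov_le[OF that(2) ji] by (simp add: mult.commute)
  qed
  interpret Y: yule_walker r k "\<lambda>n. (sig n)\<^sup>2"
  proof
    show "r (- z) = r z" for z unfolding r_def by simp
    show "(sig n)\<^sup>2 > 0" if "n \<ge> 1" for n using sig_pos[OF that] by simp
    fix n j :: nat assume j: "1 \<le> j" "j \<le> n"
    have "(\<Sum>i=1..n. k n i * r (int i - int j)) = (\<Sum>i=1..n. k n i * expectation (\<lambda>w. xi i w * xi j w))"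
      using cov j(1) by (intro sum.cong refl) simp
    also have "\<dots> = (if j = n then (sig n)\<^sup>2 else 0)"
      by (rule W.innovation_orthogonality) (use xi_meas k_diag dec j in auto)
    finally show "(\<Sum>i=1..n. k n i * r (int i - int j)) = (if j = n then (sig n)\<^sup>2 else 0)" .
  qed (rule k_diag)
  define \<beta> where "\<beta> = pacf k"
  have \<beta>_summable: "summable (\<lambda>n. (\<beta> n)\<^sup>2)" and \<beta>_lim: "(\<lambda>n. (\<beta> n)\<^sup>2 * real n) \<longlonglongrightarrow> 0"
    unfolding \<beta>_def using bigo_powr_summable[OF assms(13,12)] .
  obtain C where C: "\<And>n. (\<beta> n)\<^sup>2 * real n \<le> C"
  proof -
    have "Bseq (\<lambda>n. (\<beta> n)\<^sup>2 * real n)" by (rule convergent_imp_Bseq[OF convergentI[OF \<beta>_lim]])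
    then obtain C where "\<And>n. norm ((\<beta> n)\<^sup>2 * real n) \<le> C" unfolding Bseq_def by blast
    then show ?thesis by (intro that[of C]) (metis abs_ge_self order_trans real_norm_def)
  qed
  \<comment> \<open>The shift starts the product at \<open>sig 1\<close> and
    \<open>\<beta> 1\<close>; the convention \<open>\<beta> 0 = 1\<close> would give a vanishing
    first factor.\<close>
  obtain s where s: "s > 0" "(\<lambda>n. (sig (Suc n))\<^sup>2) \<longlonglongrightarrow> s" "\<And>n. s \<le> (sig (Suc n))\<^sup>2"
  proof (rule discounted_product_limit[of "\<lambda>n. (sig (Suc n))\<^sup>2" "\<lambda>n. (\<beta> (Suc n))\<^sup>2"])
    show "(sig (Suc n))\<^sup>2 > 0" for n using sig_pos[of "Suc n"] by simp
    show "(sig (Suc (Suc n)))\<^sup>2 = (sig (Suc n))\<^sup>2 * (1 - (\<beta> (Suc n))\<^sup>2)" for n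
      using Y.innovation_variance_Suc[of "Suc n"] by (simp add: \<beta>_def pacf_def)
    show "summable (\<lambda>n. (\<beta> (Suc n))\<^sup>2)" 
      by (rule iffD2[OF summable_Suc_iff[of "\<lambda>n. (\<beta> n)\<^sup>2"] \<beta>_summable])
  qed (rule zero_le_power2, rule that)
  have s_le: "s \<le> (sig n)\<^sup>2" if "n \<ge> 1" for n
    using s(3)[of "n - 1"] that by simp
  have sig_le: "(sig n)\<^sup>2 \<le> 1" if "n \<ge> 1" for n
    using that
  proof (induction n rule: nat_induct_at_least)
    case (Suc n)
    have "(sig (Suc n))\<^sup>2 = (sig n)\<^sup>2 * (1 - (k (Suc n) 1)\<^sup>2)"
      by (rule Y.innovation_variance_Suc[OF Suc.hyps])
    also have "\<dots> \<le> (sig n)\<^sup>2" by (simp add: mult_left_le)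
    finally show ?case using Suc.IH by simp
  qed (use sig1 in simp)
  have \<theta>: "\<theta> \<in> carrier_vec p"
    and sr: "spectral_radius (map_mat complex_of_real (companion p \<theta>)) < 1"
    using assms(7) unfolding Theta_def by auto
  define A where "A = companion p \<theta>"
  have A: "A \<in> carrier_mat p p" unfolding A_def companion_def by simp
  have A_0: "A $$ (0, l) = \<theta> $ l" if "l < p" for l
    using that unfolding A_def companion_def by simp
  have A_Suc: "(\<Sum>l<p. A $$ (Suc j, l) * y l) = y j" if "Suc j < p" for j and y :: "nat \<Rightarrow> real"
  proof -
    have "(\<Sum>l<p. A $$ (Suc j, l) * y l) = (\<Sum>l<p. if l = j then y l else 0)"
      using that unfolding A_def companion_def by (intro sum.cong refl) auto
    then show ?thesis using that by simp
  qed
  obtain c q where q: "0 < q" "q < 1"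
    and Aq: "\<And>m i j. i < p \<Longrightarrow> j < p \<Longrightarrow> \<bar>(A ^\<^sub>m m) $$ (i, j)\<bar> \<le> c * q ^ m"
  proof (rule spectral_radius_lt_1_geometric_bound[OF A _ sr[folded A_def]])
    show "p > 0" using assms(2) by simp
  qed (rule that)
  define e where "e = (\<lambda>w n. sig n * eps n w)"
  define x where "x = (\<lambda>w m. X m w)"
  \<comment> \<open>One event of full measure on which all innovations equal their linear filters
    exactly; from here the recursions are statements about single trajectories.\<close>
  define G where "G = {w \<in> space M. \<forall>n\<ge>1. sig n * eps n w = (\<Sum>i=1..n. k n i * xi i w)}"
  have "AE w in M. \<forall>n. n \<ge> 1 \<longrightarrow> sig n * eps n w = (\<Sum>i=1..n. k n i * xi i w)"
    unfolding AE_all_countable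
  proof
    fix n
    show "AE w in M. n \<ge> 1 \<longrightarrow> sig n * eps n w = (\<Sum>i=1..n. k n i * xi i w)"
      using dec[of n] by (cases "n \<ge> 1") simp_all
  qed
  then have AE_G: "AE w in M. w \<in> G"
    using AE_space by eventually_elim (simp add: G_def)
  have x_neg: "x w m = 0" if "w \<in> G" "m \<le> 0" for w m
    using assms(8) that unfolding ar_model_def G_def x_def by blast
  have x_rec: "x w n = (\<Sum>l=1..p. \<theta> $ (l - 1) * x w (n - int l)) + xi (nat n) w" if "w \<in> G" "n \<ge> 1" for w n
    using assms(8) that unfolding ar_model_def G_def x_def by blast
  have f_Suc_Suc: "filtered k (x w) (Suc n) (Suc j) = regressor k (x w) n j" if "w \<in> G" for w n j
    by (rule Y.filtered_Suc_Suc) (use x_neg that in auto)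
  have f_Suc_0: "filtered k (x w) (Suc n) 0 = (\<Sum>l<p. \<theta> $ l * regressor k (x w) n l) + e w (Suc n)"
    if w: "w \<in> G" for w n
  proof -
    have "filtered k (x w) (Suc n) 0 = (\<Sum>l<p. \<theta> $ l * regressor k (x w) n l) + (\<Sum>i=1..Suc n. k (Suc n) i * xi i w)"
      by (rule Y.filtered_Suc_0) (use x_neg[OF w] x_rec[OF w] in auto)
    also have "(\<Sum>i=1..Suc n. k (Suc n) i * xi i w) = e w (Suc n)"
      using w unfolding G_def e_def by simp
    finally show ?thesis .
  qed
  have f_0: "filtered k (x w) 0 j = 0" for w j by (simp add: filtered_def)
  have f_rec: "filtered k (x w) (Suc n) j = (\<Sum>l<p. A $$ (j, l) * (filtered k (x w) n l + memory k (x w) n l))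
      + (if j = 0 then e w (Suc n) else 0)" if w: "w \<in> G" and j: "j < p" for w n j
  proof (cases j)
    case 0
    then show ?thesis using f_Suc_0[OF w] A_0 by (simp add: regressor_def)
  next
    case (Suc i)
    then show ?thesis using f_Suc_Suc[OF w] A_Suc[of i] j by (simp add: regressor_def)
  qed
  have memory_eq: "memory k (x w) n j = \<beta> n * (\<Sum>m=1..<n. \<beta> m * filtered k (x w) m j)" for w n j
    unfolding memory_def \<beta>_def ..
  \<comment> \<open>\<open>K\<close> is fixed before any \<open>w\<close>, so it is nonrandom and
    may be used inside expectations.\<close>
  obtain K where K': "0 \<le> K \<and> (\<forall>z u e.
    (\<forall>j<p. z 0 j = 0) \<longrightarrow>
    (\<forall>n. \<forall>j<p. z (Suc n) j = (\<Sum>l<p. A $$ (j, l) * (z n l + u n l)) + (if j = 0 then e (Suc n) else 0)) \<longrightarrow>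
    (\<forall>n. \<forall>j<p. u n j = \<beta> n * (\<Sum>m=1..<n. \<beta> m * z m j)) \<longrightarrow>
    (\<forall>n. \<forall>j<p. (z n j)\<^sup>2 \<le> K * (\<Sum>m=1..n. q ^ (n - m) * ((e m)\<^sup>2 + (\<Sum>l<p. (u (m - 1) l)\<^sup>2)))) \<and>
    (\<forall>n. (\<Sum>l<p. (u n l)\<^sup>2) \<le> K * (\<beta> n)\<^sup>2 * (\<Sum>i=1..n. (e i)\<^sup>2)))"
  proof (rule exE[OF perturbed_recursion_bound[where P = "\<lambda>m i j. (A ^\<^sub>m m) $$ (i, j)", OF _ _ Aq q \<beta>_summable]])
    show "(A ^\<^sub>m 0) $$ (j, l) = (if j = l then 1 else 0)" if "j < p" "l < p" for j l
      using that A by simp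
    show "(A ^\<^sub>m Suc m) $$ (j, l) = (\<Sum>i<p. A $$ (j, i) * (A ^\<^sub>m m) $$ (i, l))" if "j < p" "l < p" for m j l
    proof -
      have "A ^\<^sub>m m \<in> carrier_mat p p" using A by simp
      then show ?thesis
        unfolding pow_mat_Suc_left[OF A] using that A by (simp add: scalar_prod_def lessThan_atLeast0 del: pow_mat.simps)
    qed
  qed (assumption | rule that)+
  note K = conjunct1[OF K'] and K_bound = conjunct2[OF K']
  have bounds: "(\<forall>n. \<forall>j<p. (filtered k (x w) n j)\<^sup>2
      \<le> K * (\<Sum>m=1..n. q ^ (n - m) * ((e w m)\<^sup>2 + (\<Sum>l<p. (memory k (x w) (m - 1) l)\<^sup>2)))) \<and>
    (\<forall>n. (\<Sum>l<p. (memory k (x w) n l)\<^sup>2) \<le> K * (\<beta> n)\<^sup>2 * (\<Sum>i=1..n. (e w i)\<^sup>2))" if "w \<in> G" for w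
    by (rule K_bound[THEN spec, THEN spec, THEN spec, THEN mp, THEN mp, THEN mp])
      (intro allI impI f_0 f_rec[OF that] memory_eq; assumption)+
  have memory_le: "(memory k (x w) n j)\<^sup>2 \<le> K * (\<beta> n)\<^sup>2 * (\<Sum>i=1..n. (e w i)\<^sup>2)" if "w \<in> G" "j < p" for w n j
  proof -
    have "(memory k (x w) n j)\<^sup>2 \<le> (\<Sum>l<p. (memory k (x w) n l)\<^sup>2)"
      using that(2) by (intro member_le_sum) auto
    also have "\<dots> \<le> K * (\<beta> n)\<^sup>2 * (\<Sum>i=1..n. (e w i)\<^sup>2)" using bounds[OF that(1)] by blast
    finally show ?thesis .
  qed
  have regressor_le: "(regressor k (x w) n j)\<^sup>2
      \<le> 2 * (K * (\<Sum>m=1..n. q ^ (n - m) * ((e w m)\<^sup>2 + K * (\<beta> (m - 1))\<^sup>2 * (\<Sum>i=1..m - 1. (e w i)\<^sup>2))))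
        + 2 * (K * (\<beta> n)\<^sup>2 * (\<Sum>i=1..n. (e w i)\<^sup>2))" if w: "w \<in> G" and j: "j < p" for w n j
  proof -
    have "(regressor k (x w) n j)\<^sup>2 \<le> 2 * (filtered k (x w) n j)\<^sup>2 + 2 * (memory k (x w) n j)\<^sup>2"
      unfolding regressor_def by (rule square_add_le)
    also have "(filtered k (x w) n j)\<^sup>2
      \<le> K * (\<Sum>m=1..n. q ^ (n - m) * ((e w m)\<^sup>2 + (\<Sum>l<p. (memory k (x w) (m - 1) l)\<^sup>2)))"
      using bounds[OF w] j by blast
    also have "\<dots> \<le> K * (\<Sum>m=1..n. q ^ (n - m) * ((e w m)\<^sup>2 + K * (\<beta> (m - 1))\<^sup>2 * (\<Sum>i=1..m - 1. (e w i)\<^sup>2)))"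
      using bounds[OF w] q K by (intro mult_left_mono sum_mono add_left_mono) auto
    finally show ?thesis using memory_le[OF w j, of n] by linarith
  qed
  have span: "\<exists>a. \<forall>w\<in>G. regressor k (x w) n j = (\<Sum>i=1..n. a i * eps i w)" if "j < p" for n j
    using perturbed_recursion_in_span[where z = "\<lambda>w. filtered k (x w)" and u = "\<lambda>w. memory k (x w)"
        and G = G and s = sig and A = "\<lambda>j l. A $$ (j, l)" and \<beta> = \<beta> and eps = eps and p = p and j = j and n = n]
      f_0 f_rec memory_eq that
    unfolding in_span_def regressor_def e_def by blast
  \<comment> \<open>A choice of coefficients independent of \<open>w\<close>, as the strong law
    requires.\<close>
  define a where "a = (\<lambda>n j. SOME a. \<forall>w\<in>G. regressor k (x w) n j = (\<Sum>i=1..n. a i * eps i w))"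
  have a: "regressor k (x w) n j = (\<Sum>i=1..n. a n j i * eps i w)" if "j < p" "w \<in> G" for n j w
    using someI_ex[OF span[OF that(1)]] that(2) unfolding a_def by (rule bspec)
  have noise: "AE w in M. (\<lambda>n. (\<Sum>i=1..n. regressor k (x w) (i - 1) j * e w i / (sig i)\<^sup>2) / real n) \<longlonglongrightarrow> 0"
    if j: "j < p" for j
  proof -
    define D where "D = 2 * (K * ((1 + K * C) / (1 - q))) + 2 * (K * C)"
    have moment: "expectation (\<lambda>w. (\<Sum>i=1..n. a n j i * eps i w)\<^sup>2) \<le> D" for n
      unfolding D_def
    proof (rule W.second_moment_bound[where b = "\<lambda>n. (\<beta> n)\<^sup>2", OF q K])
      show "AE w in M. (\<Sum>i=1..n. a n j i * eps i w)\<^sup>2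
          \<le> 2 * (K * (\<Sum>m=1..n. q ^ (n - m) * ((sig m * eps m w)\<^sup>2 + K * (\<beta> (m - 1))\<^sup>2 * (\<Sum>i=1..m - 1. (sig i * eps i w)\<^sup>2))))
        + 2 * (K * (\<beta> n)\<^sup>2 * (\<Sum>i=1..n. (sig i * eps i w)\<^sup>2))"
        using AE_G
      proof eventually_elim
        case (elim w)
        show ?case using regressor_le[OF elim j, of n] unfolding a[OF j elim] e_def .
      qed
    qed (use C sig_le in auto)
    \<comment> \<open>For \<open>n = 0\<close> the moment is that of an empty sum. The sign is
      needed to replace \<open>D / (sig n)^2\<close> by \<open>D / s\<close>.\<close>
    have D: "D \<ge> 0"
      using moment[of 0] by simp
    \<comment> \<open>One factor \<open>sig m\<close> of the noise cancels against the weight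
      \<open>1 / (sig m)^2\<close>; the other goes into the coefficients. The row
      \<open>m - 1\<close> makes the linear form predictable.\<close>
    have "AE w in M. (\<lambda>n. (\<Sum>m=1..n. (\<Sum>i=1..<m. (a (m - 1) j i / sig m) * eps i w) * eps m w) / real n) \<longlonglongrightarrow> 0"
    proof (rule W.predictable_strong_law)
      fix n :: nat assume n: "n \<ge> 1"
      have "(\<Sum>i=1..<n. (a (n - 1) j i / sig n) * eps i w) = (\<Sum>i=1..n - 1. a (n - 1) j i * eps i w) / sig n" for w
      proof -
        have "{1..<n} = {1..n - 1}" using n by auto
        then show ?thesis by (simp add: sum_divide_distrib)
      qed
      then have "expectation (\<lambda>w. (\<Sum>i=1..<n. (a (n - 1) j i / sig n) * eps i w)\<^sup>2)
          = expectation (\<lambda>w. (\<Sum>i=1..n - 1. a (n - 1) j i * eps i w)\<^sup>2) / (sig n)\<^sup>2"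
        by (simp add: power_divide)
      also have "\<dots> \<le> D / s"
        by (rule frac_le[OF D moment s(1) s_le[OF n]])
      finally show "expectation (\<lambda>w. (\<Sum>i=1..<n. (a (n - 1) j i / sig n) * eps i w)\<^sup>2) \<le> D / s" .
    qed
    with AE_G show ?thesis
    proof eventually_elim
      case (elim w)
      have "(\<Sum>i=1..<m. (a (m - 1) j i / sig m) * eps i w) * eps m w
          = regressor k (x w) (m - 1) j * e w m / (sig m)\<^sup>2" if "m \<in> {1..n}" for m n
      proof -
        have "{1..<m} = {1..m - 1}" using that by auto
        then show ?thesis
          using that sig_pos[of m] unfolding a[OF j elim(1)] e_def
          by (simp add: sum_divide_distrib[symmetric] power2_eq_square)
      qed
      then have "(\<Sum>m=1..n. (\<Sum>i=1..<m. (a (m - 1) j i / sig m) * eps i w) * eps m w)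
          = (\<Sum>i=1..n. regressor k (x w) (i - 1) j * e w i / (sig i)\<^sup>2)" for n
        by (intro sum.cong refl)
      then show ?case using elim(2) by (simp only:)
    qed
  qed
  then have noise_all: "AE w in M. \<forall>j\<in>{..<p}.
      (\<lambda>n. (\<Sum>i=1..n. regressor k (x w) (i - 1) j * e w i / (sig i)\<^sup>2) / real n) \<longlonglongrightarrow> 0"
    by (intro AE_finite_allI) auto
  have autocov: "AE w in M. \<forall>a b. a \<ge> 1 \<longrightarrow> b \<ge> 1 \<longrightarrow>
      (\<lambda>N. (\<Sum>m<N. e w (m + a) * e w (m + b)) / real N) \<longlonglongrightarrow> (if a = b then s else 0)"
    unfolding e_def by (rule W.autocovariance_average[OF _ s(2)]) (rule sig_le)
  have "AE w in M. estimator_tendsto p (mle p k sig (x w)) \<theta>"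
    using AE_G noise_all W.noise_energy_average autocov
  proof eventually_elim
    case (elim w)
    note w = elim(1)
    have energy: "(\<Sum>i=1..n. (e w i)\<^sup>2) \<le> (\<Sum>i=1..n. (eps i w)\<^sup>2)" for n
      unfolding e_def power_mult_distrib using sig_le by (intro sum_mono) (auto intro: mult_left_le_one_le)
    have memory_lim: "(\<lambda>n. memory k (x w) n j) \<longlonglongrightarrow> 0" if j: "j < p" for j
    proof -
      \<comment> \<open>The energy is compared with its average: \<open>(\<beta> n)^2 * n\<close>
        tends to 0 and the energy per time step to 1.\<close>
      have "(\<lambda>n. K * ((\<beta> n)\<^sup>2 * real n) * ((\<Sum>i=1..n. (eps i w)\<^sup>2) / real n)) \<longlonglongrightarrow> K * 0 * 1"
        by (intro tendsto_mult tendsto_const \<beta>_lim elim(3))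
      then have lim: "(\<lambda>n. K * ((\<beta> n)\<^sup>2 * real n) * ((\<Sum>i=1..n. (eps i w)\<^sup>2) / real n)) \<longlonglongrightarrow> 0"
        by (simp only: mult_zero_right mult_zero_left)
      have "(memory k (x w) n j)\<^sup>2 \<le> K * ((\<beta> n)\<^sup>2 * real n) * ((\<Sum>i=1..n. (eps i w)\<^sup>2) / real n)" for n
      proof -
        have "(memory k (x w) n j)\<^sup>2 \<le> K * (\<beta> n)\<^sup>2 * (\<Sum>i=1..n. (e w i)\<^sup>2)" by (rule memory_le[OF w j])
        also have "\<dots> \<le> K * (\<beta> n)\<^sup>2 * (\<Sum>i=1..n. (eps i w)\<^sup>2)"
          using K by (intro mult_left_mono energy) auto
        also have "\<dots> = K * ((\<beta> n)\<^sup>2 * real n) * ((\<Sum>i=1..n. (eps i w)\<^sup>2) / real n)"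
          by (cases "n = 0") auto
        finally show ?thesis .
      qed
      then have "(\<lambda>n. (memory k (x w) n j)\<^sup>2) \<longlonglongrightarrow> 0"
        by (intro tendsto_sandwich[OF _ _ tendsto_const lim] always_eventually allI zero_le_power2)
      then show ?thesis by (subst (asm) power_tendsto_0_iff) simp_all
    qed
    \<comment> \<open>The regressor at \<open>Suc n\<close> is the filtered vector plus the memory
      at \<open>Suc n\<close>, so it follows the autoregression up to the memory, which is the
      vanishing error \<open>d\<close>.\<close>
    obtain c where c: "c > 0" "\<forall>\<^sub>F n in sequentially. \<forall>v. c * real n * (\<Sum>j<p. (v j)\<^sup>2) \<le> (\<Sum>i<n. (\<Sum>j<p. v j * regressor k (x w) i j)\<^sup>2)"
    proof (rule excitation_lower_bound[where h = "regressor k (x w)" and d = "memory k (x w)" and e = "e w"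
          and th = "\<lambda>l. \<theta> $ l", OF assms(2) s(1)])
      show "regressor k (x w) (Suc n) 0 = (\<Sum>l<p. \<theta> $ l * regressor k (x w) n l) + e w (Suc n) + memory k (x w) (Suc n) 0" for n
        using f_Suc_0[OF w] by (simp add: regressor_def[of _ _ "Suc n"])
      show "regressor k (x w) (Suc n) (Suc j) = regressor k (x w) n j + memory k (x w) (Suc n) (Suc j)" for n j
        using f_Suc_Suc[OF w] by (simp add: regressor_def[of _ _ "Suc n"])
      show "(\<lambda>N. (\<Sum>m<N. e w (m + a) * e w (m + b)) / real N) \<longlonglongrightarrow> (if a = b then s else 0)"
        if "a \<ge> 1" "b \<ge> 1" for a b
        using elim(4)[rule_format, OF that] .
    qed (use memory_lim in auto)
    show ?case
    proof (rule estimator_tendsto_of_excitation[where e = "e w", OF assms(2) \<theta> c(1) _ _ c(2)])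
      show "0 < sig n \<and> (sig n)\<^sup>2 \<le> 1" if "n \<ge> 1" for n
        using sig_pos[OF that] sig_le[OF that] by simp
      show "filtered k (x w) (Suc n) 0 = (\<Sum>l<p. \<theta> $ l * regressor k (x w) n l) + e w (Suc n)" for n
        by (rule f_Suc_0[OF w])
      show "(\<lambda>n. (\<Sum>i=1..n. regressor k (x w) (i - 1) j * e w i / (sig i)\<^sup>2) / real n) \<longlonglongrightarrow> 0"
        if "j < p" for j
        using elim(2) that by (rule bspec[OF _ lessThan_iff[THEN iffD2]])
    qed
  qed
  then show ?thesis unfolding x_def .
qed

end
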